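(* Let $J\in\mathbb{R}^{n\times n}$ be a symmetric matrix with $\|J\|_1<1$, and let $\mu=\mu_J$ be the zero-field Ising model on $\{\pm1\}^n$ with interaction matrix $J$, i.e. $\mu_J(x)=\frac1{Z_J}\exp\left(\frac12x^\top Jx\right)$ with $Z_J=\sum_{x\in\{\pm1\}^n}\exp\left(\frac12x^\top Jx\right)$. Then there is a constant $C>0$, depending only on $\|J\|_1$ (and not on $n$), such that for every $f:\{\pm1\}^n\to\{\pm1\}$: (1) $\displaystyle \max_{i\in[n]}\mathsf{Inf}_{\mu,i}(f)\ge C\,\frac{\log n}{n}\,\mathrm{Var}_\mu(f)$; (2) $\displaystyle C\,\mathrm{Var}_\mu(f)\le\sum_{i=1}^n\frac{\mathsf{Inf}_{\mu,i}(f)}{1+\log(1/\mathsf{Inf}_{\mu,i}(f))}$; (3) $\displaystyle \mathsf{SA}_\mu(f)\ge C\,\mathrm{Var}_\mu(f)\sqrt{\log\left(\frac{e}{\mathrm{Var}_\mu(f)}\right)}$; (4) $\displaystyle \mathsf{SA}_\mu(f)\ge C\,\mathrm{Var}_\mu(f)\sqrt{\log\left(1+\frac{e}{\mathsf{SqInf}_\mu(f)}\right)}$.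
   Context: Notation: $[n]=\{1,\dots,n\}$; $x^i$ is $x\in\{\pm1\}^n$ with its $i$-th coordinate flipped; $\log$ is natural; $\|J\|_1=\max_j\sum_i|J_{ij}|$. For $f:\{\pm1\}^n\to\{\pm1\}$, the sensitivity is $s(f)(x)=\#\{i\in[n]: f(x^i)\ne f(x)\}$, and $\mathsf{Inf}_{\mu,i}(f)=\Pr_{x\sim\mu}[f(x^i)\neq f(x)]$, $\;\mathsf{SA}_\mu(f)=\mathbb{E}_\mu[\sqrt{s(f)}]$, $\;\mathsf{SqInf}_\mu(f)=\sum_{i=1}^n\mathsf{Inf}_{\mu,i}(f)^2$, $\;\mathrm{Var}_\mu(f)=\mathbb{E}_\mu[f^2]-(\mathbb{E}_\mu f)^2$. Conventions: a summand in (2) is $0$ if $\mathsf{Inf}_{\mu,i}(f)=0$; the right-hand sides of (3) and (4) are $0$ if $\mathrm{Var}_\mu(f)=0$. *)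

theory Defs
  imports "HOL-Probability.Probability"
begin

text \<open>The dimension \<open>n\<close> has to be quantified after the constant, so it cannot be a type. An n-by-n
  real matrix is a function \<open>nat \<Rightarrow> nat \<Rightarrow> real\<close> of which only the entries with
  both indices in \<open>{1..n}\<close> are ever used. A point of the cube is an extensional function on
  \<open>{1..n}\<close>, which makes the cube a finite set with \<open>2 ^ n\<close> elements.\<close>

definition cube :: "nat \<Rightarrow> (nat \<Rightarrow> real) set" where
  "cube n = {1..n} \<rightarrow>\<^sub>E {-1, 1}"

definition symmetric_matrix :: "nat \<Rightarrow> (nat \<Rightarrow> nat \<Rightarrow> real) \<Rightarrow> bool" where
  "symmetric_matrix n J \<longleftrightarrow> (\<forall>i\<in>{1..n}. \<forall>j\<in>{1..n}. J i j = J j i)"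

text \<open>Only used for \<open>n \<ge> 1\<close>, where the maximum is over a nonempty set.\<close>

definition norm1 :: "nat \<Rightarrow> (nat \<Rightarrow> nat \<Rightarrow> real) \<Rightarrow> real" where
  "norm1 n J = (MAX j\<in>{1..n}. \<Sum>i\<in>{1..n}. \<bar>J i j\<bar>)"

definition ising_weight :: "nat \<Rightarrow> (nat \<Rightarrow> nat \<Rightarrow> real) \<Rightarrow> (nat \<Rightarrow> real) \<Rightarrow> real" where
  "ising_weight n J x = exp (1 / 2 * (\<Sum>i\<in>{1..n}. \<Sum>j\<in>{1..n}. x i * J i j * x j))"

definition ising_Z :: "nat \<Rightarrow> (nat \<Rightarrow> nat \<Rightarrow> real) \<Rightarrow> real" where
  "ising_Z n J = (\<Sum>x\<in>cube n. ising_weight n J x)"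

definition ising :: "nat \<Rightarrow> (nat \<Rightarrow> nat \<Rightarrow> real) \<Rightarrow> (nat \<Rightarrow> real) pmf" where
  "ising n J = embed_pmf (\<lambda>x. if x \<in> cube n then ising_weight n J x / ising_Z n J else 0)"

lemma finite_cube: "finite (cube n)"
  unfolding cube_def by (intro finite_PiE) auto

lemma cube_nonempty: "cube n \<noteq> {}"
  unfolding cube_def by (simp add: PiE_eq_empty_iff)

lemma ising_Z_pos: "ising_Z n J > 0"
  unfolding ising_Z_def
  by (intro sum_pos finite_cube cube_nonempty) (simp add: ising_weight_def)

text \<open>\<open>embed_pmf\<close> is meaningful only for a nonnegative function of total mass one, which the
  following lemma establishes.\<close>

lemma pmf_ising:
  "pmf (ising n J) x = (if x \<in> cube n then ising_weight n J x / ising_Z n J else 0)"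
proof -
  let ?p = "\<lambda>x. if x \<in> cube n then ising_weight n J x / ising_Z n J else 0"
  have nn: "?p y \<ge> 0" for y
    using ising_Z_pos[of n J] by (simp add: ising_weight_def)
  have "(\<integral>\<^sup>+y. ennreal (?p y) \<partial>count_space UNIV) = (\<Sum>y\<in>cube n. ennreal (?p y))"
    by (intro nn_integral_count_space'[OF finite_cube]) auto
  also have "\<dots> = ennreal (\<Sum>y\<in>cube n. ?p y)"
    by (intro sum_ennreal nn)
  also have "(\<Sum>y\<in>cube n. ?p y) = 1"
    using ising_Z_pos[of n J] by (simp add: sum_divide_distrib[symmetric] ising_Z_def[symmetric])
  finally show ?thesis
    unfolding ising_def using nn by (subst pmf_embed_pmf) auto
qed

definition flip :: "nat \<Rightarrow> (nat \<Rightarrow> real) \<Rightarrow> (nat \<Rightarrow> real)" where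
  "flip i x = x(i := - x i)"

definition sensitivity :: "nat \<Rightarrow> ((nat \<Rightarrow> real) \<Rightarrow> real) \<Rightarrow> (nat \<Rightarrow> real) \<Rightarrow> nat" where
  "sensitivity n f x = card {i \<in> {1..n}. f (flip i x) \<noteq> f x}"

definition influence :: "(nat \<Rightarrow> real) pmf \<Rightarrow> ((nat \<Rightarrow> real) \<Rightarrow> real) \<Rightarrow> nat \<Rightarrow> real" where
  "influence \<mu> f i = measure_pmf.prob \<mu> {x. f (flip i x) \<noteq> f x}"

definition SA :: "nat \<Rightarrow> (nat \<Rightarrow> real) pmf \<Rightarrow> ((nat \<Rightarrow> real) \<Rightarrow> real) \<Rightarrow> real" where
  "SA n \<mu> f = measure_pmf.expectation \<mu> (\<lambda>x. sqrt (real (sensitivity n f x)))"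

definition SqInf :: "nat \<Rightarrow> (nat \<Rightarrow> real) pmf \<Rightarrow> ((nat \<Rightarrow> real) \<Rightarrow> real) \<Rightarrow> real" where
  "SqInf n \<mu> f = (\<Sum>i\<in>{1..n}. (influence \<mu> f i)\<^sup>2)"

definition Var :: "(nat \<Rightarrow> real) pmf \<Rightarrow> ((nat \<Rightarrow> real) \<Rightarrow> real) \<Rightarrow> real" where
  "Var \<mu> f = measure_pmf.expectation \<mu> (\<lambda>x. (f x)\<^sup>2) - (measure_pmf.expectation \<mu> f)\<^sup>2"

end

theory Submission
  imports Defs
begin

text \<open>
The interaction enters the proof through two properties of the heat-bath probabilities \<open>p\<^sub>j x\<close>, the
conditional probability of a plus at site \<open>j\<close> given the other spins: they stay away from 0 and 1, and
changing the spin at \<open>i\<close> moves \<open>p\<^sub>j\<close> by at most \<open>d i j = \<bar>J i j\<bar>\<close>, where \<open>d\<close> is symmetric with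
row sums at most \<open>\<rho> < 1\<close> (Dobrushin's condition). With \<open>E\<^sub>j\<close> the heat-bath average at \<open>j\<close> and
\<open>D\<^sub>i f\<close> the discrete derivative, everything rests on one commutation identity,
\<open>D\<^sub>i E\<^sub>j f (x) = E\<^sub>j (D\<^sub>i f) (x) + (D\<^sub>i p\<^sub>j) (x) * D\<^sub>j f (x\<^sup>i)\<close> for \<open>i \<noteq> j\<close> (\<open>D_Ei\<close>), so that up to an
error governed by \<open>d\<close> gradients commute with the Glauber dynamics.

\<^item> \<^emph>\<open>Logarithmic Sobolev inequality.\<close> Following Marton, the spins are fixed one at a time and the
chain rule for entropy is averaged over the choice of the spin (\<open>tensorization_induct\<close>). What is
left are the entropies of single-spin marginals of a density \<open>g\<close>; these are bounded by
squared covariances of \<open>g\<close> with the spins, and the contraction of the Glauber dynamics under Dobrushin's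
condition bounds the sum of all those squared covariances by the local energies of \<open>g\<close>
(\<open>spin_covariances_bound\<close>). The same induction gives the Poincare inequality. The logarithmic Sobolev
inequality is used in the linear form
\<open>k * E u\<^sup>2 \<le> C * (\<Sum>i. E (D\<^sub>i u)\<^sup>2) + e\<^sup>k * (E \<bar>u\<bar>)\<^sup>2\<close>, valid for every real \<open>k\<close>
(\<open>linearized_log_sobolev\<close>). As L1-norms do not grow (much) along the semigroup \<open>P\<^sub>t\<close>, it turns into
linear differential inequalities for L2-norms in which \<open>k\<close> can be chosen freely, and so replaces
hypercontractivity.

\<^item> \<^emph>\<open>Reduction of the sensitivity bounds to variance decay.\<close> The dynamics satisfies a curvature
bound of Bakry-Emery type with constant \<open>- 1 / \<alpha>\<close> (\<open>bochner\<close>), hence \<open>\<Sum>i. (D\<^sub>i P\<^sub>t f)\<^sup>2 \<le> C / t\<close> pointwise if \<open>\<bar>f\<bar> \<le> 1\<close>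
and \<open>t \<le> 1\<close> (\<open>gradient_smoothing\<close>), and by duality \<open>Var f - Var (P\<^sub>t f) \<le> C * sqrt t * SA f\<close> for
\<open>t \<le> 1/2\<close>. Since \<open>t \<mapsto> Var (P\<^sub>t f)\<close> is log-convex, a fixed proportion of the variance is lost already at time of order
\<open>1 / ln (Var f / Var (P\<^sub>1 f))\<close>, which gives
\<open>SA f \<ge> c * Var f * sqrt (max 1 (ln (Var f / Var (P\<^sub>1 f))))\<close> (\<open>sens_ge\<close>). It remains to show that
\<open>Var (P\<^sub>1 f)\<close> is at most a power of \<open>Var f\<close> with exponent above 1, for the logarithm of \<open>1 / Var f\<close>,
and at most a power of \<open>SqInf f\<close>, for the logarithm of \<open>1 / SqInf f\<close>. For the former the linear
inequality is applied to \<open>P\<^sub>t f - E f\<close>. For the latter it is applied to every \<open>D\<^sub>i (P\<^sub>t f)\<close>, but only from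
time 1/2 on: by then smoothing has made the total energy bounded, whereas the total influence of \<open>f\<close>
can be as large as \<open>n\<close>.

\<^item> \<^emph>\<open>Talagrand's inequality.\<close> \<open>Var f\<close> is comparable to the energy dissipated up to time 1. The energy
\<open>E (D\<^sub>i P\<^sub>t f)\<^sup>2\<close> decays at a rate proportional to the logarithm of \<open>1 / A i\<close>, where \<open>A\<close> is a
majorant of the influences that is stable under \<open>d\<close>, but energy also flows between sites. A
weighted total energy, with weights that are at least a multiple of \<open>1 / (1 + ln (1 / A i))\<close> and
stable under \<open>d\<close> as well, controls both effects (\<open>var_le_sum_talagrand\<close>). The bound on the
maximal influence follows by monotonicity of \<open>t / (1 + ln (1 / t))\<close>.
\<close>

section \<open>Differential inequalities and substochastic systems\<close>

lemma gronwall_linear: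
  fixes y :: "real \<Rightarrow> real"
  assumes "s \<le> t" and lam: "0 \<le> lam" and kap: "0 \<le> kap" and b: "0 \<le> b" 
    and der: "\<And>u. s \<le> u \<Longrightarrow> u \<le> t \<Longrightarrow> (y has_real_derivative y' u) (at u)"
    and le: "\<And>u. s \<le> u \<Longrightarrow> u \<le> t \<Longrightarrow> y' u \<le> - lam * y u + kap * y u + b"
  shows "y t \<le> exp (kap * (t - s)) * (exp (- lam * (t - s)) * y s + b * (t - s))"
proof -
  define z where "z u = exp ((lam - kap) * (u - s)) * y u - b * exp (lam * (t - s)) * (u - s)" for u
  have "z t \<le> z s"
  proof (rule DERIV_nonpos_imp_nonincreasing[OF \<open>s \<le> t\<close>])
    fix u assume u: "s \<le> u" "u \<le> t"
    have 1: "(z has_real_derivative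
       (exp ((lam - kap) * (u - s)) * (y' u + (lam - kap) * y u) - b * exp (lam * (t - s)))) (at u)"
      unfolding z_def by (auto intro!: derivative_eq_intros der u simp: algebra_simps)
    have "exp ((lam - kap) * (u - s)) * (y' u + (lam - kap) * y u) \<le> exp ((lam - kap) * (u - s)) * b"
      using le[OF u] by (intro mult_left_mono) (auto simp: algebra_simps)
    also have "\<dots> \<le> exp (lam * (t - s)) * b"
    proof (intro mult_right_mono b)
      have "(lam - kap) * (u - s) \<le> lam * (u - s)" using kap u by (intro mult_right_mono) auto
      also have "\<dots> \<le> lam * (t - s)" using lam u by (intro mult_left_mono) auto
      finally show "exp ((lam - kap) * (u - s)) \<le> exp (lam * (t - s))" by simp
    qed
    finally show "\<exists>d. (z has_real_derivative d) (at u) \<and> d \<le> 0"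
      using 1 by (intro exI conjI) (auto simp: algebra_simps)
  qed
  then have "exp ((lam - kap) * (t - s)) * y t \<le> y s + b * exp (lam * (t - s)) * (t - s)"
    by (simp add: z_def)
  then have "exp ((kap - lam) * (t - s)) * (exp ((lam - kap) * (t - s)) * y t)
    \<le> exp ((kap - lam) * (t - s)) * (y s + b * exp (lam * (t - s)) * (t - s))"
    by (intro mult_left_mono) auto
  moreover have "exp ((kap - lam) * (t - s)) * exp ((lam - kap) * (t - s)) = 1"
    by (simp add: exp_add[symmetric] algebra_simps)
  moreover have "exp ((kap - lam) * (t - s)) * exp (lam * (t - s)) = exp (kap * (t - s))"
    by (simp add: exp_add[symmetric] algebra_simps)
  moreover have "exp ((kap - lam) * (t - s)) = exp (kap * (t - s)) * exp (- lam * (t - s))"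
    by (simp add: exp_add[symmetric] algebra_simps)
  ultimately show ?thesis
    by (simp add: algebra_simps)
qed

text \<open>The Neumann series of \<open>d\<close>, normalised so that row sums at most \<open>r\<close> make \<open>A i\<close> a subconvex
  combination of \<open>v i\<close> and the \<open>A j\<close>. Bounds that only involve convexity then pass from \<open>v\<close> to \<open>A\<close>.\<close>
lemma substochastic_fixpoint:
  fixes d :: "'a \<Rightarrow> 'a \<Rightarrow> real"
  assumes fin: "finite I" and d: "\<And>i j. i \<in> I \<Longrightarrow> j \<in> I \<Longrightarrow> 0 \<le> d i j"
    and row: "\<And>i. i \<in> I \<Longrightarrow> (\<Sum>j\<in>I. d i j) \<le> r" and r: "0 \<le> r" "r < 1"
    and v: "\<And>i. i \<in> I \<Longrightarrow> 0 \<le> v i"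
  obtains A where "\<And>i. i \<in> I \<Longrightarrow> 0 \<le> A i"
    "\<And>i. i \<in> I \<Longrightarrow> A i = (1 - r) * v i + (\<Sum>j\<in>I. d i j * A j)"
proof -
  define a where "a = rec_nat (\<lambda>_::'a. 0::real) (\<lambda>_ b i. (1 - r) * v i + (\<Sum>j\<in>I. d i j * b j))"
  have a0: "a 0 i = 0" and aS: "a (Suc k) i = (1 - r) * v i + (\<Sum>j\<in>I. d i j * a k j)" for k i
    by (auto simp: a_def)
  define B where "B = (\<Sum>i\<in>I. v i)"
  have B: "v i \<le> B" if "i \<in> I" for i
    unfolding B_def using that fin v by (intro member_le_sum) auto
  have B0: "0 \<le> B" unfolding B_def by (intro sum_nonneg v)
  have ge: "0 \<le> a k i" if "i \<in> I" for i k
    using that by (induction k arbitrary: i) (auto simp: a0 aS r v d less_imp_le intro!: add_nonneg_nonneg sum_nonneg mult_nonneg_nonneg)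
  have le: "a k i \<le> B" if "i \<in> I" for i k
    using that
  proof (induction k arbitrary: i)
    case (Suc k)
    have "a (Suc k) i \<le> (1 - r) * B + (\<Sum>j\<in>I. d i j * B)"
      unfolding aS using Suc r B d by (intro add_mono mult_left_mono sum_mono) auto
    also have "(\<Sum>j\<in>I. d i j * B) \<le> r * B"
      using row[OF Suc.prems] B0 by (simp add: sum_distrib_right[symmetric] mult_right_mono)
    finally show ?case by (simp add: algebra_simps)
  qed (use B0 a0 in simp)
  have mono: "a k i \<le> a (Suc k) i" if "i \<in> I" for i k
    using that
  proof (induction k arbitrary: i)
    case 0 then show ?case using ge by (simp add: a0)
  next
    case (Suc k)
    then show ?case unfolding aS[of "Suc k"] aS[of k]
      by (intro add_left_mono sum_mono mult_left_mono d) auto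
  qed
  define A where "A i = lim (\<lambda>k. a k i)" for i
  have lim: "(\<lambda>k. a k i) \<longlonglongrightarrow> A i" if "i \<in> I" for i
  proof -
    have "incseq (\<lambda>k. a k i)" using mono[OF that] by (rule incseq_SucI)
    then have "convergent (\<lambda>k. a k i)"
      using le[OF that] by (metis incseq_convergent convergent_def)
    then show ?thesis by (simp add: A_def convergent_LIMSEQ_iff)
  qed
  show thesis
  proof (rule that)
    fix i assume i: "i \<in> I"
    show "0 \<le> A i" using lim[OF i] ge[OF i] by (intro LIMSEQ_le_const) auto
    have "(\<lambda>k. a (Suc k) i) \<longlonglongrightarrow> (1 - r) * v i + (\<Sum>j\<in>I. d i j * A j)"
      unfolding aS by (intro tendsto_intros lim)
    moreover have "(\<lambda>k. a (Suc k) i) \<longlonglongrightarrow> A i" using lim[OF i] by (rule LIMSEQ_Suc)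
    ultimately show "A i = (1 - r) * v i + (\<Sum>j\<in>I. d i j * A j)"
      using LIMSEQ_unique by blast
  qed
qed

lemma substochastic_fixpoint_le:
  fixes d :: "'a \<Rightarrow> 'a \<Rightarrow> real"
  assumes fin: "finite I" and d: "\<And>i j. i \<in> I \<Longrightarrow> j \<in> I \<Longrightarrow> 0 \<le> d i j"
    and row: "\<And>i. i \<in> I \<Longrightarrow> (\<Sum>j\<in>I. d i j) \<le> r" and r: "r < 1"
    and A: "\<And>i. i \<in> I \<Longrightarrow> 0 \<le> A i"
    and eq: "\<And>i. i \<in> I \<Longrightarrow> A i = (1 - r) * v i + (\<Sum>j\<in>I. d i j * A j)"
    and v: "\<And>i. i \<in> I \<Longrightarrow> v i \<le> 1" and i: "i \<in> I"
  shows "A i \<le> 1"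
proof -
  define m where "m = Max (A ` I)"
  have le: "A j \<le> m" if "j \<in> I" for j using that fin by (simp add: m_def)
  have "m \<in> A ` I" unfolding m_def using fin i by (intro Max_in) auto
  then obtain k where k: "k \<in> I" "m = A k" by auto
  have "m \<le> (1 - r) * 1 + (\<Sum>j\<in>I. d k j * m)"
    unfolding k(2) eq[OF k(1)] using le[unfolded k(2)] k(1) r v d
    by (intro add_mono mult_left_mono sum_mono) (auto simp flip: eq[OF k(1)])
  also have "(\<Sum>j\<in>I. d k j * m) \<le> r * m"
    using row[OF k(1)] A[OF k(1)] k(2) by (simp add: sum_distrib_right[symmetric] mult_right_mono)
  finally have "(1 - r) * m \<le> (1 - r) * 1" by (simp add: algebra_simps)
  then have "m \<le> 1" using r by (simp add: mult_le_cancel_left)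
  then show ?thesis using le[OF i] by simp
qed

lemma substochastic_sum_le:
  fixes d :: "'a \<Rightarrow> 'a \<Rightarrow> real"
  assumes col: "\<And>j. j \<in> I \<Longrightarrow> (\<Sum>i\<in>I. d i j) \<le> r" and r: "r < 1"
    and pos: "\<And>i. i \<in> I \<Longrightarrow> 0 \<le> B i"
    and le: "\<And>i. i \<in> I \<Longrightarrow> B i \<le> (1 - r) * b i + (\<Sum>j\<in>I. d i j * B j)"
  shows "(\<Sum>i\<in>I. B i) \<le> (\<Sum>i\<in>I. b i)"
proof -
  have "(\<Sum>i\<in>I. B i) \<le> (\<Sum>i\<in>I. (1 - r) * b i + (\<Sum>j\<in>I. d i j * B j))"
    by (intro sum_mono le)
  also have "\<dots> = (1 - r) * (\<Sum>i\<in>I. b i) + (\<Sum>j\<in>I. (\<Sum>i\<in>I. d i j) * B j)"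
    unfolding sum_distrib_right sum.swap[of "\<lambda>j i. d i j * B j"]
    by (simp add: sum.distrib sum_distrib_left)
  also have "(\<Sum>j\<in>I. (\<Sum>i\<in>I. d i j) * B j) \<le> (\<Sum>j\<in>I. r * B j)"
    by (intro sum_mono mult_right_mono col pos)
  finally have "(1 - r) * (\<Sum>i\<in>I. B i) \<le> (1 - r) * (\<Sum>i\<in>I. b i)"
    by (simp add: sum_distrib_left[symmetric] algebra_simps)
  then show ?thesis using r by (simp add: mult_le_cancel_left)
qed

text \<open>The weights may sum to less than 1. A convex function that vanishes at 0 still satisfies
  Jensen's inequality, because its tangents are nonpositive at 0.\<close>
lemma square_subconvex:
  fixes d :: "'a \<Rightarrow> real"
  assumes d: "\<And>j. j \<in> I \<Longrightarrow> 0 \<le> d j" and row: "(\<Sum>j\<in>I. d j) \<le> r" and r: "r < 1"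
  shows "((1 - r) * v + (\<Sum>j\<in>I. d j * A j))\<^sup>2 \<le> (1 - r) * v\<^sup>2 + (\<Sum>j\<in>I. d j * (A j)\<^sup>2)"
proof -
  define s where "s = (1 - r) * v + (\<Sum>j\<in>I. d j * A j)"
  have *: "x\<^sup>2 \<ge> 2 * s * x - s\<^sup>2" for x :: real
    using zero_le_power2[of "x - s"] by (simp add: power2_diff algebra_simps)
  have "(1 - r) * v\<^sup>2 + (\<Sum>j\<in>I. d j * (A j)\<^sup>2) \<ge>
     (1 - r) * (2 * s * v - s\<^sup>2) + (\<Sum>j\<in>I. d j * (2 * s * A j - s\<^sup>2))"
    using r d by (intro add_mono mult_left_mono sum_mono *) auto
  also have "(1 - r) * (2 * s * v - s\<^sup>2) + (\<Sum>j\<in>I. d j * (2 * s * A j - s\<^sup>2))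
    = 2 * s * ((1 - r) * v + (\<Sum>j\<in>I. d j * A j)) - (1 - r + (\<Sum>j\<in>I. d j)) * s\<^sup>2"
    by (simp add: algebra_simps sum_subtractf sum_distrib_left sum_distrib_right)
  also have "\<dots> = 2 * s\<^sup>2 - (1 - r + (\<Sum>j\<in>I. d j)) * s\<^sup>2"
    by (simp add: s_def[symmetric] power2_eq_square)
  also have "\<dots> \<ge> 2 * s\<^sup>2 - 1 * s\<^sup>2"
    using row by (intro diff_left_mono mult_right_mono) auto
  finally show ?thesis by (simp add: s_def)
qed

section \<open>The function of Talagrand's inequality\<close>
definition talagrand :: "real \<Rightarrow> real" where
  "talagrand t = t / (1 + ln (1 / t))"

lemma talagrand_0 [simp]: "talagrand 0 = 0" by (simp add: talagrand_def)

lemma one_plus_ln_inverse_ge_1: "0 \<le> t \<Longrightarrow> t \<le> 1 \<Longrightarrow> 1 \<le> 1 + ln (1 / t)" for t :: real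
  by (cases "t = 0") (auto simp: ln_div)

lemma talagrand_nonneg: "0 \<le> t \<Longrightarrow> t \<le> 1 \<Longrightarrow> 0 \<le> talagrand t"
  unfolding talagrand_def using one_plus_ln_inverse_ge_1[of t] by (intro divide_nonneg_nonneg) auto

text \<open>Convexity on \<open>[0, 1]\<close> in the form of tangent lines. With \<open>l = 1 + ln (1 / s)\<close> and
  \<open>x = 1 + ln (1 / t)\<close> the claim becomes the bound \<open>e\<^sup>y \<ge> 1 + y\<close> at \<open>y = x - l\<close> plus a square.\<close>
lemma talagrand_tangent:
  assumes s: "0 < s" "s \<le> 1" and t: "0 \<le> t" "t \<le> 1"
  defines "l \<equiv> 1 + ln (1 / s)"
  shows "talagrand t \<ge> (1 / l + 1 / l\<^sup>2) * t - s / l\<^sup>2"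
proof (cases "t = 0")
  case True
  then show ?thesis using s by simp
next
  case False
  then have t0: "0 < t" using t by simp
  define x where "x = 1 + ln (1 / t)"
  have l: "l \<ge> 1" using one_plus_ln_inverse_ge_1[of s] s by (simp add: l_def)
  have x: "x \<ge> 1" using one_plus_ln_inverse_ge_1[of t] t by (simp add: x_def)
  have st: "s / t = exp (x - l)"
    using s t0 by (simp add: x_def l_def ln_div exp_diff)
  have "(1 / x - 1 / l - 1 / l\<^sup>2) + (1 + (x - l)) / l\<^sup>2 = (l - x)\<^sup>2 / (x * l\<^sup>2)"
    using l x by (simp add: field_simps power2_eq_square)
  then have "0 \<le> (1 / x - 1 / l - 1 / l\<^sup>2) + (1 + (x - l)) / l\<^sup>2"
    using x by simp
  also have "\<dots> \<le> (1 / x - 1 / l - 1 / l\<^sup>2) + (s / t) / l\<^sup>2"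
    unfolding st by (intro add_left_mono divide_right_mono exp_ge_add_one_self) auto
  finally have "0 \<le> t * ((1 / x - 1 / l - 1 / l\<^sup>2) + (s / t) / l\<^sup>2)"
    using t0 by (intro mult_nonneg_nonneg) auto
  also have "\<dots> = t / x - (1 / l + 1 / l\<^sup>2) * t + s / l\<^sup>2"
    using t0 by (simp add: algebra_simps)
  finally show ?thesis by (simp add: talagrand_def x_def)
qed

lemma talagrand_subconvex:
  fixes d :: "'a \<Rightarrow> real"
  assumes d: "\<And>j. j \<in> I \<Longrightarrow> 0 \<le> d j" and row: "(\<Sum>j\<in>I. d j) \<le> r" and r: "r < 1"
    and v: "0 \<le> v" "v \<le> 1" and A: "\<And>j. j \<in> I \<Longrightarrow> 0 \<le> A j" "\<And>j. j \<in> I \<Longrightarrow> A j \<le> 1"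
  shows "talagrand ((1 - r) * v + (\<Sum>j\<in>I. d j * A j))
    \<le> (1 - r) * talagrand v + (\<Sum>j\<in>I. d j * talagrand (A j))"
proof -
  define s where "s = (1 - r) * v + (\<Sum>j\<in>I. d j * A j)"
  have s0: "0 \<le> s" unfolding s_def using r v A d by (intro add_nonneg_nonneg sum_nonneg mult_nonneg_nonneg) auto
  have "s \<le> (1 - r) * 1 + (\<Sum>j\<in>I. d j * 1)"
    unfolding s_def using r v A d by (intro add_mono sum_mono mult_left_mono) auto
  then have s1: "s \<le> 1" using row by simp
  show ?thesis
  proof (cases "s = 0")
    case True
    have "0 \<le> (1 - r) * talagrand v + (\<Sum>j\<in>I. d j * talagrand (A j))"
      using r v A d by (intro add_nonneg_nonneg sum_nonneg mult_nonneg_nonneg talagrand_nonneg) auto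
    then show ?thesis using True by (simp add: s_def[symmetric])
  next
    case False
    then have sp: "0 < s" using s0 by simp
    define l where "l = 1 + ln (1 / s)"
    have l: "l \<ge> 1" using one_plus_ln_inverse_ge_1[of s] s0 s1 by (simp add: l_def)
    define k where "k = 1 / l + 1 / l\<^sup>2"
    have tan: "talagrand t \<ge> k * t - s / l\<^sup>2" if "0 \<le> t" "t \<le> 1" for t
      using talagrand_tangent[OF sp s1 that] by (simp add: k_def l_def)
    have expand: "(1 - r) * (k * v - q) + (\<Sum>j\<in>I. d j * (k * A j - q))
      = k * s - (1 - r + (\<Sum>j\<in>I. d j)) * q" for q
      by (simp add: s_def algebra_simps sum_subtractf sum_distrib_left sum_distrib_right)
    have "(1 - r) * talagrand v + (\<Sum>j\<in>I. d j * talagrand (A j))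
      \<ge> (1 - r) * (k * v - s / l\<^sup>2) + (\<Sum>j\<in>I. d j * (k * A j - s / l\<^sup>2))"
      using r v A d by (intro add_mono mult_left_mono sum_mono tan) auto
    also have "(1 - r) * (k * v - s / l\<^sup>2) + (\<Sum>j\<in>I. d j * (k * A j - s / l\<^sup>2))
      = k * s - (1 - r + (\<Sum>j\<in>I. d j)) * (s / l\<^sup>2)"
      by (rule expand)
    also have "\<dots> \<ge> k * s - 1 * (s / l\<^sup>2)"
      using row s0 by (intro diff_left_mono mult_right_mono) auto
    also have "k * s - 1 * (s / l\<^sup>2) = s / l"
      by (simp add: k_def algebra_simps)
    finally show ?thesis by (simp add: s_def[symmetric] talagrand_def l_def)
  qed
qed

lemma talagrand_mono:
  assumes "0 \<le> s" "s \<le> t" "t \<le> 1"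
  shows "talagrand s \<le> talagrand t"
proof (cases "s = 0")
  case True
  then show ?thesis using talagrand_nonneg assms by simp
next
  case False
  have "ln (1 / t) \<le> ln (1 / s)" using False assms by (simp add: frac_le)
  moreover have "0 < 1 + ln (1 / t)" using one_plus_ln_inverse_ge_1[of t] assms by linarith
  ultimately show ?thesis unfolding talagrand_def using assms by (intro frac_le) auto
qed

lemma sqrt_le_inverse_log:
  assumes "0 \<le> a" "a \<le> 1"
  shows "sqrt a \<le> 2 * (1 / (1 + ln (1 / a)))"
proof (cases "a = 0")
  case False
  then have a: "0 < a" using assms by simp
  define r where "r = sqrt a"
  have r: "0 < r" using a by (simp add: r_def)
  have "a = r * r" using a by (simp add: r_def)
  then have "ln (1 / a) = 2 * ln (1 / r)" using r by (simp add: ln_div ln_mult)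
  also have "ln (1 / r) \<le> 1 / r - 1" using r by (intro ln_le_minus_one) simp
  finally have "1 + ln (1 / a) \<le> 2 / r" by simp
  then have "r * (1 + ln (1 / a)) \<le> 2" using r by (simp add: field_simps)
  moreover have "0 < 1 + ln (1 / a)" using one_plus_ln_inverse_ge_1[OF assms] by linarith
  ultimately show ?thesis by (simp add: r_def[symmetric] pos_le_divide_eq)
qed simp

section \<open>Discrete derivatives and heat-bath averages\<close>
definition disc_deriv :: "nat \<Rightarrow> ((nat \<Rightarrow> real) \<Rightarrow> real) \<Rightarrow> (nat \<Rightarrow> real) \<Rightarrow> real" where
  "disc_deriv i f x = f (x(i := 1)) - f (x(i := -1))"

text \<open>The conditional probability of a plus at site \<open>i\<close> given all other spins of \<open>x\<close>, for the measure
  on the cube with density proportional to \<open>w\<close>.\<close>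
definition heat_bath :: "((nat \<Rightarrow> real) \<Rightarrow> real) \<Rightarrow> nat \<Rightarrow> (nat \<Rightarrow> real) \<Rightarrow> real" where
  "heat_bath w i x = w (x(i := 1)) / (w (x(i := 1)) + w (x(i := -1)))"

lemma cube_cases: "x \<in> cube n \<Longrightarrow> i \<in> {1..n} \<Longrightarrow> x i = 1 \<or> x i = -1"
  by (auto simp: cube_def PiE_iff)

lemma cube_upd: "x \<in> cube n \<Longrightarrow> i \<in> {1..n} \<Longrightarrow> a = 1 \<or> a = -1 \<Longrightarrow> x(i := a) \<in> cube n"
  by (auto simp: cube_def PiE_iff extensional_def)

lemma cube_flip: "x \<in> cube n \<Longrightarrow> i \<in> {1..n} \<Longrightarrow> flip i x \<in> cube n"
  using cube_cases[of x n i] unfolding flip_def by (intro cube_upd) auto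

lemma flip_flip [simp]: "flip i (flip i x) = x"
  by (simp add: flip_def)

lemma disc_deriv_upd [simp]: "disc_deriv i f (x(i := a)) = disc_deriv i f x"
  by (simp add: disc_deriv_def)

lemma heat_bath_upd [simp]: "heat_bath w i (x(i := a)) = heat_bath w i x"
  by (simp add: heat_bath_def)

lemma disc_deriv_self [simp]: "disc_deriv i (disc_deriv i f) x = 0"
  by (simp add: disc_deriv_def)

lemma disc_deriv_commute: "i \<noteq> j \<Longrightarrow> disc_deriv i (disc_deriv j f) x = disc_deriv j (disc_deriv i f) x"
  by (simp add: disc_deriv_def fun_upd_twist algebra_simps)

lemma abs_disc_deriv_eq:
  assumes "x i = 1 \<or> x i = -1"
  shows "\<bar>disc_deriv i f x\<bar> = \<bar>f x - f (flip i x)\<bar>"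
proof -
  from assms show ?thesis
    by (auto simp: disc_deriv_def flip_def fun_upd_idem abs_minus_commute)
qed

text \<open>Dobrushin's uniqueness condition, with a symmetric matrix \<open>d\<close> of influences between the sites, and
  conditional probabilities bounded away from 0 and 1. All constants below depend on \<open>\<alpha>\<close> and \<open>\<rho>\<close> only.\<close>
locale spin_system =
  fixes n :: nat and w :: "(nat \<Rightarrow> real) \<Rightarrow> real" and d :: "nat \<Rightarrow> nat \<Rightarrow> real"
    and \<alpha> \<rho> :: real
  assumes w_pos: "x \<in> cube n \<Longrightarrow> 0 < w x"
    and n_pos: "1 \<le> n"
    and \<alpha>_pos: "0 < \<alpha>"
    and \<rho>_nonneg: "0 \<le> \<rho>" and \<rho>_less: "\<rho> < 1"
    and heat_bath_ge: "x \<in> cube n \<Longrightarrow> i \<in> {1..n} \<Longrightarrow> \<alpha> \<le> heat_bath w i x"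
    and heat_bath_le: "x \<in> cube n \<Longrightarrow> i \<in> {1..n} \<Longrightarrow> heat_bath w i x \<le> 1 - \<alpha>"
    and d_nonneg: "i \<in> {1..n} \<Longrightarrow> j \<in> {1..n} \<Longrightarrow> 0 \<le> d i j"
    and d_sym: "i \<in> {1..n} \<Longrightarrow> j \<in> {1..n} \<Longrightarrow> d i j = d j i"
    and d_row: "i \<in> {1..n} \<Longrightarrow> (\<Sum>j\<in>{1..n}. d i j) \<le> \<rho>"
    and heat_bath_lipschitz: "x \<in> cube n \<Longrightarrow> i \<in> {1..n} \<Longrightarrow> j \<in> {1..n} \<Longrightarrow> i \<noteq> j \<Longrightarrow>
      \<bar>disc_deriv i (heat_bath w j) x\<bar> \<le> d i j"
begin

abbreviation "V \<equiv> {1..n}"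
abbreviation "D \<equiv> disc_deriv"
abbreviation "p \<equiv> heat_bath w"

text \<open>The conditional expectation of \<open>f\<close> given all spins except the one at \<open>i\<close>.\<close>
definition Ei :: "nat \<Rightarrow> ((nat \<Rightarrow> real) \<Rightarrow> real) \<Rightarrow> (nat \<Rightarrow> real) \<Rightarrow> real" where
  "Ei i f x = p i x * f (x(i := 1)) + (1 - p i x) * f (x(i := -1))"

lemma d_le_\<rho>: "i \<in> V \<Longrightarrow> j \<in> V \<Longrightarrow> d i j \<le> \<rho>"
  using member_le_sum[of j V "d i"] d_row[of i] d_nonneg[of i] by force

lemma d_col: "j \<in> V \<Longrightarrow> (\<Sum>i\<in>V. d i j) \<le> \<rho>"
  using d_row[of j] d_sym by (metis (no_types, lifting) sum.cong)

lemma \<alpha>_le_half: "\<alpha> \<le> 1 / 2"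
proof -
  obtain x where "x \<in> cube n" using cube_nonempty by blast
  then show ?thesis using heat_bath_ge[of x 1] heat_bath_le[of x 1] n_pos by auto
qed

lemma heat_bath_bounds:
  assumes "x \<in> cube n" "i \<in> V"
  shows "0 < p i x" "p i x < 1"
  using heat_bath_ge[OF assms] heat_bath_le[OF assms] \<alpha>_pos by auto

lemma heat_bath_var_bounds:
  assumes "x \<in> cube n" "i \<in> V"
  shows "\<alpha> / 2 \<le> p i x * (1 - p i x)" "p i x * (1 - p i x) \<le> 1 / 4"
proof -
  have "0 \<le> (p i x - \<alpha>) * (1 - \<alpha> - p i x)"
    using heat_bath_ge[OF assms] heat_bath_le[OF assms] by (intro mult_nonneg_nonneg) auto
  then have "\<alpha> * (1 - \<alpha>) \<le> p i x * (1 - p i x)" by (simp add: algebra_simps)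
  moreover have "\<alpha> * (1 / 2) \<le> \<alpha> * (1 - \<alpha>)"
    using \<alpha>_le_half \<alpha>_pos by (intro mult_left_mono) auto
  ultimately show "\<alpha> / 2 \<le> p i x * (1 - p i x)" by linarith
  show "p i x * (1 - p i x) \<le> 1 / 4"
    using zero_le_power2[of "p i x - 1 / 2"] by (simp add: power2_eq_square algebra_simps)
qed

lemma Ei_upd [simp]: "Ei i f (x(i := a)) = Ei i f x"
  by (simp add: Ei_def)

lemma Ei_flip [simp]: "Ei i f (flip i x) = Ei i f x"
  by (simp add: flip_def)

lemma D_Ei_self [simp]: "D i (Ei i f) x = 0"
  by (simp add: disc_deriv_def)

lemma Ei_mono:
  assumes "x \<in> cube n" "i \<in> V" "\<And>y. y \<in> cube n \<Longrightarrow> f y \<le> g y"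
  shows "Ei i f x \<le> Ei i g x"
  unfolding Ei_def using heat_bath_bounds[OF assms(1,2)] assms
  by (intro add_mono mult_left_mono assms(3) cube_upd) auto

lemma Ei_abs:
  assumes "x \<in> cube n" "i \<in> V"
  shows "\<bar>Ei i f x\<bar> \<le> Ei i (\<lambda>y. \<bar>f y\<bar>) x"
proof -
  have "\<bar>Ei i f x\<bar> \<le> \<bar>p i x * f (x(i := 1))\<bar> + \<bar>(1 - p i x) * f (x(i := -1))\<bar>"
    unfolding Ei_def by (rule abs_triangle_ineq)
  then show ?thesis using heat_bath_bounds[OF assms] by (simp add: Ei_def abs_mult)
qed

lemma Ei_const [simp]: "Ei i (\<lambda>_. c) x = c"
  by (simp add: Ei_def algebra_simps)

text \<open>Flipping \<open>x i\<close> affects \<open>Ei j f\<close> through \<open>f\<close> and through the probability \<open>p j\<close>. If the first change is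
  averaged with the probability at \<open>x\<close> itself, the second one is measured at the flipped point.\<close>
lemma D_Ei:
  assumes "x i = 1 \<or> x i = -1" "i \<noteq> j"
  shows "D i (Ei j f) x = Ei j (D i f) x + D i (p j) x * D j f (flip i x)"
proof -
  have tw: "x(i := a, j := b) = x(j := b, i := a)" for a b :: real
    using assms(2) by (rule fun_upd_twist)
  have id: "x(j := b, i := x i) = x(j := b)" "x(i := x i) = x" for b :: real
    using assms(2) by (auto intro: fun_upd_idem)
  from assms(1) show ?thesis
  proof
    assume x: "x i = 1"
    show ?thesis using id unfolding disc_deriv_def Ei_def flip_def x tw by (simp add: algebra_simps)
  next
    assume x: "x i = -1"
    show ?thesis using id unfolding disc_deriv_def Ei_def flip_def x tw by (simp add: algebra_simps)
  qed
qed

lemma D_Ei_bound: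
  assumes x: "x \<in> cube n" and ij: "i \<in> V" "j \<in> V" "i \<noteq> j"
  shows "\<bar>D i (Ei j f) x\<bar> \<le> Ei j (\<lambda>y. \<bar>D i f y\<bar>) x + d i j * \<bar>D j f (flip i x)\<bar>"
proof -
  have "\<bar>D i (Ei j f) x\<bar> \<le> \<bar>Ei j (D i f) x\<bar> + \<bar>D i (p j) x\<bar> * \<bar>D j f (flip i x)\<bar>"
    using D_Ei[of x i j f] cube_cases[OF x ij(1)] ij(3)
      abs_triangle_ineq[of "Ei j (D i f) x" "D i (p j) x * D j f (flip i x)"]
    by (simp add: abs_mult)
  also have "\<dots> \<le> Ei j (\<lambda>y. \<bar>D i f y\<bar>) x + d i j * \<bar>D j f (flip i x)\<bar>"
    using x ij by (intro add_mono Ei_abs mult_right_mono heat_bath_lipschitz) auto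
  finally show ?thesis .
qed

text \<open>The configurations that agree with \<open>x\<close> outside \<open>U\<close>. Summing over them with weight \<open>w\<close> gives the
  unnormalised measure with the spins outside \<open>U\<close> pinned to \<open>x\<close>. Its heat-bath averages at sites
  of \<open>U\<close> are those of the full measure, so all pinnings satisfy Dobrushin's condition with the same \<open>d\<close>.\<close>
definition box :: "nat set \<Rightarrow> (nat \<Rightarrow> real) \<Rightarrow> (nat \<Rightarrow> real) set" where
  "box U x = {y \<in> cube n. \<forall>i\<in>V - U. y i = x i}"

definition box_sum :: "nat set \<Rightarrow> (nat \<Rightarrow> real) \<Rightarrow> ((nat \<Rightarrow> real) \<Rightarrow> real) \<Rightarrow> real" where
  "box_sum U x f = (\<Sum>y\<in>box U x. w y * f y)"

abbreviation box_mass :: "nat set \<Rightarrow> (nat \<Rightarrow> real) \<Rightarrow> real" where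
  "box_mass U x \<equiv> box_sum U x (\<lambda>_. 1)"

lemma finite_box [simp]: "finite (box U x)"
  unfolding box_def using finite_cube by simp

lemma box_cube: "y \<in> box U x \<Longrightarrow> y \<in> cube n"
  by (simp add: box_def)

lemma box_self: "x \<in> cube n \<Longrightarrow> x \<in> box U x"
  by (simp add: box_def)

lemma box_full: "box V x = cube n"
  by (auto simp: box_def)

lemma box_upd: "y \<in> box U x \<Longrightarrow> i \<in> U \<Longrightarrow> U \<subseteq> V \<Longrightarrow> a = 1 \<or> a = -1 \<Longrightarrow> y(i := a) \<in> box U x"
  using cube_upd[of y n i a] unfolding box_def by auto

lemma box_flip: "y \<in> box U x \<Longrightarrow> i \<in> U \<Longrightarrow> U \<subseteq> V \<Longrightarrow> flip i y \<in> box U x"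
  using cube_cases[OF box_cube, of y U x i] unfolding flip_def by (intro box_upd) auto

lemma box_empty: "x \<in> cube n \<Longrightarrow> box {} x = {x}"
  unfolding box_def cube_def by (auto intro: PiE_ext)

lemma box_split:
  assumes "i \<in> U" "U \<subseteq> V" "x \<in> cube n"
  shows "box U x = box (U - {i}) (x(i := 1)) \<union> box (U - {i}) (x(i := -1))"
    "box (U - {i}) (x(i := 1)) \<inter> box (U - {i}) (x(i := -1)) = {}"
proof -
  have i: "i \<in> V" and V: "V - (U - {i}) = insert i (V - U)" using assms by auto
  have mem: "y \<in> box (U - {i}) (x(i := a)) \<longleftrightarrow> y \<in> box U x \<and> y i = a" for y a
    unfolding box_def V using assms(1) by auto
  show "box U x = box (U - {i}) (x(i := 1)) \<union> box (U - {i}) (x(i := -1))"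
    using mem cube_cases[OF box_cube i] by blast
  show "box (U - {i}) (x(i := 1)) \<inter> box (U - {i}) (x(i := -1)) = {}"
    unfolding disjoint_iff mem by simp
qed

lemma box_sum_split:
  assumes "i \<in> U" "U \<subseteq> V" "x \<in> cube n"
  shows "box_sum U x f = box_sum (U - {i}) (x(i := 1)) f + box_sum (U - {i}) (x(i := -1)) f"
  unfolding box_sum_def box_split(1)[OF assms]
  by (intro sum.union_disjoint finite_box box_split(2)[OF assms])

lemma box_sum_mono: "(\<And>y. y \<in> box U x \<Longrightarrow> f y \<le> g y) \<Longrightarrow> box_sum U x f \<le> box_sum U x g"
  unfolding box_sum_def by (intro sum_mono mult_left_mono) (auto intro: less_imp_le w_pos box_cube)

lemma box_sum_cong: "(\<And>y. y \<in> box U x \<Longrightarrow> f y = g y) \<Longrightarrow> box_sum U x f = box_sum U x g"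
  unfolding box_sum_def by (intro sum.cong) auto

lemma box_sum_nonneg: "(\<And>y. y \<in> box U x \<Longrightarrow> 0 \<le> f y) \<Longrightarrow> 0 \<le> box_sum U x f"
  unfolding box_sum_def by (intro sum_nonneg mult_nonneg_nonneg) (auto intro: less_imp_le w_pos box_cube)

lemma box_sum_pos: "x \<in> cube n \<Longrightarrow> (\<And>y. y \<in> box U x \<Longrightarrow> 0 < f y) \<Longrightarrow> 0 < box_sum U x f"
  unfolding box_sum_def using box_self by (intro sum_pos mult_pos_pos) (auto intro: w_pos box_cube)

lemma box_sum_add: "box_sum U x (\<lambda>y. f y + g y) = box_sum U x f + box_sum U x g"
  by (simp add: box_sum_def algebra_simps sum.distrib)

lemma box_sum_diff: "box_sum U x (\<lambda>y. f y - g y) = box_sum U x f - box_sum U x g"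
  by (simp add: box_sum_def algebra_simps sum_subtractf)

lemma box_sum_cmult: "box_sum U x (\<lambda>y. c * f y) = c * box_sum U x f"
  by (simp add: box_sum_def sum_distrib_left algebra_simps)

lemma box_sum_sum: "box_sum U x (\<lambda>y. \<Sum>i\<in>I. f i y) = (\<Sum>i\<in>I. box_sum U x (f i))"
  unfolding box_sum_def sum_distrib_left by (rule sum.swap)

lemma box_sum_abs: "\<bar>box_sum U x f\<bar> \<le> box_sum U x (\<lambda>y. \<bar>f y\<bar>)"
  using box_sum_mono[of U x f "\<lambda>y. \<bar>f y\<bar>"] box_sum_mono[of U x "\<lambda>y. - \<bar>f y\<bar>" f] box_sum_cmult[of U x "-1" "\<lambda>y. \<bar>f y\<bar>"]
  by (simp add: abs_le_iff minus_le_iff)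

text \<open>Pair each configuration with its flip at \<open>i\<close>.\<close>
lemma box_sum_Ei:
  assumes i: "i \<in> U" "U \<subseteq> V"
  shows "box_sum U x (Ei i f) = box_sum U x f"
proof -
  have swp: "box_sum U x h = (\<Sum>y\<in>box U x. w (flip i y) * h (flip i y))" for h
    unfolding box_sum_def
    by (rule sum.reindex_bij_witness[of _ "flip i" "flip i"]) (use i box_flip in auto)
  have "2 * box_sum U x (Ei i f) = (\<Sum>y\<in>box U x. w y * Ei i f y + w (flip i y) * Ei i f (flip i y))"
    using swp[of "Ei i f"] by (simp add: sum.distrib box_sum_def)
  also have "\<dots> = (\<Sum>y\<in>box U x. w y * f y + w (flip i y) * f (flip i y))"
  proof (intro sum.cong refl)
    fix y assume y: "y \<in> box U x"
    have iV: "i \<in> V" using i by auto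
    note c = cube_upd[OF box_cube[OF y] iV]
    have W: "0 < w (y(i := 1)) + w (y(i := -1))" using w_pos[OF c] by (intro add_pos_pos) auto
    have *: "(w (y(i := 1)) + w (y(i := -1))) * Ei i f y
       = w (y(i := 1)) * f (y(i := 1)) + w (y(i := -1)) * f (y(i := -1))"
    proof -
      let ?W = "w (y(i := 1)) + w (y(i := -1))"
      have a: "?W * p i y = w (y(i := 1))" using W by (simp add: heat_bath_def)
      then have b: "?W * (1 - p i y) = w (y(i := -1))" by (simp only: right_diff_distrib) simp
      have "?W * Ei i f y = (?W * p i y) * f (y(i := 1)) + (?W * (1 - p i y)) * f (y(i := -1))"
        unfolding Ei_def by (simp only: distrib_left mult.assoc)
      then show ?thesis unfolding a b .
    qed
    show "w y * Ei i f y + w (flip i y) * Ei i f (flip i y) = w y * f y + w (flip i y) * f (flip i y)"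
      using cube_cases[OF box_cube[OF y] iV] * by (auto simp: flip_def fun_upd_idem algebra_simps)
  qed
  also have "\<dots> = 2 * box_sum U x f"
    using swp[of f] by (simp add: sum.distrib box_sum_def)
  finally show ?thesis by simp
qed

lemma box_sum_dirichlet:
  assumes i: "i \<in> U" "U \<subseteq> V"
  shows "box_sum U x (\<lambda>y. g y * (f y - Ei i f y)) = box_sum U x (\<lambda>y. p i y * (1 - p i y) * D i g y * D i f y)"
proof -
  have "Ei i (\<lambda>y. g y * (f y - Ei i f y)) y = p i y * (1 - p i y) * D i g y * D i f y" for y
    by (simp add: Ei_def disc_deriv_def algebra_simps)
  then show ?thesis using box_sum_Ei[OF i, of x "\<lambda>y. g y * (f y - Ei i f y)"] by presburger
qed

section \<open>Covariances with the spins\<close>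

text \<open>One step of the Glauber dynamics that updates a uniformly random site of \<open>U\<close>.\<close>
definition glauber :: "nat set \<Rightarrow> ((nat \<Rightarrow> real) \<Rightarrow> real) \<Rightarrow> (nat \<Rightarrow> real) \<Rightarrow> real" where
  "glauber U f x = (\<Sum>j\<in>U. Ei j f x) / real (card U)"

lemma Ei_le_const:
  assumes "y \<in> box U x" "i \<in> U" "U \<subseteq> V" "\<And>z. z \<in> box U x \<Longrightarrow> f z \<le> c"
  shows "Ei i f y \<le> c"
proof -
  have "i \<in> V" using assms by auto
  then have "Ei i f y \<le> p i y * c + (1 - p i y) * c"
    unfolding Ei_def using heat_bath_bounds[OF box_cube[OF assms(1)]] 
    by (intro add_mono mult_left_mono assms(4) box_upd assms) (auto intro: less_imp_le)
  then show ?thesis by (simp add: algebra_simps)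
qed

text \<open>Updating \<open>j = i\<close> removes the dependence on \<open>x i\<close>, which is the negative term; updating \<open>j \<noteq> i\<close>
  transports at most \<open>d i j\<close> of the dependence on \<open>x j\<close>.\<close>
lemma glauber_D_bound:
  assumes U: "U \<subseteq> V" "U \<noteq> {}" 
    and c: "\<And>i y. i \<in> U \<Longrightarrow> y \<in> box U x \<Longrightarrow> \<bar>D i f y\<bar> \<le> c i"
    and y: "y \<in> box U x" and i: "i \<in> U"
  shows "\<bar>D i (glauber U f) y\<bar> \<le> c i + ((\<Sum>j\<in>U. d i j * c j) - c i) / real (card U)"
proof -
  have fin: "finite U" using U finite_subset by blast
  then have m: "0 < real (card U)" using U by (simp add: card_gt_0_iff)
  have c0: "0 \<le> c j" if "j \<in> U" for j using c[OF that y] by simp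
  have iV: "i \<in> V" using i U by auto
  have one: "\<bar>D i (Ei j f) y\<bar> \<le> (if j = i then 0 else c i + d i j * c j)" if j: "j \<in> U" for j
  proof (cases "j = i")
    case False
    have jV: "j \<in> V" using j U by auto
    have "\<bar>D i (Ei j f) y\<bar> \<le> Ei j (\<lambda>y. \<bar>D i f y\<bar>) y + d i j * \<bar>D j f (flip i y)\<bar>"
      using False jV iV y box_cube by (intro D_Ei_bound) auto
    also have "\<dots> \<le> c i + d i j * c j"
      using y j U c[OF i] c[OF j] box_flip[OF y i] d_nonneg[OF iV jV]
      by (intro add_mono Ei_le_const[OF y j] mult_left_mono) auto
    finally show ?thesis using False by simp
  qed simp
  have "\<bar>D i (glauber U f) y\<bar> = \<bar>\<Sum>j\<in>U. D i (Ei j f) y\<bar> / real (card U)"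
    by (simp add: glauber_def disc_deriv_def sum_subtractf diff_divide_distrib[symmetric] abs_divide)
  also have "\<dots> \<le> (\<Sum>j\<in>U. if j = i then 0 else c i + d i j * c j) / real (card U)"
    using one by (intro divide_right_mono order.trans[OF sum_abs] sum_mono) auto
  also have "(\<Sum>j\<in>U. if j = i then 0 else c i + d i j * c j) \<le> (\<Sum>j\<in>U. c i + d i j * c j) - c i"
  proof -
    have "(\<Sum>j\<in>U. if j = i then 0 else c i + d i j * c j) = (\<Sum>j\<in>U - {i}. c i + d i j * c j)"
      by (subst sum.remove[OF fin i]) (auto intro!: sum.cong)
    also have "\<dots> = (\<Sum>j\<in>U. c i + d i j * c j) - (c i + d i i * c i)"
      by (simp only: sum.remove[OF fin i])
    finally show ?thesis using c0[OF i] d_nonneg[OF iV iV] by simp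
  qed
  also have "(\<Sum>j\<in>U. c i + d i j * c j) - c i = real (card U) * c i + ((\<Sum>j\<in>U. d i j * c j) - c i)"
    by (simp add: sum.distrib)
  finally show ?thesis using m by (simp add: divide_right_mono add_divide_distrib)
qed

definition cov :: "nat set \<Rightarrow> (nat \<Rightarrow> real) \<Rightarrow> ((nat \<Rightarrow> real) \<Rightarrow> real) \<Rightarrow> ((nat \<Rightarrow> real) \<Rightarrow> real) \<Rightarrow> real" where
  "cov U x g f = box_mass U x * box_sum U x (\<lambda>y. g y * f y) - box_sum U x g * box_sum U x f"

lemma cov_step:
  assumes U: "U \<subseteq> V" "U \<noteq> {}" and x: "x \<in> cube n"
    and c: "\<And>i y. i \<in> U \<Longrightarrow> y \<in> box U x \<Longrightarrow> \<bar>D i f y\<bar> \<le> c i"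
  shows "cov U x g f \<le> cov U x g (glauber U f)
    + box_mass U x * ((\<Sum>i\<in>U. box_sum U x (\<lambda>y. \<bar>D i g y\<bar>) * c i) / real (card U))"
proof -
  have fin: "finite U" using U finite_subset by blast
  define m where "m = real (card U)"
  have m: "0 < m" using U fin by (simp add: card_gt_0_iff m_def)
  have glauber_f: "glauber U f y = (1 / m) * (\<Sum>i\<in>U. Ei i f y)" for y by (simp add: glauber_def m_def)
  have "box_sum U x (glauber U f) = (1 / m) * (\<Sum>i\<in>U. box_sum U x (Ei i f))"
    unfolding glauber_f box_sum_cmult box_sum_sum ..
  also have "\<dots> = box_sum U x f"
    using U m by (simp add: box_sum_Ei m_def)
  finally have 1: "box_sum U x (glauber U f) = box_sum U x f" .
  have 2: "box_sum U x (\<lambda>y. g y * f y) - box_sum U x (\<lambda>y. g y * glauber U f y)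
     = (1 / m) * (\<Sum>i\<in>U. box_sum U x (\<lambda>y. g y * (f y - Ei i f y)))"
  proof -
    have "g y * f y - g y * glauber U f y = (1 / m) * (\<Sum>i\<in>U. g y * (f y - Ei i f y))" for y
      using m by (simp add: glauber_f sum_subtractf sum_distrib_left[symmetric] m_def[symmetric] field_simps)
    then have "box_sum U x (\<lambda>y. g y * f y - g y * glauber U f y) = (1 / m) * (\<Sum>i\<in>U. box_sum U x (\<lambda>y. g y * (f y - Ei i f y)))"
      by (simp only: box_sum_cmult box_sum_sum)
    then show ?thesis by (simp only: box_sum_diff)
  qed
  have "(\<Sum>i\<in>U. box_sum U x (\<lambda>y. g y * (f y - Ei i f y))) \<le> (\<Sum>i\<in>U. box_sum U x (\<lambda>y. \<bar>D i g y\<bar>) * c i)"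
  proof (intro sum_mono)
    fix i assume i: "i \<in> U"
    then have iV: "i \<in> V" using U by auto
    have "box_sum U x (\<lambda>y. g y * (f y - Ei i f y)) = box_sum U x (\<lambda>y. p i y * (1 - p i y) * D i g y * D i f y)"
      by (rule box_sum_dirichlet[OF i U(1)])
    also have "\<dots> \<le> box_sum U x (\<lambda>y. c i * \<bar>D i g y\<bar>)"
    proof (rule box_sum_mono)
      fix y assume y: "y \<in> box U x"
      have b: "0 \<le> p i y * (1 - p i y)" "p i y * (1 - p i y) \<le> 1"
        using heat_bath_var_bounds[OF box_cube[OF y] iV] \<alpha>_pos by auto
      have "p i y * (1 - p i y) * D i g y * D i f y \<le> \<bar>p i y * (1 - p i y) * (D i g y * D i f y)\<bar>"
        by (simp add: mult.assoc)
      also have "\<dots> = (p i y * (1 - p i y)) * (\<bar>D i g y\<bar> * \<bar>D i f y\<bar>)"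
        using abs_of_nonneg[OF b(1)] by (simp only: abs_mult)
      also have "\<dots> \<le> 1 * (\<bar>D i g y\<bar> * c i)"
        using b c[OF i y] by (intro mult_mono) auto
      finally show "p i y * (1 - p i y) * D i g y * D i f y \<le> c i * \<bar>D i g y\<bar>"
        by (simp add: mult.commute)
    qed
    also have "\<dots> = box_sum U x (\<lambda>y. \<bar>D i g y\<bar>) * c i" by (simp add: box_sum_cmult)
    finally show "box_sum U x (\<lambda>y. g y * (f y - Ei i f y)) \<le> box_sum U x (\<lambda>y. \<bar>D i g y\<bar>) * c i" .
  qed
  then have "box_sum U x (\<lambda>y. g y * f y) - box_sum U x (\<lambda>y. g y * glauber U f y)
     \<le> (\<Sum>i\<in>U. box_sum U x (\<lambda>y. \<bar>D i g y\<bar>) * c i) / m"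
    unfolding 2 using m by (simp add: divide_right_mono)
  then have "box_mass U x * (box_sum U x (\<lambda>y. g y * f y) - box_sum U x (\<lambda>y. g y * glauber U f y))
     \<le> box_mass U x * ((\<Sum>i\<in>U. box_sum U x (\<lambda>y. \<bar>D i g y\<bar>) * c i) / m)"
    by (intro mult_left_mono box_sum_nonneg) auto
  then show ?thesis by (simp add: cov_def 1 algebra_simps m_def)
qed

text \<open>Change the coordinates in which \<open>y\<close> and \<open>z\<close> differ one at a time.\<close>
lemma oscillation_bound:
  assumes U: "U \<subseteq> V" and \<epsilon>: "0 \<le> \<epsilon>"
    and c: "\<And>i y. i \<in> U \<Longrightarrow> y \<in> box U x \<Longrightarrow> \<bar>D i f y\<bar> \<le> \<epsilon>"
    and y: "y \<in> box U x" and z: "z \<in> box U x"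
  shows "\<bar>f y - f z\<bar> \<le> real (card U) * \<epsilon>"
proof -
  have fin: "finite U" using U finite_subset by blast
  have "\<bar>f y - f z\<bar> \<le> real (card \<Delta>) * \<epsilon>"
    if "finite \<Delta>" "\<Delta> \<subseteq> U" "y \<in> box U x" "z \<in> box U x" "\<forall>i\<in>U - \<Delta>. y i = z i" for \<Delta> y
    using that
  proof (induction \<Delta> arbitrary: y rule: finite_induct)
    case empty
    have "y = z" 
      using empty by (intro PiE_ext[of _ V "\<lambda>_. {-1,1}"]) (auto simp: box_def cube_def)
    then show ?case by simp
  next
    case (insert i \<Delta>)
    then have i: "i \<in> U" "i \<in> V" using U by auto
    define y' where "y' = y(i := z i)"
    have zi: "z i = 1 \<or> z i = -1" using cube_cases[OF box_cube i(2)] insert by blast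
    have y': "y' \<in> box U x" unfolding y'_def using insert i U zi by (intro box_upd) auto
    have "\<bar>f y' - f z\<bar> \<le> real (card \<Delta>) * \<epsilon>"
    proof (rule insert.IH[OF _ y'])
      show "\<forall>j\<in>U - \<Delta>. y' j = z j" using insert.prems(4) by (auto simp: y'_def)
    qed (use insert.prems in auto)
    moreover have "\<bar>f y - f y'\<bar> \<le> \<epsilon>"
    proof (cases "y i = z i")
      case True
      then show ?thesis using \<epsilon> by (simp add: y'_def fun_upd_idem)
    next
      case False
      have yi: "y i = 1 \<or> y i = -1" using cube_cases[OF box_cube i(2)] insert by blast
      then have "y' = flip i y" using False zi by (auto simp: y'_def flip_def)
      then show ?thesis using c[OF i(1) insert.prems(2)] abs_disc_deriv_eq[of y i f] yi by simp
    qed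
    ultimately show ?case using insert by (simp add: algebra_simps)
  qed
  from this[OF fin order.refl y z] show ?thesis by simp
qed

lemma cov_oscillation:
  assumes U: "U \<subseteq> V" and x: "x \<in> cube n" and \<epsilon>: "0 \<le> \<epsilon>"
    and c: "\<And>i y. i \<in> U \<Longrightarrow> y \<in> box U x \<Longrightarrow> \<bar>D i f y\<bar> \<le> \<epsilon>"
  shows "cov U x g f \<le> 2 * box_mass U x * box_sum U x (\<lambda>y. \<bar>g y\<bar>) * (real (card U) * \<epsilon>)"
proof -
  define b where "b = real (card U) * \<epsilon>"
  have osc: "\<bar>f y - f x\<bar> \<le> b" if "y \<in> box U x" for y
    unfolding b_def using oscillation_bound[OF U \<epsilon> c that box_self[OF x]] by simp
  have S1: "box_sum U x (\<lambda>_. c) = c * box_mass U x" for c using box_sum_cmult[of U x c "\<lambda>_. 1"] by simp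
  have b0: "0 \<le> b" using \<epsilon> by (simp add: b_def)
  have 1: "cov U x g f = box_mass U x * box_sum U x (\<lambda>y. g y * (f y - f x)) - box_sum U x g * box_sum U x (\<lambda>y. f y - f x)"
    using box_sum_cmult[of U x "f x" g]
    by (simp add: cov_def right_diff_distrib box_sum_diff S1[of "f x"] mult.commute[of "g _" "f x"] algebra_simps)
  have g1: "\<bar>box_sum U x (\<lambda>y. g y * (f y - f x))\<bar> \<le> b * box_sum U x (\<lambda>y. \<bar>g y\<bar>)"
    unfolding box_sum_cmult[symmetric] using osc
    by (intro order.trans[OF box_sum_abs] box_sum_mono) (auto simp: abs_mult mult.commute[of "\<bar>g _\<bar>"] intro!: mult_right_mono)
  have g2: "\<bar>box_sum U x (\<lambda>y. f y - f x)\<bar> \<le> b * box_sum U x (\<lambda>y. 1)"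
    unfolding box_sum_cmult[symmetric] using osc
    by (intro order.trans[OF box_sum_abs] box_sum_mono) auto
  have S0: "0 \<le> box_mass U x" "0 \<le> box_sum U x (\<lambda>y. \<bar>g y\<bar>)" by (auto intro: box_sum_nonneg)
  have "cov U x g f \<le> \<bar>box_mass U x\<bar> * \<bar>box_sum U x (\<lambda>y. g y * (f y - f x))\<bar> + \<bar>box_sum U x g\<bar> * \<bar>box_sum U x (\<lambda>y. f y - f x)\<bar>"
    unfolding 1 abs_mult[symmetric] by linarith
  also have "\<dots> \<le> box_mass U x * (b * box_sum U x (\<lambda>y. \<bar>g y\<bar>)) + box_sum U x (\<lambda>y. \<bar>g y\<bar>) * (b * box_sum U x (\<lambda>y. 1))"
    using S0 g1 g2 box_sum_abs[of U x g] by (intro add_mono mult_mono) auto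
  finally show ?thesis by (simp add: b_def algebra_simps)
qed

text \<open>The vector \<open>a\<close> is a potential: one step of the dynamics lowers \<open>box_mass U x * (\<Sum>i\<in>U. a i * c i)\<close> by exactly
  the bound of \<open>cov_step\<close> on the covariance lost in this step, because \<open>a - d a\<close> is the vector of the
  L1-norms of the derivatives of \<open>g\<close>.\<close>
lemma cov_iterate:
  assumes U: "U \<subseteq> V" "U \<noteq> {}" and x: "x \<in> cube n"
    and c: "\<And>i y. i \<in> U \<Longrightarrow> y \<in> box U x \<Longrightarrow> \<bar>D i f y\<bar> \<le> c i"
    and a: "\<And>i. i \<in> U \<Longrightarrow> 0 \<le> a i"
      "\<And>i. i \<in> U \<Longrightarrow> a i = box_sum U x (\<lambda>y. \<bar>D i g y\<bar>) + (\<Sum>j\<in>U. d i j * a j)"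
  shows "cov U x g f \<le> box_mass U x * (\<Sum>i\<in>U. a i * c i) + cov U x g ((glauber U ^^ k) f)"
  using c
proof (induction k arbitrary: f c)
  case 0
  have "0 \<le> c i" if "i \<in> U" for i using 0[OF that box_self[OF x]] by simp
  then have "0 \<le> box_mass U x * (\<Sum>i\<in>U. a i * c i)"
    using a(1) by (intro mult_nonneg_nonneg sum_nonneg box_sum_nonneg) auto
  then show ?case by simp
next
  case (Suc k)
  have fin: "finite U" using U finite_subset by blast
  define m where "m = real (card U)"
  have m: "0 < m" using U fin by (simp add: card_gt_0_iff m_def)
  define c' where "c' i = c i + ((\<Sum>j\<in>U. d i j * c j) - c i) / m" for i
  have bd: "\<bar>D i (glauber U f) y\<bar> \<le> c' i" if "i \<in> U" "y \<in> box U x" for i y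
    unfolding c'_def m_def by (rule glauber_D_bound[OF U Suc.prems that(2,1)])
  have "cov U x g f \<le> cov U x g (glauber U f)
    + box_mass U x * ((\<Sum>i\<in>U. box_sum U x (\<lambda>y. \<bar>D i g y\<bar>) * c i) / m)"
    unfolding m_def by (rule cov_step[OF U x Suc.prems])
  also have "cov U x g (glauber U f) \<le> box_mass U x * (\<Sum>i\<in>U. a i * c' i) + cov U x g ((glauber U ^^ k) (glauber U f))"
    by (rule Suc.IH[OF bd])
  also have "(glauber U ^^ k) (glauber U f) = (glauber U ^^ Suc k) f"
    by (simp add: funpow_swap1)
  finally have "cov U x g f \<le> box_mass U x * ((\<Sum>i\<in>U. a i * c' i) + (\<Sum>i\<in>U. box_sum U x (\<lambda>y. \<bar>D i g y\<bar>) * c i) / m)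
     + cov U x g ((glauber U ^^ Suc k) f)"
    by (simp add: algebra_simps)
  also have "(\<Sum>i\<in>U. a i * c' i) + (\<Sum>i\<in>U. box_sum U x (\<lambda>y. \<bar>D i g y\<bar>) * c i) / m = (\<Sum>i\<in>U. a i * c i)"
  proof -
    have "(\<Sum>i\<in>U. box_sum U x (\<lambda>y. \<bar>D i g y\<bar>) * c i) = (\<Sum>i\<in>U. (a i - (\<Sum>j\<in>U. d i j * a j)) * c i)"
      using a(2) by (intro sum.cong) auto
    also have "\<dots> = (\<Sum>i\<in>U. a i * c i) - (\<Sum>i\<in>U. \<Sum>j\<in>U. d i j * a j * c i)"
      by (simp add: left_diff_distrib sum_subtractf sum_distrib_right)
    also have "(\<Sum>i\<in>U. \<Sum>j\<in>U. d i j * a j * c i) = (\<Sum>j\<in>U. \<Sum>i\<in>U. d j i * a j * c i)"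
      using U d_sym by (subst sum.swap) (intro sum.cong refl, simp add: subset_iff)
    also have "\<dots> = (\<Sum>i\<in>U. a i * (\<Sum>j\<in>U. d i j * c j))"
      by (simp add: sum_distrib_left algebra_simps)
    finally show ?thesis
      using m by (simp add: c'_def ring_distribs sum.distrib sum_divide_distrib[symmetric] right_diff_distrib sum_subtractf diff_divide_distrib)
  qed
  finally show ?case .
qed

text \<open>Dobrushin's condition makes the derivatives of the iterates decay geometrically, so the
  remainder in \<open>cov_iterate\<close> tends to 0.\<close>
lemma covariance_bound:
  assumes U: "U \<subseteq> V" "U \<noteq> {}" and x: "x \<in> cube n"
    and c: "\<And>i y. i \<in> U \<Longrightarrow> y \<in> box U x \<Longrightarrow> \<bar>D i f y\<bar> \<le> c i"
    and a: "\<And>i. i \<in> U \<Longrightarrow> 0 \<le> a i"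
      "\<And>i. i \<in> U \<Longrightarrow> a i = box_sum U x (\<lambda>y. \<bar>D i g y\<bar>) + (\<Sum>j\<in>U. d i j * a j)"
  shows "cov U x g f \<le> box_mass U x * (\<Sum>i\<in>U. a i * c i)"
proof -
  have fin: "finite U" using U finite_subset by blast
  define m where "m = real (card U)"
  have m: "1 \<le> m" using U fin by (simp add: m_def card_gt_0_iff Suc_le_eq)
  define r where "r = 1 - (1 - \<rho>) / m"
  have r: "0 \<le> r" "r < 1"
    using m \<rho>_nonneg \<rho>_less by (auto simp: r_def field_simps)
  define B where "B = (\<Sum>i\<in>U. c i)"
  have c0: "0 \<le> c i" if "i \<in> U" for i using c[OF that box_self[OF x]] by simp
  have B: "c i \<le> B" if "i \<in> U" for i unfolding B_def using fin that c0 by (intro member_le_sum) auto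
  have B0: "0 \<le> B" unfolding B_def by (intro sum_nonneg c0)
  have decay: "\<bar>D i ((glauber U ^^ k) f) y\<bar> \<le> B * r ^ k" if "i \<in> U" "y \<in> box U x" for i y k
    using that
  proof (induction k arbitrary: i y)
    case 0
    then show ?case using c[OF 0] B[OF 0(1)] by simp
  next
    case (Suc k)
    have iV: "i \<in> V" using Suc.prems U by auto
    have "\<bar>D i (glauber U ((glauber U ^^ k) f)) y\<bar> \<le> B * r ^ k + ((\<Sum>j\<in>U. d i j * (B * r ^ k)) - B * r ^ k) / m"
      unfolding m_def by (rule glauber_D_bound[OF U Suc.IH Suc.prems(2,1)])
    also have "(\<Sum>j\<in>U. d i j * (B * r ^ k)) \<le> \<rho> * (B * r ^ k)"
    proof -
      have "(\<Sum>j\<in>U. d i j) \<le> (\<Sum>j\<in>V. d i j)" using U d_nonneg[OF iV] by (intro sum_mono2) auto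
      then show ?thesis unfolding sum_distrib_right[symmetric] using d_row[OF iV] B0 r
        by (intro mult_right_mono) auto
    qed
    finally show ?case using m by (simp add: r_def divide_right_mono algebra_simps diff_divide_distrib)
  qed
  define M where "M = box_mass U x * (\<Sum>i\<in>U. a i * c i)"
  define N where "N = 2 * box_mass U x * box_sum U x (\<lambda>y. \<bar>g y\<bar>) * m * B"
  have "cov U x g f \<le> M + N * r ^ k" for k
  proof -
    have "cov U x g f \<le> M + cov U x g ((glauber U ^^ k) f)"
      unfolding M_def by (rule cov_iterate[OF U x c a])
    also have "cov U x g ((glauber U ^^ k) f) \<le> 2 * box_mass U x * box_sum U x (\<lambda>y. \<bar>g y\<bar>) * (real (card U) * (B * r ^ k))"
      using B0 r by (intro cov_oscillation[OF U(1) x] decay) auto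
    finally show ?thesis by (simp add: N_def m_def algebra_simps)
  qed
  moreover have "(\<lambda>k. M + N * r ^ k) \<longlonglongrightarrow> M + N * 0"
    using r by (intro tendsto_intros LIMSEQ_power_zero) auto
  ultimately show ?thesis unfolding M_def[symmetric]
    by (intro LIMSEQ_le_const[of "\<lambda>k. M + N * r ^ k"]) auto
qed

text \<open>Apply \<open>covariance_bound\<close> to the linear function whose coefficients are the covariances themselves;
  its covariance with \<open>g\<close> is the sum to be estimated.\<close>
lemma spin_covariances_bound:
  assumes U: "U \<subseteq> V" "U \<noteq> {}" and x: "x \<in> cube n"
  shows "(\<Sum>i\<in>U. (cov U x g (\<lambda>y. y i))\<^sup>2)
    \<le> 4 * (box_mass U x)\<^sup>2 / (1 - \<rho>)\<^sup>2 * (\<Sum>i\<in>U. (box_sum U x (\<lambda>y. \<bar>D i g y\<bar>))\<^sup>2)"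
proof -
  have fin: "finite U" using U finite_subset by blast
  define e where "e i = box_sum U x (\<lambda>y. \<bar>D i g y\<bar>)" for i
  have e0: "0 \<le> e i" for i unfolding e_def by (intro box_sum_nonneg) auto
  have inV: "i \<in> V" if "i \<in> U" for i using that U by auto
  have row: "(\<Sum>j\<in>U. d i j) \<le> \<rho>" if "i \<in> U" for i
  proof -
    have "(\<Sum>j\<in>U. d i j) \<le> (\<Sum>j\<in>V. d i j)" using U d_nonneg[OF inV[OF that]] by (intro sum_mono2) auto
    then show ?thesis using d_row[OF inV[OF that]] by simp
  qed
  have col: "(\<Sum>i\<in>U. d i j) \<le> \<rho>" if "j \<in> U" for j
    using row[OF that] that inV d_sym by (metis (no_types, lifting) sum.cong)
  obtain A where A: "\<And>i. i \<in> U \<Longrightarrow> 0 \<le> A i" "\<And>i. i \<in> U \<Longrightarrow> A i = (1 - \<rho>) * e i + (\<Sum>j\<in>U. d i j * A j)"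
    using substochastic_fixpoint[of U d \<rho> e] fin d_nonneg inV row e0 \<rho>_nonneg \<rho>_less by metis
  have A2: "(\<Sum>i\<in>U. (A i)\<^sup>2) \<le> (\<Sum>i\<in>U. (e i)\<^sup>2)"
  proof (rule substochastic_sum_le[OF col \<rho>_less])
    fix i assume i: "i \<in> U"
    show "(A i)\<^sup>2 \<le> (1 - \<rho>) * (e i)\<^sup>2 + (\<Sum>j\<in>U. d i j * (A j)\<^sup>2)"
      unfolding A(2)[OF i] using d_nonneg inV i row \<rho>_less by (intro square_subconvex) auto
  qed (assumption | rule zero_le_power2)+
  define a where "a i = A i / (1 - \<rho>)" for i
  have a: "0 \<le> a i" "a i = e i + (\<Sum>j\<in>U. d i j * a j)" if "i \<in> U" for i
  proof -
    show "0 \<le> a i" using A(1)[OF that] \<rho>_less by (simp add: a_def)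
    have "A i / (1 - \<rho>) = e i + (\<Sum>j\<in>U. d i j * A j) / (1 - \<rho>)"
      using \<rho>_less by (subst A(2)[OF that]) (simp add: add_divide_distrib)
    then show "a i = e i + (\<Sum>j\<in>U. d i j * a j)"
      by (simp add: a_def sum_divide_distrib)
  qed
  define b where "b i = cov U x g (\<lambda>y. y i)" for i
  define f where "f y = (\<Sum>i\<in>U. b i * y i)" for y :: "nat \<Rightarrow> real"
  have Df: "D j f y = 2 * b j" if j: "j \<in> U" for j y
  proof -
    have "D j f y = (\<Sum>i\<in>U. b i * ((y(j := 1)) i) - b i * ((y(j := -1)) i))"
      by (simp add: disc_deriv_def f_def sum_subtractf)
    also have "\<dots> = (\<Sum>i\<in>U. if i = j then 2 * b j else 0)"
      by (intro sum.cong) auto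
    finally show ?thesis using fin j by simp
  qed
  have "(\<Sum>i\<in>U. (b i)\<^sup>2) = cov U x g f"
  proof -
    have 1: "box_sum U x f = (\<Sum>i\<in>U. b i * box_sum U x (\<lambda>y. y i))"
      unfolding f_def by (simp add: box_sum_sum box_sum_cmult)
    have "box_sum U x (\<lambda>y. g y * f y) = box_sum U x (\<lambda>y. \<Sum>i\<in>U. b i * (g y * y i))"
      unfolding f_def by (simp add: sum_distrib_left algebra_simps)
    then have 2: "box_sum U x (\<lambda>y. g y * f y) = (\<Sum>i\<in>U. b i * box_sum U x (\<lambda>y. g y * y i))"
      by (simp add: box_sum_sum box_sum_cmult)
    have "cov U x g f = (\<Sum>i\<in>U. b i * cov U x g (\<lambda>y. y i))"
      by (simp only: cov_def 1 2 sum_distrib_left right_diff_distrib sum_subtractf) (simp add: mult_ac)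
    then show ?thesis by (simp add: b_def power2_eq_square)
  qed
  also have "\<dots> \<le> box_mass U x * (\<Sum>i\<in>U. a i * \<bar>2 * b i\<bar>)"
    using a by (intro covariance_bound[OF U x]) (auto simp: Df e_def)
  also have "\<dots> = (\<Sum>i\<in>U. (2 * box_mass U x * a i) * \<bar>b i\<bar>)"
    by (simp add: sum_distrib_left abs_mult algebra_simps)
  also have "\<dots> \<le> (\<Sum>i\<in>U. ((2 * box_mass U x * a i)\<^sup>2 + (b i)\<^sup>2) / 2)"
  proof (intro sum_mono)
    fix i 
    have "0 \<le> (2 * box_mass U x * a i - \<bar>b i\<bar>)\<^sup>2" by simp
    then show "2 * box_mass U x * a i * \<bar>b i\<bar> \<le> ((2 * box_mass U x * a i)\<^sup>2 + (b i)\<^sup>2) / 2"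
      by (simp add: power2_diff)
  qed
  also have "\<dots> = ((\<Sum>i\<in>U. (2 * box_mass U x * a i)\<^sup>2) + (\<Sum>i\<in>U. (b i)\<^sup>2)) / 2"
    by (simp add: sum.distrib sum_divide_distrib[symmetric])
  finally have "(\<Sum>i\<in>U. (b i)\<^sup>2) \<le> (\<Sum>i\<in>U. (2 * box_mass U x * a i)\<^sup>2)" by simp
  also have "\<dots> = 4 * (box_mass U x)\<^sup>2 / (1 - \<rho>)\<^sup>2 * (\<Sum>i\<in>U. (A i)\<^sup>2)"
    by (simp add: sum_distrib_left a_def power_mult_distrib power_divide)
  also have "\<dots> \<le> 4 * (box_mass U x)\<^sup>2 / (1 - \<rho>)\<^sup>2 * (\<Sum>i\<in>U. (e i)\<^sup>2)"
    using A2 by (intro mult_left_mono) auto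
  finally show ?thesis by (simp add: b_def e_def)
qed

section \<open>Tensorisation of variance and entropy\<close>
lemma half_box_mass_ge:
  assumes i: "i \<in> U" "U \<subseteq> V" and x: "x \<in> cube n"
  shows "\<alpha> * box_mass U x \<le> box_sum (U - {i}) (x(i := 1)) (\<lambda>_. 1)"
    "\<alpha> * box_mass U x \<le> box_sum (U - {i}) (x(i := -1)) (\<lambda>_. 1)"
proof -
  have iV: "i \<in> V" using i by auto
  have in1: "y i = a" if "y \<in> box (U - {i}) (x(i := a))" for y a
    using that iV by (auto simp: box_def)
  have *: "box_sum U x (\<lambda>y. if y i = a then 1 else 0) = box_sum (U - {i}) (x(i := a)) (\<lambda>_. 1)"
    if "a = 1 \<or> a = -1" for a :: real
  proof -
    have "box_sum (U - {i}) (x(i := b)) (\<lambda>y. if y i = a then 1 else 0)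
      = (if b = a then box_sum (U - {i}) (x(i := a)) (\<lambda>_. 1) else 0)" for b
    proof (cases "b = a")
      case True
      then show ?thesis using in1[of _ a] by (auto intro!: box_sum_cong)
    next
      case False
      then have "box_sum (U - {i}) (x(i := b)) (\<lambda>y. if y i = a then 1 else 0) = box_sum (U - {i}) (x(i := b)) (\<lambda>_. 0)"
        using in1[of _ b] by (intro box_sum_cong) auto
      then show ?thesis using False by (simp add: box_sum_def)
    qed
    then show ?thesis using that by (subst box_sum_split[OF i x]) auto
  qed
  have **: "\<alpha> * box_mass U x \<le> box_sum U x (\<lambda>y. if y i = a then 1 else 0)"
    if "a = 1 \<or> a = -1" for a :: real
  proof -
    have "\<alpha> * box_mass U x = box_sum U x (\<lambda>_. \<alpha>)" using box_sum_cmult[of U x \<alpha> "\<lambda>_. 1"] by simp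
    also have "\<dots> \<le> box_sum U x (Ei i (\<lambda>y. if y i = a then 1 else 0))"
    proof (rule box_sum_mono)
      fix y assume "y \<in> box U x"
      from heat_bath_ge[OF box_cube[OF this] iV] heat_bath_le[OF box_cube[OF this] iV]
      show "\<alpha> \<le> Ei i (\<lambda>y. if y i = a then 1 else 0) y" using that by (auto simp: Ei_def)
    qed
    also have "\<dots> = box_sum U x (\<lambda>y. if y i = a then 1 else 0)" by (rule box_sum_Ei[OF i])
    finally show ?thesis .
  qed
  show "\<alpha> * box_mass U x \<le> box_sum (U - {i}) (x(i := 1)) (\<lambda>_. 1)"
    "\<alpha> * box_mass U x \<le> box_sum (U - {i}) (x(i := -1)) (\<lambda>_. 1)"
    using *[of 1] *[of "-1"] **[of 1] **[of "-1"] by auto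
qed

lemma cov_spin:
  assumes i: "i \<in> U" "U \<subseteq> V" and x: "x \<in> cube n"
  defines "Sp \<equiv> box_sum (U - {i}) (x(i := 1))" and "Sm \<equiv> box_sum (U - {i}) (x(i := -1))"
  shows "cov U x g (\<lambda>y. y i) = 2 * (Sp g * Sm (\<lambda>_. 1) - Sm g * Sp (\<lambda>_. 1))"
proof -
  have iV: "i \<in> V" using i by auto
  have in1: "box_sum (U - {i}) (x(i := a)) (\<lambda>y. h y * y i) = a * box_sum (U - {i}) (x(i := a)) h" for h a
    unfolding box_sum_cmult[symmetric] using iV by (intro box_sum_cong) (auto simp: box_def)
  have dif: "box_sum U x (\<lambda>y. h y * y i) = Sp h - Sm h" for h
    unfolding box_sum_split[OF i x] in1 by (simp add: Sp_def Sm_def)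
  have spin: "box_sum U x (\<lambda>y. y i) = Sp (\<lambda>_. 1) - Sm (\<lambda>_. 1)" using dif[of "\<lambda>_. 1"] by simp
  have tot: "box_sum U x g = Sp g + Sm g" "box_mass U x = Sp (\<lambda>_. 1) + Sm (\<lambda>_. 1)"
    unfolding Sp_def Sm_def by (rule box_sum_split[OF i x])+
  show ?thesis
    by (simp only: cov_def dif spin tot) (simp add: algebra_simps)
qed

definition "loc_const = 2 / (\<alpha> * (1 - \<rho>)\<^sup>2)"

lemma loc_const_pos: "0 < loc_const"
  using \<alpha>_pos \<rho>_less by (simp add: loc_const_def)

text \<open>Up to normalisation, each summand is the squared covariance of \<open>g\<close> with the spin at \<open>i\<close>, divided by the variance of that
  spin and by \<open>G\<close>. In this form it appears as the variance (\<open>G\<close> is the total mass) and as a bound on the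
  entropy (\<open>G\<close> is the total integral of \<open>g\<close>) of the marginal of \<open>g\<close> at \<open>i\<close>.\<close>
lemma sum_spin_covariances_le:
  assumes U: "U \<subseteq> V" "U \<noteq> {}" and x: "x \<in> cube n" and G: "0 < G"
    and e: "\<And>i. i \<in> U \<Longrightarrow> (box_sum U x (\<lambda>y. \<bar>D i g y\<bar>))\<^sup>2 \<le> G * q i"
  defines "Sp \<equiv> \<lambda>i. box_sum (U - {i}) (x(i := 1))" and "Sm \<equiv> \<lambda>i. box_sum (U - {i}) (x(i := -1))"
  shows "(\<Sum>i\<in>U. (Sp i g * Sm i (\<lambda>_. 1) - Sm i g * Sp i (\<lambda>_. 1))\<^sup>2 / (Sp i (\<lambda>_. 1) * Sm i (\<lambda>_. 1) * G))
    \<le> loc_const * (\<Sum>i\<in>U. q i)"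
proof -
  define Z where "Z = box_mass U x"
  have Z: "0 < Z" unfolding Z_def using x by (intro box_sum_pos) auto
  have "(Sp i g * Sm i (\<lambda>_. 1) - Sm i g * Sp i (\<lambda>_. 1))\<^sup>2 / (Sp i (\<lambda>_. 1) * Sm i (\<lambda>_. 1) * G)
      \<le> (cov U x g (\<lambda>y. y i))\<^sup>2 * (1 / (2 * \<alpha> * Z\<^sup>2 * G))" (is "?l i \<le> _") if i: "i \<in> U" for i
  proof -
    let ?P = "Sp i (\<lambda>_. 1)" and ?M = "Sm i (\<lambda>_. 1)"
    have PM: "\<alpha> * Z \<le> ?P" "\<alpha> * Z \<le> ?M" "?P + ?M = Z"
      using half_box_mass_ge[OF i U(1) x] box_sum_split[OF i U(1) x, of "\<lambda>_. 1"] by (auto simp: Z_def Sp_def Sm_def)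
    have aZ: "0 < \<alpha> * Z" using \<alpha>_pos Z by simp
    have "\<alpha> * Z\<^sup>2 \<le> 2 * (?P * ?M)"
    proof (cases "?P \<le> ?M")
      case True
      then have "\<alpha> * Z * Z \<le> ?P * (2 * ?M)" using PM aZ Z by (intro mult_mono) auto
      then show ?thesis by (simp add: power2_eq_square)
    next
      case False
      then have "\<alpha> * Z * Z \<le> ?M * (2 * ?P)" using PM aZ Z by (intro mult_mono) auto
      then show ?thesis by (simp add: power2_eq_square mult_ac)
    qed
    moreover have "?l i = (cov U x g (\<lambda>y. y i))\<^sup>2 * (1 / (4 * (?P * ?M) * G))"
    proof -
      have "X\<^sup>2 / (Y * G) = (2 * X)\<^sup>2 * (1 / (4 * Y * G))" for X Y :: real
        by (simp add: power_mult_distrib)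
      then show ?thesis unfolding cov_spin[OF i U(1) x] Sp_def Sm_def .
    qed
    moreover have "0 < \<alpha> * Z\<^sup>2" using \<alpha>_pos Z by simp
    ultimately have "2 * \<alpha> * Z\<^sup>2 * G \<le> 4 * (?P * ?M) * G" "0 < 2 * \<alpha> * Z\<^sup>2 * G"
      "?l i = (cov U x g (\<lambda>y. y i))\<^sup>2 * (1 / (4 * (?P * ?M) * G))"
      using G by (auto simp: mult_ac)
    then show ?thesis by (simp only:) (intro mult_left_mono frac_le, auto)
  qed
  then have "(\<Sum>i\<in>U. ?l i) \<le> (\<Sum>i\<in>U. (cov U x g (\<lambda>y. y i))\<^sup>2) * (1 / (2 * \<alpha> * Z\<^sup>2 * G))"
    unfolding sum_distrib_right by (rule sum_mono)
  also have "\<dots> \<le> (4 * Z\<^sup>2 / (1 - \<rho>)\<^sup>2 * (\<Sum>i\<in>U. G * q i)) * (1 / (2 * \<alpha> * Z\<^sup>2 * G))"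
  proof (intro mult_right_mono)
    have "(\<Sum>i\<in>U. (cov U x g (\<lambda>y. y i))\<^sup>2) \<le> 4 * Z\<^sup>2 / (1 - \<rho>)\<^sup>2 * (\<Sum>i\<in>U. (box_sum U x (\<lambda>y. \<bar>D i g y\<bar>))\<^sup>2)"
      unfolding Z_def by (rule spin_covariances_bound[OF U x])
    also have "\<dots> \<le> 4 * Z\<^sup>2 / (1 - \<rho>)\<^sup>2 * (\<Sum>i\<in>U. G * q i)"
      using e by (intro mult_left_mono sum_mono) auto
    finally show "(\<Sum>i\<in>U. (cov U x g (\<lambda>y. y i))\<^sup>2) \<le> \<dots>" .
  qed (use \<alpha>_pos Z G in auto)
  also have "\<dots> = loc_const * (\<Sum>i\<in>U. q i)"
    unfolding sum_distrib_left[symmetric] loc_const_def using \<alpha>_pos Z G \<rho>_less by (simp add: field_simps)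
  finally show ?thesis .
qed

text \<open>The difference in \<open>step\<close> is what a variance or entropy functional \<open>H\<close> loses when the spin at \<open>i\<close> is
  pinned. After pinning \<open>i\<close> the induction hypothesis misses the local term at \<open>i\<close>; averaged over \<open>i\<close>, it
  yields the fraction \<open>1 - 1 / card U\<close> of the total, and \<open>step\<close> supplies the rest with the same constant.\<close>
lemma tensorization_induct:
  fixes H :: "nat set \<Rightarrow> (nat \<Rightarrow> real) \<Rightarrow> real" and q :: "nat \<Rightarrow> (nat \<Rightarrow> real) \<Rightarrow> real"
  assumes empty: "\<And>x. x \<in> cube n \<Longrightarrow> H {} x \<le> 0"
    and step: "\<And>U x. U \<subseteq> V \<Longrightarrow> U \<noteq> {} \<Longrightarrow> x \<in> cube n \<Longrightarrow>
      (\<Sum>i\<in>U. H U x - H (U - {i}) (x(i := 1)) - H (U - {i}) (x(i := -1))) \<le> B * (\<Sum>i\<in>U. box_sum U x (q i))"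
    and U: "U \<subseteq> V" and x: "x \<in> cube n"
  shows "H U x \<le> B * (\<Sum>i\<in>U. box_sum U x (q i))"
proof -
  have "finite U" using U finite_subset by blast
  then show ?thesis using U x
  proof (induction "card U" arbitrary: U x)
    case 0
    then show ?case using empty by simp
  next
    case (Suc m)
    then have ne: "U \<noteq> {}" by auto
    have card: "real (card U) = real m + 1" using Suc by (metis of_nat_Suc add.commute)
    define Q where "Q = (\<Sum>i\<in>U. box_sum U x (q i))"
    have "H (U - {i}) (x(i := 1)) + H (U - {i}) (x(i := -1)) \<le> B * (Q - box_sum U x (q i))" if i: "i \<in> U" for i
    proof -
      have iV: "i \<in> V" using i Suc by auto
      have m: "m = card (U - {i})" using Suc i by (metis card_Diff_singleton diff_Suc_1)
      have "H (U - {i}) (x(i := a)) \<le> B * (\<Sum>j\<in>U - {i}. box_sum (U - {i}) (x(i := a)) (q j))"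
        if "a = 1 \<or> a = -1" for a
        using Suc.prems cube_upd[OF Suc.prems(3) iV that] by (intro Suc.hyps(1)[OF m]) auto
      from add_mono[OF this[of 1] this[of "-1"]]
      have "H (U - {i}) (x(i := 1)) + H (U - {i}) (x(i := -1)) \<le> B * (\<Sum>j\<in>U - {i}. box_sum U x (q j))"
        unfolding box_sum_split[OF i Suc.prems(2,3)] by (simp add: sum.distrib ring_distribs)
      also have "(\<Sum>j\<in>U - {i}. box_sum U x (q j)) = Q - box_sum U x (q i)"
        unfolding Q_def using sum.remove[OF Suc.prems(1) i, of "\<lambda>j. box_sum U x (q j)"] by simp
      finally show ?thesis .
    qed
    then have "(\<Sum>i\<in>U. H (U - {i}) (x(i := 1)) + H (U - {i}) (x(i := -1))) \<le> (\<Sum>i\<in>U. B * (Q - box_sum U x (q i)))"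
      by (rule sum_mono)
    also have "\<dots> = B * (real (card U) * Q - Q)"
      unfolding sum_distrib_left[symmetric] sum_subtractf by (simp add: Q_def)
    also have "\<dots> = real m * (B * Q)" unfolding card by (simp add: algebra_simps)
    finally have 1: "(\<Sum>i\<in>U. H (U - {i}) (x(i := 1)) + H (U - {i}) (x(i := -1))) \<le> real m * (B * Q)" .
    have "(\<Sum>i\<in>U. H U x - H (U - {i}) (x(i := 1)) - H (U - {i}) (x(i := -1))) \<le> B * Q"
      unfolding Q_def by (rule step[OF Suc.prems(2) ne Suc.prems(3)])
    then have "(real m + 1) * H U x \<le> B * Q + real m * (B * Q)"
      using 1 by (simp add: sum_subtractf sum.distrib card)
    then have "(real m + 1) * H U x \<le> (real m + 1) * (B * Q)" by (simp add: algebra_simps)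
    then show ?case unfolding Q_def by (rule mult_left_le_imp_le) simp
  qed
qed

lemma box_sum_square_le: "(\<And>y. y \<in> box U x \<Longrightarrow> 0 < h y) \<Longrightarrow> (box_sum U x (\<lambda>y. \<bar>u y\<bar>))\<^sup>2 \<le> box_sum U x h * box_sum U x (\<lambda>y. (u y)\<^sup>2 / h y)"
proof -
  assume h: "\<And>y. y \<in> box U x \<Longrightarrow> 0 < h y"
  let ?a = "\<lambda>y. sqrt (w y * h y)" and ?b = "\<lambda>y. sqrt (w y) * \<bar>u y\<bar> / sqrt (h y)"
  have pos: "0 < w y" "0 < h y" if "y \<in> box U x" for y using that h w_pos box_cube by auto
  have "(\<Sum>y\<in>box U x. ?a y * ?b y)\<^sup>2 \<le> (\<Sum>y\<in>box U x. (?a y)\<^sup>2) * (\<Sum>y\<in>box U x. (?b y)\<^sup>2)"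
    by (rule Cauchy_Schwarz_ineq_sum)
  moreover have "(\<Sum>y\<in>box U x. ?a y * ?b y) = box_sum U x (\<lambda>y. \<bar>u y\<bar>)"
    unfolding box_sum_def
  proof (intro sum.cong refl)
    fix y assume "y \<in> box U x"
    from pos[OF this] have "sqrt (h y) \<noteq> 0" "sqrt (w y) * sqrt (w y) = w y" by auto
    then show "?a y * ?b y = w y * \<bar>u y\<bar>" by (simp add: real_sqrt_mult mult.assoc[symmetric])
  qed
  moreover have "(\<Sum>y\<in>box U x. (?a y)\<^sup>2) = box_sum U x h"
    unfolding box_sum_def using pos by (intro sum.cong) (auto simp: less_imp_le)
  moreover have "(\<Sum>y\<in>box U x. (?b y)\<^sup>2) = box_sum U x (\<lambda>y. (u y)\<^sup>2 / h y)"
    unfolding box_sum_def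
  proof (intro sum.cong refl)
    fix y assume "y \<in> box U x"
    from pos[OF this] show "(?b y)\<^sup>2 = w y * ((u y)\<^sup>2 / h y)"
      by (simp add: power_mult_distrib power_divide)
  qed
  ultimately show ?thesis by simp
qed

lemma pinned_poincare:
  assumes U: "U \<subseteq> V" and x: "x \<in> cube n"
  shows "box_sum U x (\<lambda>y. (g y)\<^sup>2) - (box_sum U x g)\<^sup>2 / box_mass U x \<le> loc_const * (\<Sum>i\<in>U. box_sum U x (\<lambda>y. (D i g y)\<^sup>2))"
proof -
  define H where "H = (\<lambda>U x. box_sum U x (\<lambda>y. (g y)\<^sup>2) - (box_sum U x g)\<^sup>2 / box_mass U x)"
  have "H U x \<le> loc_const * (\<Sum>i\<in>U. box_sum U x (\<lambda>y. (D i g y)\<^sup>2))"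
  proof (rule tensorization_induct[OF _ _ U x])
    fix x assume x: "x \<in> cube n"
    then have "0 < w x" by (rule w_pos)
    then show "H {} x \<le> 0"
      using x by (simp add: H_def box_sum_def box_empty power2_eq_square)
  next
    fix U x assume U: "U \<subseteq> V" "U \<noteq> {}" and x: "x \<in> cube n"
    define Z where "Z = box_mass U x"
    have Z: "0 < Z" unfolding Z_def using x by (intro box_sum_pos) auto
    define Sp where "Sp = (\<lambda>i. box_sum (U - {i}) (x(i := 1)))"
    define Sm where "Sm = (\<lambda>i. box_sum (U - {i}) (x(i := -1)))"
    have "H U x - H (U - {i}) (x(i := 1)) - H (U - {i}) (x(i := -1))
      = (Sp i g * Sm i (\<lambda>_. 1) - Sm i g * Sp i (\<lambda>_. 1))\<^sup>2 / (Sp i (\<lambda>_. 1) * Sm i (\<lambda>_. 1) * Z)" if i: "i \<in> U" for i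
    proof -
      have iV: "i \<in> V" using i U by auto
      have P: "0 < Sp i (\<lambda>_. 1)" "0 < Sm i (\<lambda>_. 1)"
        unfolding Sp_def Sm_def by (intro box_sum_pos cube_upd[OF x iV]; simp)+
      have Zs: "Z = Sp i (\<lambda>_. 1) + Sm i (\<lambda>_. 1)"
        unfolding Z_def Sp_def Sm_def by (rule box_sum_split[OF i U(1) x])
      have "(a\<^sup>2 / P + b\<^sup>2 / M - (a + b)\<^sup>2 / (P + M)) = (a * M - b * P)\<^sup>2 / (P * M * (P + M))"
        if "0 < P" "0 < M" for a b P M :: real
        using that add_pos_pos[OF that] by (simp add: divide_simps) (simp add: power2_eq_square algebra_simps)
      from this[OF P, of "Sp i g" "Sm i g"] show ?thesis
        unfolding H_def box_sum_split[OF i U(1) x] Zs Sp_def Sm_def by simp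
    qed
    then have "(\<Sum>i\<in>U. H U x - H (U - {i}) (x(i := 1)) - H (U - {i}) (x(i := -1)))
      = (\<Sum>i\<in>U. (Sp i g * Sm i (\<lambda>_. 1) - Sm i g * Sp i (\<lambda>_. 1))\<^sup>2 / (Sp i (\<lambda>_. 1) * Sm i (\<lambda>_. 1) * Z))"
      by (rule sum.cong[OF refl])
    also have "\<dots> \<le> loc_const * (\<Sum>i\<in>U. box_sum U x (\<lambda>y. (D i g y)\<^sup>2))"
      unfolding Sp_def Sm_def
    proof (rule sum_spin_covariances_le[OF U x Z])
      fix i 
      show "(box_sum U x (\<lambda>y. \<bar>D i g y\<bar>))\<^sup>2 \<le> Z * box_sum U x (\<lambda>y. (D i g y)\<^sup>2)"
        using box_sum_square_le[of U x "\<lambda>_. 1" "D i g"] by (simp add: Z_def)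
    qed
    finally show "(\<Sum>i\<in>U. H U x - H (U - {i}) (x(i := 1)) - H (U - {i}) (x(i := -1)))
      \<le> loc_const * (\<Sum>i\<in>U. box_sum U x (\<lambda>y. (D i g y)\<^sup>2))" .
    qed
  then show ?thesis by (simp add: H_def)
qed

text \<open>Entropy is at most variance divided by the mean, by \<open>ln t \<le> t - 1\<close>.\<close>
lemma two_point_entropy:
  fixes a b P M :: real
  assumes "0 < a" "0 < b" "0 < P" "0 < M"
  shows "a * ln (a / P) + b * ln (b / M) - (a + b) * ln ((a + b) / (P + M))
    \<le> (a * M - b * P)\<^sup>2 / (P * M * (a + b))"
proof -
  have 1: "c * ln (c / R) - c * ln ((a + b) / (P + M)) \<le> c * ((c * (P + M)) / (R * (a + b)) - 1)"
    if "0 < c" "0 < R" for c R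
  proof -
    have "ln (c / R) - ln ((a + b) / (P + M)) = ln ((c * (P + M)) / (R * (a + b)))"
      using assms that by (subst ln_divide_pos[symmetric]) (auto simp: field_simps)
    also have "\<dots> \<le> (c * (P + M)) / (R * (a + b)) - 1"
      using assms that by (intro ln_le_minus_one divide_pos_pos mult_pos_pos add_pos_pos) auto
    finally show ?thesis using that by (simp add: right_diff_distrib[symmetric])
  qed
  have "a * ln (a / P) + b * ln (b / M) - (a + b) * ln ((a + b) / (P + M))
    = (a * ln (a / P) - a * ln ((a + b) / (P + M))) + (b * ln (b / M) - b * ln ((a + b) / (P + M)))"
    by (simp add: algebra_simps)
  also have "\<dots> \<le> a * ((a * (P + M)) / (P * (a + b)) - 1) + b * ((b * (P + M)) / (M * (a + b)) - 1)"
    by (intro add_mono 1 assms)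
  also have "\<dots> = (a * M - b * P)\<^sup>2 / (P * M * (a + b))"
    using assms add_pos_pos[OF assms(1,2)] by (simp add: divide_simps) (simp add: power2_eq_square algebra_simps)
  finally show ?thesis .
qed

lemma pinned_entropy:
  assumes U: "U \<subseteq> V" and x: "x \<in> cube n" and g: "\<And>y. y \<in> cube n \<Longrightarrow> 0 < g y"
  shows "box_sum U x (\<lambda>y. g y * ln (g y)) - box_sum U x g * ln (box_sum U x g / box_mass U x)
    \<le> loc_const * (\<Sum>i\<in>U. box_sum U x (\<lambda>y. (D i g y)\<^sup>2 / Ei i g y))"
proof -
  define H where "H = (\<lambda>U x. box_sum U x (\<lambda>y. g y * ln (g y)) - box_sum U x g * ln (box_sum U x g / box_mass U x))"
  have "H U x \<le> loc_const * (\<Sum>i\<in>U. box_sum U x (\<lambda>y. (D i g y)\<^sup>2 / Ei i g y))"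
  proof (rule tensorization_induct[OF _ _ U x])
    fix x assume x: "x \<in> cube n"
    then have "0 < w x" by (rule w_pos)
    then show "H {} x \<le> 0"
      using x by (simp add: H_def box_sum_def box_empty)
  next
    fix U x assume U: "U \<subseteq> V" "U \<noteq> {}" and x: "x \<in> cube n"
    define G where "G = box_sum U x g"
    have G: "0 < G" unfolding G_def using x g box_cube by (intro box_sum_pos) auto
    define Sp where "Sp = (\<lambda>i. box_sum (U - {i}) (x(i := 1)))"
    define Sm where "Sm = (\<lambda>i. box_sum (U - {i}) (x(i := -1)))"
    have "H U x - H (U - {i}) (x(i := 1)) - H (U - {i}) (x(i := -1))
      \<le> (Sp i g * Sm i (\<lambda>_. 1) - Sm i g * Sp i (\<lambda>_. 1))\<^sup>2 / (Sp i (\<lambda>_. 1) * Sm i (\<lambda>_. 1) * G)" if i: "i \<in> U" for i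
    proof -
      have iV: "i \<in> V" using i U by auto
      have P: "0 < Sp i g" "0 < Sm i g" "0 < Sp i (\<lambda>_. 1)" "0 < Sm i (\<lambda>_. 1)"
        unfolding Sp_def Sm_def using g box_cube by (intro box_sum_pos cube_upd[OF x iV]; simp)+
      have Gs: "G = Sp i g + Sm i g"
        unfolding G_def Sp_def Sm_def by (rule box_sum_split[OF i U(1) x])
      show ?thesis using two_point_entropy[OF P]
        unfolding H_def box_sum_split[OF i U(1) x] Gs Sp_def Sm_def by simp
    qed
    then have "(\<Sum>i\<in>U. H U x - H (U - {i}) (x(i := 1)) - H (U - {i}) (x(i := -1)))
      \<le> (\<Sum>i\<in>U. (Sp i g * Sm i (\<lambda>_. 1) - Sm i g * Sp i (\<lambda>_. 1))\<^sup>2 / (Sp i (\<lambda>_. 1) * Sm i (\<lambda>_. 1) * G))"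
      by (rule sum_mono)
    also have "\<dots> \<le> loc_const * (\<Sum>i\<in>U. box_sum U x (\<lambda>y. (D i g y)\<^sup>2 / Ei i g y))"
      unfolding Sp_def Sm_def
    proof (rule sum_spin_covariances_le[OF U x G])
      fix i assume i: "i \<in> U"
      then have iV: "i \<in> V" using U by auto
      have pos: "0 < Ei i g y" if "y \<in> box U x" for y
        unfolding Ei_def using heat_bath_bounds[OF box_cube[OF that] iV] g cube_upd[OF box_cube[OF that] iV]
        by (intro add_pos_pos mult_pos_pos) auto
      from box_sum_square_le[of U x "Ei i g" "D i g", OF pos]
      show "(box_sum U x (\<lambda>y. \<bar>D i g y\<bar>))\<^sup>2 \<le> G * box_sum U x (\<lambda>y. (D i g y)\<^sup>2 / Ei i g y)"
        by (simp add: G_def box_sum_Ei[OF i U(1)])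
    qed
    finally show "(\<Sum>i\<in>U. H U x - H (U - {i}) (x(i := 1)) - H (U - {i}) (x(i := -1)))
      \<le> loc_const * (\<Sum>i\<in>U. box_sum U x (\<lambda>y. (D i g y)\<^sup>2 / Ei i g y))" .
    qed
  then show ?thesis by (simp add: H_def)
qed

end

context spin_system begin

section \<open>Poincare and logarithmic Sobolev inequalities\<close>

text \<open>The index set of the sites is kept in the form \<open>{1..n}\<close> from here on.\<close>

declare One_nat_def [simp del]
definition mean :: "((nat \<Rightarrow> real) \<Rightarrow> real) \<Rightarrow> real" where
  "mean f = (\<Sum>x\<in>cube n. w x * f x) / (\<Sum>x\<in>cube n. w x)"

lemma mean_eq_box_sum: "mean f = box_sum V x f / box_sum V x (\<lambda>_. 1)"
  by (simp add: mean_def box_sum_def box_full)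

lemma total_weight_pos: "0 < (\<Sum>x\<in>cube n. w x)"
  by (intro sum_pos finite_cube cube_nonempty w_pos)

lemma box_sum_total_pos: "0 < box_sum V x (\<lambda>_. 1)"
  using total_weight_pos by (simp add: box_sum_def box_full)

lemma mean_mono: "(\<And>x. x \<in> cube n \<Longrightarrow> f x \<le> g x) \<Longrightarrow> mean f \<le> mean g"
  unfolding mean_eq_box_sum[of _ undefined] using box_sum_total_pos
  by (intro divide_right_mono box_sum_mono) (auto simp: box_full less_imp_le)

lemma mean_cong: "(\<And>x. x \<in> cube n \<Longrightarrow> f x = g x) \<Longrightarrow> mean f = mean g"
  unfolding mean_def by simp

lemma mean_nonneg: "(\<And>x. x \<in> cube n \<Longrightarrow> 0 \<le> f x) \<Longrightarrow> 0 \<le> mean f"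
  unfolding mean_eq_box_sum[of _ undefined] using box_sum_total_pos
  by (intro divide_nonneg_pos box_sum_nonneg) (auto simp: box_full)

lemma mean_add: "mean (\<lambda>x. f x + g x) = mean f + mean g"
  by (simp add: mean_eq_box_sum[of _ undefined] box_sum_add add_divide_distrib)

lemma mean_diff: "mean (\<lambda>x. f x - g x) = mean f - mean g"
  by (simp add: mean_eq_box_sum[of _ undefined] box_sum_diff diff_divide_distrib)

lemma mean_cmult: "mean (\<lambda>x. c * f x) = c * mean f"
  by (simp add: mean_eq_box_sum[of _ undefined] box_sum_cmult)

lemma mean_minus: "mean (\<lambda>x. - f x) = - mean f"
  using mean_cmult[of "-1" f] by simp

lemma mean_sum: "mean (\<lambda>x. \<Sum>i\<in>I. f i x) = (\<Sum>i\<in>I. mean (f i))"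
  by (simp add: mean_eq_box_sum[of _ undefined] box_sum_sum sum_divide_distrib)

lemma mean_const [simp]: "mean (\<lambda>_. c) = c"
  using total_weight_pos by (simp add: mean_def sum_distrib_right[symmetric])

lemma mean_abs: "\<bar>mean f\<bar> \<le> mean (\<lambda>x. \<bar>f x\<bar>)"
  using mean_mono[of f "\<lambda>x. \<bar>f x\<bar>"] mean_mono[of "\<lambda>x. - f x" "\<lambda>x. \<bar>f x\<bar>"] mean_minus[of f]
  by (simp add: abs_le_iff)

lemma mean_Ei: "i \<in> V \<Longrightarrow> mean (Ei i f) = mean f"
  by (simp add: mean_eq_box_sum[of _ undefined] box_sum_Ei)

lemma mean_dirichlet:
  "i \<in> V \<Longrightarrow> mean (\<lambda>x. g x * (f x - Ei i f x)) = mean (\<lambda>x. p i x * (1 - p i x) * D i g x * D i f x)"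
  by (simp add: mean_eq_box_sum[of _ undefined] box_sum_dirichlet)

text \<open>Flipping a spin changes the weight of a configuration by a factor of at most \<open>1 / \<alpha>\<close>.\<close>
lemma mean_flip_le:
  assumes i: "i \<in> V" and f: "\<And>x. x \<in> cube n \<Longrightarrow> 0 \<le> f x"
  shows "mean (\<lambda>x. f (flip i x)) \<le> mean f / \<alpha>"
proof -
  have "mean (\<lambda>x. f (flip i x)) = mean (Ei i (\<lambda>x. f (flip i x)))" by (simp add: mean_Ei[OF i])
  also have "\<dots> \<le> mean (\<lambda>x. (1 / \<alpha>) * Ei i f x)"
  proof (rule mean_mono)
    fix x assume x: "x \<in> cube n"
    have f1: "0 \<le> f (x(i := 1))" "0 \<le> f (x(i := -1))" using f cube_upd[OF x i] by auto
    have a: "\<alpha> \<le> p i x" "p i x \<le> 1 - \<alpha>" using heat_bath_ge[OF x i] heat_bath_le[OF x i] .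
    have "\<alpha> * Ei i (\<lambda>x. f (flip i x)) x = (\<alpha> * p i x) * f (x(i := -1)) + (\<alpha> * (1 - p i x)) * f (x(i := 1))"
      by (simp add: Ei_def flip_def algebra_simps)
    also have "\<dots> \<le> (1 - p i x) * f (x(i := -1)) + p i x * f (x(i := 1))"
    proof (intro add_mono mult_right_mono f1)
      have "\<alpha> * p i x \<le> \<alpha> * 1" using a \<alpha>_pos by (intro mult_left_mono) auto
      then show "\<alpha> * p i x \<le> 1 - p i x" using a by linarith
      have "\<alpha> * (1 - p i x) \<le> \<alpha> * 1" using a \<alpha>_pos by (intro mult_left_mono) auto
      then show "\<alpha> * (1 - p i x) \<le> p i x" using a by linarith
    qed
    finally show "Ei i (\<lambda>x. f (flip i x)) x \<le> (1 / \<alpha>) * Ei i f x"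
      using \<alpha>_pos by (simp add: field_simps Ei_def)
  qed
  also have "\<dots> = mean f / \<alpha>" unfolding mean_cmult mean_Ei[OF i] by simp
  finally show ?thesis .
qed

lemma poincare: "mean (\<lambda>x. (f x)\<^sup>2) - (mean f)\<^sup>2 \<le> loc_const * (\<Sum>i\<in>V. mean (\<lambda>x. (D i f x)\<^sup>2))"
proof -
  obtain x where x: "x \<in> cube n" using cube_nonempty by blast
  define Z where "Z = box_sum V x (\<lambda>_. 1)"
  have Z: "0 < Z" unfolding Z_def by (rule box_sum_total_pos)
  have sc: "box_sum V x h = Z * mean h" for h using Z by (simp add: mean_eq_box_sum[of _ x] Z_def)
  have "Z * mean (\<lambda>x. (f x)\<^sup>2) - (Z * mean f)\<^sup>2 / (Z * 1) \<le> loc_const * (\<Sum>i\<in>V. Z * mean (\<lambda>x. (D i f x)\<^sup>2))"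
    using pinned_poincare[OF order.refl x, of f] unfolding sc mean_const .
  then have "Z * (mean (\<lambda>x. (f x)\<^sup>2) - (mean f)\<^sup>2) \<le> Z * (loc_const * (\<Sum>i\<in>V. mean (\<lambda>x. (D i f x)\<^sup>2)))"
    using Z unfolding sum_distrib_left[symmetric] by (simp add: power2_eq_square algebra_simps)
  then show ?thesis using Z by simp
qed

definition "lsi_const = 2 * loc_const / \<alpha>"

lemma lsi_const_pos: "0 < lsi_const"
  using loc_const_pos \<alpha>_pos by (simp add: lsi_const_def)

lemma entropy_le_energy:
  assumes r: "\<And>y. y \<in> cube n \<Longrightarrow> 0 < r y"
  shows "mean (\<lambda>y. (r y)\<^sup>2 * ln ((r y)\<^sup>2)) - mean (\<lambda>y. (r y)\<^sup>2) * ln (mean (\<lambda>y. (r y)\<^sup>2))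
    \<le> lsi_const * (\<Sum>i\<in>V. mean (\<lambda>y. (D i r y)\<^sup>2))"
proof -
  obtain x where x: "x \<in> cube n" using cube_nonempty by blast
  define Z where "Z = box_sum V x (\<lambda>_. 1)"
  have Z: "0 < Z" unfolding Z_def by (rule box_sum_total_pos)
  define g where "g y = (r y)\<^sup>2" for y
  have g: "0 < g y" if "y \<in> cube n" for y using r[OF that] by (simp add: g_def)
  have loc: "(D i g y)\<^sup>2 / Ei i g y \<le> (2 / \<alpha>) * (D i r y)\<^sup>2" if y: "y \<in> cube n" and i: "i \<in> V" for i y
  proof -
    let ?a = "r (y(i := 1))" and ?b = "r (y(i := -1))"
    have ab: "0 < ?a" "0 < ?b" using r cube_upd[OF y i] by auto
    have E: "\<alpha> * (?a\<^sup>2 + ?b\<^sup>2) \<le> Ei i g y"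
      unfolding Ei_def g_def distrib_left using heat_bath_ge[OF y i] heat_bath_le[OF y i]
      by (intro add_mono mult_right_mono) auto
    have ab2: "0 < \<alpha> * (?a\<^sup>2 + ?b\<^sup>2)" using \<alpha>_pos ab by (intro mult_pos_pos add_pos_pos) auto
    have "(D i g y)\<^sup>2 = (?a - ?b)\<^sup>2 * (?a + ?b)\<^sup>2"
      by (simp add: disc_deriv_def g_def power2_eq_square algebra_simps)
    also have "\<dots> \<le> (?a - ?b)\<^sup>2 * (2 * (?a\<^sup>2 + ?b\<^sup>2))"
      using zero_le_power2[of "?a - ?b"]
      by (intro mult_left_mono) (auto simp: power2_eq_square algebra_simps)
    finally have "(D i g y)\<^sup>2 \<le> (2 / \<alpha>) * (?a - ?b)\<^sup>2 * (\<alpha> * (?a\<^sup>2 + ?b\<^sup>2))"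
      using \<alpha>_pos by (simp add: distrib_left mult_ac)
    then have "(D i g y)\<^sup>2 \<le> (2 / \<alpha>) * (?a - ?b)\<^sup>2 * Ei i g y"
      using E \<alpha>_pos by (smt (verit) mult_left_mono divide_nonneg_pos mult_nonneg_nonneg zero_le_power2)
    then show ?thesis using E ab2 by (simp add: disc_deriv_def pos_divide_le_eq)
  qed
  have sc: "box_sum V x h = Z * mean h" for h using Z by (simp add: mean_eq_box_sum[of _ x] Z_def)
  have "box_sum V x (\<lambda>y. g y * ln (g y)) - box_sum V x g * ln (box_sum V x g / box_sum V x (\<lambda>_. 1))
    \<le> loc_const * (\<Sum>i\<in>V. box_sum V x (\<lambda>y. (D i g y)\<^sup>2 / Ei i g y))"
    by (rule pinned_entropy[OF order.refl x g])
  also have "\<dots> \<le> loc_const * (\<Sum>i\<in>V. box_sum V x (\<lambda>y. (2 / \<alpha>) * (D i r y)\<^sup>2))"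
    using loc_const_pos by (intro mult_left_mono sum_mono box_sum_mono loc) (auto simp: box_full)
  also have "\<dots> = Z * (lsi_const * (\<Sum>i\<in>V. mean (\<lambda>y. (D i r y)\<^sup>2)))"
    unfolding sc mean_cmult lsi_const_def by (simp add: sum_distrib_left mult_ac)
  finally have "Z * (mean (\<lambda>y. g y * ln (g y)) - mean g * ln (mean g)) \<le> Z * (lsi_const * (\<Sum>i\<in>V. mean (\<lambda>y. (D i r y)\<^sup>2)))"
    using Z unfolding sc by (simp add: algebra_simps)
  then show ?thesis using Z by (simp add: g_def[abs_def])
qed

text \<open>By Jensen's inequality for the logarithm under the density \<open>u\<^sup>2 / E u\<^sup>2\<close>, the entropy of \<open>u\<^sup>2\<close> is at
  least \<open>N * ln (N / M\<^sup>2)\<close> with \<open>N = E u\<^sup>2\<close> and \<open>M = E \<bar>u\<bar>\<close>, and this convex function of \<open>N\<close> lies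
  above each of its tangents. The linear form makes sense where \<open>u\<close> vanishes, so it follows from the
  case of the positive functions \<open>\<bar>u\<bar> + \<epsilon>\<close>.\<close>
lemma linearized_log_sobolev:
  "k * mean (\<lambda>x. (u x)\<^sup>2) \<le> lsi_const * (\<Sum>i\<in>V. mean (\<lambda>x. (D i u x)\<^sup>2)) + exp k * (mean (\<lambda>x. \<bar>u x\<bar>))\<^sup>2"
proof -
  define A where "A = mean (\<lambda>x. (u x)\<^sup>2)"
  define B where "B = mean (\<lambda>x. \<bar>u x\<bar>)"
  define R where "R = lsi_const * (\<Sum>i\<in>V. mean (\<lambda>x. (D i u x)\<^sup>2))"
  have eps: "k * (A + 2 * \<epsilon> * B + \<epsilon>\<^sup>2) - exp k * (B + \<epsilon>)\<^sup>2 \<le> R" if \<epsilon>: "0 < \<epsilon>" for \<epsilon>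
  proof -
    define r where "r x = \<bar>u x\<bar> + \<epsilon>" for x
    have r: "0 < r x" for x using \<epsilon> by (simp add: r_def add_nonneg_pos)
    define N where "N = mean (\<lambda>x. (r x)\<^sup>2)"
    define M where "M = mean r"
    have r2: "(r x)\<^sup>2 = (u x)\<^sup>2 + (2 * \<epsilon> * \<bar>u x\<bar> + \<epsilon>\<^sup>2)" for x
      by (simp add: r_def power2_sum)
    have N: "N = A + 2 * \<epsilon> * B + \<epsilon>\<^sup>2"
      unfolding N_def r2 mean_add mean_cmult mean_const A_def B_def by simp
    have M: "M = B + \<epsilon>"
      unfolding M_def r_def[abs_def] mean_add mean_const B_def by simp
    have AB: "0 \<le> A" "0 \<le> B" unfolding A_def B_def by (auto intro: mean_nonneg)
    have NM: "0 < N" "0 < M" using AB \<epsilon> by (auto simp: N M add_nonneg_pos)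
    have "2 * (N * ln (N / M)) = mean (\<lambda>x. 2 * ((r x)\<^sup>2 * ln (N / M) + (r x)\<^sup>2 - (N / M) * r x))"
    proof -
      have "mean (\<lambda>x. 2 * ((r x)\<^sup>2 * ln (N / M) + (r x)\<^sup>2 - (N / M) * r x))
        = mean (\<lambda>x. 2 * (ln (N / M) * (r x)\<^sup>2 + (r x)\<^sup>2 - (N / M) * r x))" by (simp add: mult.commute)
      also have "\<dots> = 2 * (ln (N / M) * N + N - (N / M) * M)"
        unfolding mean_cmult mean_diff mean_add N_def M_def ..
      finally show ?thesis using NM by simp
    qed
    also have "\<dots> \<le> mean (\<lambda>x. (r x)\<^sup>2 * ln ((r x)\<^sup>2))"
    proof (rule mean_mono)
      fix x 
      have "ln (N / (M * r x)) \<le> N / (M * r x) - 1"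
        using NM r[of x] by (intro ln_le_minus_one) simp
      moreover have "ln (N / (M * r x)) = ln (N / M) - ln (r x)"
        using NM r[of x] by (simp add: ln_div ln_mult)
      ultimately have "ln (N / M) + 1 - N / (M * r x) \<le> ln (r x)" by simp
      then have "(r x)\<^sup>2 * (ln (N / M) + 1 - N / (M * r x)) \<le> (r x)\<^sup>2 * ln (r x)"
        by (intro mult_left_mono) auto
      moreover have "(r x)\<^sup>2 * (ln (N / M) + 1 - N / (M * r x)) = (r x)\<^sup>2 * ln (N / M) + (r x)\<^sup>2 - (N / M) * r x"
        using r[of x] NM by (simp add: power2_eq_square field_simps)
      ultimately have "(r x)\<^sup>2 * ln (N / M) + (r x)\<^sup>2 - (N / M) * r x \<le> (r x)\<^sup>2 * ln (r x)"
        by simp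
      then have "2 * ((r x)\<^sup>2 * ln (N / M) + (r x)\<^sup>2 - (N / M) * r x) \<le> 2 * ((r x)\<^sup>2 * ln (r x))"
        by (rule mult_left_mono) simp
      also have "\<dots> = (r x)\<^sup>2 * ln ((r x)\<^sup>2)" using r[of x] by (simp add: ln_realpow)
      finally show "2 * ((r x)\<^sup>2 * ln (N / M) + (r x)\<^sup>2 - (N / M) * r x) \<le> (r x)\<^sup>2 * ln ((r x)\<^sup>2)"
        .
    qed
    also have "\<dots> \<le> lsi_const * (\<Sum>i\<in>V. mean (\<lambda>y. (D i r y)\<^sup>2)) + N * ln N"
      using entropy_le_energy[of r] r by (simp add: N_def)
    also have "lsi_const * (\<Sum>i\<in>V. mean (\<lambda>y. (D i r y)\<^sup>2)) \<le> R"
      unfolding R_def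
    proof (intro mult_left_mono sum_mono mean_mono)
      fix i y 
      have "\<bar>D i r y\<bar> \<le> \<bar>D i u y\<bar>" unfolding disc_deriv_def r_def by linarith
      then show "(D i r y)\<^sup>2 \<le> (D i u y)\<^sup>2" by (simp add: abs_le_square_iff)
    qed (use lsi_const_pos in auto)
    finally have "2 * (N * ln (N / M)) - N * ln N \<le> R" by simp
    moreover have "N * k - exp k * M\<^sup>2 \<le> 2 * (N * ln (N / M)) - N * ln N"
    proof -
      have "ln (M\<^sup>2 * exp k / N) \<le> M\<^sup>2 * exp k / N - 1"
        using NM by (intro ln_le_minus_one) simp
      moreover have "ln (M\<^sup>2 * exp k / N) = 2 * ln M + k - ln N"
        using NM by (simp add: ln_div ln_mult ln_realpow)
      ultimately have "N * (k - M\<^sup>2 * exp k / N) \<le> N * (ln N - 2 * ln M)"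
        using NM by (intro mult_left_mono) auto
      then show ?thesis using NM by (simp add: ln_div algebra_simps)
    qed
    ultimately show ?thesis unfolding N M by (simp add: mult.commute)
  qed
  have "((\<lambda>\<epsilon>. k * (A + 2 * \<epsilon> * B + \<epsilon>\<^sup>2) - exp k * (B + \<epsilon>)\<^sup>2) \<longlongrightarrow> k * A - exp k * B\<^sup>2) (at_right 0)"
    by (auto intro!: tendsto_eq_intros)
  then have "k * A - exp k * B\<^sup>2 \<le> R"
  proof (rule tendsto_upperbound)
    show "\<forall>\<^sub>F \<epsilon> in at_right 0. k * (A + 2 * \<epsilon> * B + \<epsilon>\<^sup>2) - exp k * (B + \<epsilon>)\<^sup>2 \<le> R"
      using eps by (auto simp: eventually_at_filter)
  qed simp
  then show ?thesis by (simp add: A_def B_def R_def)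
qed

section \<open>The Glauber semigroup\<close>
definition L :: "((nat \<Rightarrow> real) \<Rightarrow> real) \<Rightarrow> (nat \<Rightarrow> real) \<Rightarrow> real" where
  "L f x = (\<Sum>i\<in>V. Ei i f x - f x)"

abbreviation "K \<equiv> glauber V"

text \<open>The semigroup generated by \<open>L\<close>. As \<open>L = n (K - 1)\<close>, it is the average of the powers of \<open>K\<close> over a Poisson
  distribution with mean \<open>n t\<close>, which makes positivity and L1-bounds evident.\<close>
definition P :: "real \<Rightarrow> ((nat \<Rightarrow> real) \<Rightarrow> real) \<Rightarrow> (nat \<Rightarrow> real) \<Rightarrow> real" where
  "P t f x = exp (- (real n * t)) * (\<Sum>k. (real n * t) ^ k / fact k * (K ^^ k) f x)"

lemma L_eq: "L f x = real n * (K f x - f x)"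
  using n_pos by (simp add: L_def glauber_def sum_subtractf algebra_simps)

lemma K_nonneg:
  assumes f: "\<And>y. y \<in> cube n \<Longrightarrow> 0 \<le> f y" and x: "x \<in> cube n"
  shows "0 \<le> K f x"
  unfolding glauber_def Ei_def using heat_bath_bounds[OF x] f cube_upd[OF x]
  by (intro divide_nonneg_nonneg sum_nonneg add_nonneg_nonneg mult_nonneg_nonneg) (auto intro: less_imp_le)

lemma K_iter_nonneg: "(\<And>y. y \<in> cube n \<Longrightarrow> 0 \<le> f y) \<Longrightarrow> x \<in> cube n \<Longrightarrow> 0 \<le> (K ^^ k) f x"
proof (induction k arbitrary: x)
  case (Suc k)
  then show ?case using K_nonneg[of "(K ^^ k) f" x] by simp
qed simp

lemma K_abs_le:
  assumes f: "\<And>y. y \<in> cube n \<Longrightarrow> \<bar>f y\<bar> \<le> B" and x: "x \<in> cube n"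
  shows "\<bar>K f x\<bar> \<le> B"
proof -
  have "\<bar>K f x\<bar> \<le> (\<Sum>j\<in>V. B) / real (card V)"
    unfolding glauber_def abs_divide abs_of_nat
  proof (intro divide_right_mono order.trans[OF sum_abs] sum_mono)
    fix j assume j: "j \<in> V"
    have "\<bar>Ei j f x\<bar> \<le> Ei j (\<lambda>y. \<bar>f y\<bar>) x" by (rule Ei_abs[OF x j])
    also have "\<dots> \<le> Ei j (\<lambda>y. B) x" by (rule Ei_mono[OF x j f])
    finally show "\<bar>Ei j f x\<bar> \<le> B" by simp
  qed auto
  then show ?thesis using n_pos by simp
qed

lemma bounded_on_cube:
  fixes f :: "(nat \<Rightarrow> real) \<Rightarrow> real"
  obtains B where "\<And>y. y \<in> cube n \<Longrightarrow> \<bar>f y\<bar> \<le> B"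
proof
  show "\<bar>f y\<bar> \<le> (\<Sum>y\<in>cube n. \<bar>f y\<bar>)" if "y \<in> cube n" for y
    using that finite_cube by (intro member_le_sum) auto
qed

lemma K_iter_bounded:
  obtains B where "\<And>k y. y \<in> cube n \<Longrightarrow> \<bar>(K ^^ k) f y\<bar> \<le> B"
proof -
  obtain B where B: "\<And>y. y \<in> cube n \<Longrightarrow> \<bar>f y\<bar> \<le> B" using bounded_on_cube[of f] by blast
  have "\<bar>(K ^^ k) f y\<bar> \<le> B" if "y \<in> cube n" for k y
    using that
  proof (induction k arbitrary: y)
    case (Suc k)
    then show ?case using K_abs_le[of "(K ^^ k) f" B y] by simp
  qed (simp add: B)
  then show ?thesis by (rule that)
qed

lemma exp_series_summable:
  fixes b :: "nat \<Rightarrow> real"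
  assumes "\<And>k. \<bar>b k\<bar> \<le> B"
  shows "summable (\<lambda>k. s ^ k / fact k * b k)"
proof (rule summable_comparison_test')
  show "summable (\<lambda>k. (\<bar>s\<bar> ^ k / fact k) * B)"
    using summable_exp[of "\<bar>s\<bar>"] by (intro summable_mult2) (simp add: field_simps)
  show "norm (s ^ k / fact k * b k) \<le> (\<bar>s\<bar> ^ k / fact k) * B" if "0 \<le> k" for k
    unfolding real_norm_def abs_mult using assms[of k]
    by (intro mult_mono) (auto simp: power_abs)
qed

lemma K_iter_summable: "x \<in> cube n \<Longrightarrow> summable (\<lambda>k. s ^ k / fact k * (K ^^ k) f x)"
proof -
  assume x: "x \<in> cube n"
  obtain B where "\<And>k y. y \<in> cube n \<Longrightarrow> \<bar>(K ^^ k) f y\<bar> \<le> B" using K_iter_bounded[of f] by blast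
  then show ?thesis using x by (intro exp_series_summable[of _ B]) auto
qed

lemma P_0 [simp]: "P 0 f x = f x"
proof -
  have "(\<Sum>k. (real n * 0) ^ k / fact k * (K ^^ k) f x) = (\<Sum>k\<in>{0}. (real n * 0) ^ k / fact k * (K ^^ k) f x)"
    by (rule suminf_finite) (auto simp: power_0_left)
  then show ?thesis by (simp add: P_def)
qed

lemma P_nonneg:
  assumes "\<And>y. y \<in> cube n \<Longrightarrow> 0 \<le> f y" "x \<in> cube n" "0 \<le> t"
  shows "0 \<le> P t f x"
  unfolding P_def using assms
  by (intro mult_nonneg_nonneg suminf_nonneg K_iter_summable K_iter_nonneg) auto

lemma P_deriv:
  assumes x: "x \<in> cube n"
  shows "((\<lambda>t. P t f x) has_real_derivative L (P t f) x) (at t)"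
proof -
  define c where "c k = (K ^^ k) f x / fact k" for k
  define F where "F s = (\<Sum>k. c k * s ^ k)" for s :: real
  have form: "s ^ k / fact k * (K ^^ k) f y = (K ^^ k) f y / fact k * s ^ k" for s y k by simp
  have sm: "summable (\<lambda>k. (K ^^ k) f y / fact k * s ^ k)" if "y \<in> cube n" for y s
    using K_iter_summable[OF that, of s f] by (simp only: form)
  have F: "(F has_real_derivative (\<Sum>k. diffs c k * s ^ k)) (at s)" for s
    unfolding F_def c_def by (rule termdiffs_strong_converges_everywhere) (rule sm[OF x])
  have PF: "P t f y = exp (- (real n * t)) * (\<Sum>k. (K ^^ k) f y / fact k * (real n * t) ^ k)" for t y
    by (simp only: P_def form)
  have dF: "(\<Sum>k. diffs c k * s ^ k) = (\<Sum>j\<in>V. p j x * (\<Sum>k. (K ^^ k) f (x(j := 1)) / fact k * s ^ k)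
      + (1 - p j x) * (\<Sum>k. (K ^^ k) f (x(j := -1)) / fact k * s ^ k)) / real n" for s
  proof -
    have "diffs c k = (\<Sum>j\<in>V. p j x * ((K ^^ k) f (x(j := 1)) / fact k) + (1 - p j x) * ((K ^^ k) f (x(j := -1)) / fact k)) / real n" for k
    proof -
      have "diffs c k = K ((K ^^ k) f) x / fact k"
        by (simp add: diffs_def c_def field_simps del: of_nat_Suc)
      then show ?thesis
        by (simp add: glauber_def Ei_def sum_divide_distrib add_divide_distrib mult.commute)
    qed
    then have "diffs c k * s ^ k = (\<Sum>j\<in>V. p j x * ((K ^^ k) f (x(j := 1)) / fact k * s ^ k)
      + (1 - p j x) * ((K ^^ k) f (x(j := -1)) / fact k * s ^ k)) / real n" for k
      by (simp only: times_divide_eq_left sum_distrib_right distrib_right mult.assoc)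
    moreover have "(\<lambda>k. (\<Sum>j\<in>V. p j x * ((K ^^ k) f (x(j := 1)) / fact k * s ^ k)
      + (1 - p j x) * ((K ^^ k) f (x(j := -1)) / fact k * s ^ k)) / real n) sums
      ((\<Sum>j\<in>V. p j x * (\<Sum>k. (K ^^ k) f (x(j := 1)) / fact k * s ^ k)
      + (1 - p j x) * (\<Sum>k. (K ^^ k) f (x(j := -1)) / fact k * s ^ k)) / real n)"
      by (intro sums_divide sums_sum sums_add sums_mult summable_sums sm cube_upd[OF x]) auto
    ultimately show ?thesis by (simp add: sums_iff)
  qed
  have 1: "((\<lambda>t. exp (- (real n * t)) * F (real n * t)) has_real_derivative
     (exp (- (real n * t)) * (real n * (\<Sum>k. diffs c k * (real n * t) ^ k)) - real n * (exp (- (real n * t)) * F (real n * t)))) (at t)"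
    by (auto intro!: derivative_eq_intros DERIV_chain2[OF F] simp: algebra_simps)
  have 2: "exp (- (real n * t)) * F (real n * t) = P t f x" for t
    by (simp add: PF F_def c_def)
  have 3: "exp (- (real n * t)) * (real n * (\<Sum>k. diffs c k * (real n * t) ^ k)) = real n * K (P t f) x"
    using n_pos unfolding dF by (simp add: glauber_def Ei_def PF sum_distrib_left algebra_simps)
  show ?thesis using 1 unfolding 2 3 L_eq right_diff_distrib .
qed

lemma mean_poisson_average_le:
  assumes bd: "\<And>k x. x \<in> cube n \<Longrightarrow> \<bar>b k x\<bar> \<le> B"
    and le: "\<And>k. mean (\<lambda>x. \<bar>b k x\<bar>) \<le> c * \<gamma> ^ k" and s: "0 \<le> s"
  shows "mean (\<lambda>x. \<bar>exp (- s) * (\<Sum>k. s ^ k / fact k * b k x)\<bar>) \<le> c * exp (s * (\<gamma> - 1))"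
proof -
  define h where "h x = (\<Sum>k. s ^ k / fact k * \<bar>b k x\<bar>)" for x
  have sm: "summable (\<lambda>k. s ^ k / fact k * \<bar>b k x\<bar>)" if "x \<in> cube n" for x
    using bd[OF that] by (intro exp_series_summable) auto
  have "mean (\<lambda>x. \<bar>exp (- s) * (\<Sum>k. s ^ k / fact k * b k x)\<bar>) \<le> mean (\<lambda>x. exp (- s) * h x)"
  proof (rule mean_mono)
    fix x assume x: "x \<in> cube n"
    have "\<bar>\<Sum>k. s ^ k / fact k * b k x\<bar> \<le> (\<Sum>k. \<bar>s ^ k / fact k * b k x\<bar>)"
      using sm[OF x] s by (intro summable_rabs) (simp add: abs_mult)
    then show "\<bar>exp (- s) * (\<Sum>k. s ^ k / fact k * b k x)\<bar> \<le> exp (- s) * h x"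
      using s by (simp add: abs_mult h_def)
  qed
  also have "\<dots> = exp (- s) * mean h" by (rule mean_cmult)
  also have "mean h \<le> c * exp (s * \<gamma>)"
  proof -
    have "(\<lambda>k. mean (\<lambda>x. s ^ k / fact k * \<bar>b k x\<bar>)) sums mean h"
      unfolding mean_def h_def by (intro sums_divide sums_sum sums_mult summable_sums sm)
    then have "(\<lambda>k. s ^ k / fact k * mean (\<lambda>x. \<bar>b k x\<bar>)) sums mean h" by (simp only: mean_cmult)
    moreover have "(\<lambda>k. c * ((s * \<gamma>) ^ k /\<^sub>R fact k)) sums (c * exp (s * \<gamma>))"
      by (intro sums_mult exp_converges)
    moreover have "s ^ k / fact k * mean (\<lambda>x. \<bar>b k x\<bar>) \<le> c * ((s * \<gamma>) ^ k /\<^sub>R fact k)" for k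
    proof -
      have "s ^ k / fact k * mean (\<lambda>x. \<bar>b k x\<bar>) \<le> s ^ k / fact k * (c * \<gamma> ^ k)"
        using s by (intro mult_left_mono le) auto
      also have "\<dots> = c * ((s * \<gamma>) ^ k /\<^sub>R fact k)"
        by (simp add: power_mult_distrib divide_inverse)
      finally show ?thesis .
    qed
    ultimately show ?thesis by (metis (no_types, lifting) sums_le)
  qed
  finally show ?thesis
    by (simp add: right_diff_distrib exp_diff exp_minus field_simps)
qed

definition dirichlet :: "((nat \<Rightarrow> real) \<Rightarrow> real) \<Rightarrow> ((nat \<Rightarrow> real) \<Rightarrow> real) \<Rightarrow> real" where
  "dirichlet g f = (\<Sum>i\<in>V. mean (\<lambda>x. p i x * (1 - p i x) * D i g x * D i f x))"

lemma mean_mult_L: "mean (\<lambda>x. g x * L f x) = - dirichlet g f"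
proof -
  have "mean (\<lambda>x. g x * L f x) = mean (\<lambda>x. \<Sum>i\<in>V. - (g x * (f x - Ei i f x)))"
    by (simp add: L_def sum_distrib_left algebra_simps)
  also have "\<dots> = (\<Sum>i\<in>V. - mean (\<lambda>x. g x * (f x - Ei i f x)))"
    unfolding mean_sum mean_minus ..
  also have "\<dots> = - dirichlet g f"
    by (simp add: dirichlet_def sum_negf mean_dirichlet)
  finally show ?thesis .
qed

lemma mean_L_symmetric: "mean (\<lambda>x. g x * L f x) = mean (\<lambda>x. f x * L g x)"
  unfolding mean_mult_L dirichlet_def by (simp add: mult_ac)

lemma mean_L: "mean (L f) = 0"
  using mean_mult_L[of "\<lambda>_. 1" f] by (simp add: dirichlet_def disc_deriv_def)

lemma mean_deriv:
  assumes "\<And>x. x \<in> cube n \<Longrightarrow> ((\<lambda>t. F t x) has_real_derivative F' x) (at t)"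
  shows "((\<lambda>t. mean (F t)) has_real_derivative mean F') (at t)"
  unfolding mean_def by (intro DERIV_cdivide DERIV_sum DERIV_cmult assms)

lemma P_deriv_chain:
  assumes x: "x \<in> cube n" and g: "(g has_real_derivative g') (at s)"
  shows "((\<lambda>s. P (g s) f x) has_real_derivative L (P (g s) f) x * g') (at s)"
  using DERIV_chain2[OF P_deriv[OF x] g] .

lemma D_P_deriv:
  assumes x: "x \<in> cube n" and i: "i \<in> V"
  shows "((\<lambda>t. D i (P t f) x) has_real_derivative D i (L (P t f)) x) (at t)"
  unfolding disc_deriv_def by (intro DERIV_diff P_deriv cube_upd[OF x i]) auto

lemma L_P_deriv:
  assumes x: "x \<in> cube n"
  shows "((\<lambda>t. L (P t f) x) has_real_derivative L (L (P t f)) x) (at t)"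
proof -
  have L: "L F x = (\<Sum>i\<in>V. p i x * F (x(i := 1)) + (1 - p i x) * F (x(i := -1)) - F x)" for F
    by (simp add: L_def Ei_def)
  have eq: "(\<lambda>t. L (P t f) x) = (\<lambda>t. \<Sum>i\<in>V. p i x * P t f (x(i := 1)) + (1 - p i x) * P t f (x(i := -1)) - P t f x)"
    by (simp add: L)
  show ?thesis unfolding eq L[of "L (P t f)"]
    by (intro DERIV_sum DERIV_diff DERIV_add DERIV_cmult P_deriv cube_upd[OF x] x) auto
qed

lemma mean_P: "mean (P t f) = mean f"
proof -
  have "\<forall>t. ((\<lambda>t. mean (P t f)) has_real_derivative 0) (at t)"
  proof
    fix t
    have "((\<lambda>t. mean (P t f)) has_real_derivative mean (L (P t f))) (at t)"
      by (rule mean_deriv) (rule P_deriv)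
    then show "((\<lambda>t. mean (P t f)) has_real_derivative 0) (at t)" by (simp add: mean_L)
  qed
  from DERIV_isconst_all[OF this, of t 0] show ?thesis
    using mean_cong[of "P 0 f" f] by simp
qed

text \<open>By symmetry of \<open>L\<close> the mean of \<open>P s f * P (2 * t - s) f\<close> does not depend on \<open>s\<close>.\<close>
lemma mean_mult_P_double: "mean (\<lambda>x. f x * P (2 * t) f x) = mean (\<lambda>x. (P t f x)\<^sup>2)"
proof -
  define F where "F s = mean (\<lambda>x. P s f x * P (2 * t - s) f x)" for s
  have "\<forall>s. (F has_real_derivative 0) (at s)"
  proof
    fix s
    have "(F has_real_derivative mean (\<lambda>x. P s f x * (L (P (2 * t - s) f) x * (- 1)) + L (P s f) x * P (2 * t - s) f x)) (at s)"
      unfolding F_def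
      by (intro mean_deriv DERIV_mult' P_deriv P_deriv_chain) (auto intro!: derivative_eq_intros)
    also have "mean (\<lambda>x. P s f x * (L (P (2 * t - s) f) x * (- 1)) + L (P s f) x * P (2 * t - s) f x)
      = mean (\<lambda>x. P (2 * t - s) f x * L (P s f) x) - mean (\<lambda>x. P s f x * L (P (2 * t - s) f) x)"
      by (simp add: mean_diff[symmetric] algebra_simps)
    also have "\<dots> = 0" by (subst mean_L_symmetric) simp
    finally show "(F has_real_derivative 0) (at s)" .
  qed
  from DERIV_isconst_all[OF this, of 0 t] show ?thesis
    by (simp add: F_def power2_eq_square)
qed

section \<open>Curvature and gradient smoothing\<close>
definition Gam :: "((nat \<Rightarrow> real) \<Rightarrow> real) \<Rightarrow> (nat \<Rightarrow> real) \<Rightarrow> real" where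
  "Gam f x = (\<Sum>i\<in>V. (D i f x)\<^sup>2)"

text \<open>The iterated form of \<open>Gam\<close> in the sense of Bakry and Emery, up to a factor 2, and below it the carre
  du champ, again up to a factor 2. \<open>Gam\<close> is comparable to the carre du champ and commutes better
  with \<open>L\<close>, since it has no weights that depend on the configuration.\<close>
definition Gam2 :: "((nat \<Rightarrow> real) \<Rightarrow> real) \<Rightarrow> (nat \<Rightarrow> real) \<Rightarrow> real" where
  "Gam2 f x = L (Gam f) x - 2 * (\<Sum>i\<in>V. D i f x * D i (L f) x)"

definition cdc :: "((nat \<Rightarrow> real) \<Rightarrow> real) \<Rightarrow> (nat \<Rightarrow> real) \<Rightarrow> real" where
  "cdc f x = L (\<lambda>y. (f y)\<^sup>2) x - 2 * f x * L f x"

text \<open>The right-hand side is the average of \<open>(u - u x)\<^sup>2\<close> over the update at \<open>j\<close>, which flips \<open>x j\<close> with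
  probability at least \<open>\<alpha>\<close>.\<close>
lemma Ei_variance_ge:
  assumes x: "x \<in> cube n" and j: "j \<in> V"
  shows "\<alpha> * (D j u x)\<^sup>2 \<le> Ei j (\<lambda>y. (u y)\<^sup>2) x - (u x)\<^sup>2 - 2 * u x * (Ei j u x - u x)"
proof -
  let ?a = "u (x(j := 1))" and ?b = "u (x(j := -1))"
  have b: "\<alpha> \<le> p j x" "\<alpha> \<le> 1 - p j x" using heat_bath_ge[OF x j] heat_bath_le[OF x j] by auto
  have e: "Ei j (\<lambda>y. (u y)\<^sup>2) x - (u x)\<^sup>2 - 2 * u x * (Ei j u x - u x)
    = p j x * (?a - u x)\<^sup>2 + (1 - p j x) * (?b - u x)\<^sup>2"
    by (simp add: Ei_def power2_eq_square algebra_simps)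
  have sq: "(?b - ?a)\<^sup>2 = (?a - ?b)\<^sup>2" by (rule power2_commute)
  from cube_cases[OF x j] show ?thesis
  proof
    assume "x j = 1"
    then have "u x = ?a" by (simp add: fun_upd_idem)
    then show ?thesis unfolding e disc_deriv_def using b sq by (simp add: mult_right_mono)
  next
    assume "x j = -1"
    then have "u x = ?b" by (simp add: fun_upd_idem)
    then show ?thesis unfolding e disc_deriv_def using b by (simp add: mult_right_mono)
  qed
qed

text \<open>A curvature bound in the sense of Bakry and Emery, for \<open>Gam\<close>. The updates at \<open>j \<noteq> i\<close> contribute second derivatives
  \<open>\<alpha> * (D j (D i f))\<^sup>2\<close>; these absorb the part of the commutator that is evaluated at the flipped
  point, at the price of \<open>d i j * (D i f)\<^sup>2 / \<alpha>\<close>.\<close>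
lemma bochner:
  assumes x: "x \<in> cube n"
  shows "- (1 / \<alpha>) * Gam f x \<le> Gam2 f x"
proof -
  define u where "u i = D i f x" for i
  define T where "T i j = Ei j (\<lambda>y. (D i f y)\<^sup>2) x - (u i)\<^sup>2 - 2 * u i * (D i (Ei j f) x - u i)" for i j
  have 1: "Gam2 f x = (\<Sum>i\<in>V. \<Sum>j\<in>V. T i j)"
  proof -
    have "L (Gam f) x = (\<Sum>j\<in>V. \<Sum>i\<in>V. Ei j (\<lambda>y. (D i f y)\<^sup>2) x - (u i)\<^sup>2)"
      by (simp add: L_def Gam_def Ei_def u_def sum_distrib_left sum.distrib sum_subtractf)
    also have "\<dots> = (\<Sum>i\<in>V. \<Sum>j\<in>V. Ei j (\<lambda>y. (D i f y)\<^sup>2) x - (u i)\<^sup>2)" by (rule sum.swap)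
    finally have "L (Gam f) x = (\<Sum>i\<in>V. \<Sum>j\<in>V. Ei j (\<lambda>y. (D i f y)\<^sup>2) x - (u i)\<^sup>2)" .
    moreover have "D i (L f) x = (\<Sum>j\<in>V. D i (Ei j f) x - u i)" for i
      unfolding L_def disc_deriv_def u_def
      by (subst sum_subtractf[symmetric]) (simp add: algebra_simps)
    ultimately have "L (Gam f) x - 2 * (\<Sum>i\<in>V. u i * D i (L f) x)
      = (\<Sum>i\<in>V. (\<Sum>j\<in>V. Ei j (\<lambda>y. (D i f y)\<^sup>2) x - (u i)\<^sup>2) - 2 * u i * (\<Sum>j\<in>V. D i (Ei j f) x - u i))"
      by (simp only: sum_subtractf[of _ _ V] sum_distrib_left mult.assoc)
    then show ?thesis
      by (simp only: Gam2_def T_def u_def[symmetric] sum_distrib_left sum_subtractf[symmetric])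
  qed
  have T: "(if j = i then 2 * (u i)\<^sup>2 else 0) - d i j * (u i)\<^sup>2 - d i j * (u j)\<^sup>2 - d i j * ((u i)\<^sup>2 / \<alpha>) \<le> T i j"
    if i: "i \<in> V" and j: "j \<in> V" for i j
  proof (cases "j = i")
    case True
    have "T i i = 2 * (u i)\<^sup>2"
      by (simp add: T_def u_def Ei_def power2_eq_square algebra_simps)
    moreover have "0 \<le> d i i * (u i)\<^sup>2" "0 \<le> d i i * ((u i)\<^sup>2 / \<alpha>)"
      using d_nonneg[OF i i] \<alpha>_pos by auto
    ultimately show ?thesis using True by simp
  next
    case False
    define z where "z = \<bar>D j (D i f) x\<bar>"
    define v where "v = D j f (flip i x)"
    define r where "r = D i (p j) x"
    have r: "\<bar>r\<bar> \<le> d i j" unfolding r_def using False by (intro heat_bath_lipschitz x i j) auto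
    have d1: "0 \<le> d i j" "d i j \<le> 1" using d_nonneg[OF i j] d_le_\<rho>[OF i j] \<rho>_less by auto
    have v: "\<bar>v\<bar> \<le> \<bar>u j\<bar> + z"
    proof -
      have "\<bar>u j - v\<bar> = \<bar>D i (D j f) x\<bar>"
        unfolding u_def v_def by (rule abs_disc_deriv_eq[symmetric]) (rule cube_cases[OF x i])
      also have "\<dots> = z" using False by (simp add: z_def disc_deriv_commute)
      finally show ?thesis by linarith
    qed
    have "T i j = (Ei j (\<lambda>y. (D i f y)\<^sup>2) x - (D i f x)\<^sup>2 - 2 * D i f x * (Ei j (D i f) x - D i f x)) - 2 * u i * (r * v)"
      using D_Ei[of x i j f] cube_cases[OF x i] False
      by (simp add: T_def u_def r_def v_def algebra_simps)
    then have t: "\<alpha> * z\<^sup>2 - 2 * u i * (r * v) \<le> T i j"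
      using Ei_variance_ge[OF x j, of "D i f"] by (simp add: z_def)
    have "2 * u i * (r * v) \<le> 2 * \<bar>u i\<bar> * (d i j * (\<bar>u j\<bar> + z))"
    proof -
      have "2 * u i * (r * v) \<le> \<bar>2 * u i * (r * v)\<bar>" by simp
      also have "\<dots> = 2 * \<bar>u i\<bar> * (\<bar>r\<bar> * \<bar>v\<bar>)" by (simp add: abs_mult)
      also have "\<dots> \<le> 2 * \<bar>u i\<bar> * (d i j * (\<bar>u j\<bar> + z))"
        using r v by (intro mult_left_mono mult_mono) auto
      finally show ?thesis .
    qed
    also have "\<dots> = d i j * (2 * \<bar>u i\<bar> * \<bar>u j\<bar>) + d i j * (2 * \<bar>u i\<bar> * z)" by (simp add: algebra_simps)
    also have "\<dots> \<le> d i j * ((u i)\<^sup>2 + (u j)\<^sup>2) + (\<alpha> * z\<^sup>2 + d i j * ((u i)\<^sup>2 / \<alpha>))"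
    proof (intro add_mono mult_left_mono d1)
      show "2 * \<bar>u i\<bar> * \<bar>u j\<bar> \<le> (u i)\<^sup>2 + (u j)\<^sup>2"
        using sum_squares_bound[of "\<bar>u i\<bar>" "\<bar>u j\<bar>"] by simp
      have "0 \<le> (\<alpha> * z - d i j * \<bar>u i\<bar>)\<^sup>2 / \<alpha>" using \<alpha>_pos by simp
      also have "\<dots> = \<alpha> * z\<^sup>2 - d i j * (2 * \<bar>u i\<bar> * z) + d i j * (d i j * ((u i)\<^sup>2 / \<alpha>))"
        using \<alpha>_pos by (simp add: power2_diff power_mult_distrib divide_simps) (simp add: power2_eq_square algebra_simps)
      finally have "d i j * (2 * \<bar>u i\<bar> * z) \<le> \<alpha> * z\<^sup>2 + d i j * (d i j * ((u i)\<^sup>2 / \<alpha>))" by simp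
      also have "d i j * (d i j * ((u i)\<^sup>2 / \<alpha>)) \<le> d i j * (1 * ((u i)\<^sup>2 / \<alpha>))"
        using d1 \<alpha>_pos by (intro mult_left_mono mult_right_mono) auto
      finally show "d i j * (2 * \<bar>u i\<bar> * z) \<le> \<alpha> * z\<^sup>2 + d i j * ((u i)\<^sup>2 / \<alpha>)" by simp
    qed
    finally show ?thesis using t False by (simp add: algebra_simps)
  qed
  have G: "Gam f x = (\<Sum>i\<in>V. (u i)\<^sup>2)" by (simp add: Gam_def u_def)
  have "(\<Sum>i\<in>V. \<Sum>j\<in>V. T i j) \<ge> (\<Sum>i\<in>V. \<Sum>j\<in>V. (if j = i then 2 * (u i)\<^sup>2 else 0) - d i j * (u i)\<^sup>2 - d i j * (u j)\<^sup>2 - d i j * ((u i)\<^sup>2 / \<alpha>))"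
    by (intro sum_mono T)
  also have "(\<Sum>i\<in>V. \<Sum>j\<in>V. (if j = i then 2 * (u i)\<^sup>2 else 0) - d i j * (u i)\<^sup>2 - d i j * (u j)\<^sup>2 - d i j * ((u i)\<^sup>2 / \<alpha>))
     = 2 * Gam f x - (\<Sum>i\<in>V. (\<Sum>j\<in>V. d i j) * (u i)\<^sup>2) - (\<Sum>j\<in>V. (\<Sum>i\<in>V. d i j) * (u j)\<^sup>2) - (\<Sum>i\<in>V. (\<Sum>j\<in>V. d i j) * ((u i)\<^sup>2 / \<alpha>))"
  proof -
    have "(\<Sum>j\<in>V. (\<Sum>i\<in>V. d i j) * (u j)\<^sup>2) = (\<Sum>i\<in>V. \<Sum>j\<in>V. d i j * (u j)\<^sup>2)"
      unfolding sum_distrib_right by (rule sum.swap)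
    then show ?thesis
      by (simp only: sum_subtractf G sum_distrib_right) (simp add: sum_distrib_left)
  qed
  also have "\<dots> \<ge> 2 * Gam f x - (\<Sum>i\<in>V. 1 * (u i)\<^sup>2) - (\<Sum>j\<in>V. 1 * (u j)\<^sup>2) - (\<Sum>i\<in>V. 1 * ((u i)\<^sup>2 / \<alpha>))"
  proof -
    have "(\<Sum>j\<in>V. d i j) \<le> 1" "(\<Sum>j\<in>V. d j i) \<le> 1" if "i \<in> V" for i
      using d_row[OF that] d_col[OF that] \<rho>_less by auto
    then show ?thesis using \<alpha>_pos
      by (intro diff_mono order.refl sum_mono mult_right_mono) auto
  qed
  also have "2 * Gam f x - (\<Sum>i\<in>V. 1 * (u i)\<^sup>2) - (\<Sum>j\<in>V. 1 * (u j)\<^sup>2) - (\<Sum>i\<in>V. 1 * ((u i)\<^sup>2 / \<alpha>)) = - (1 / \<alpha>) * Gam f x"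
    by (simp add: G sum_divide_distrib)
  finally show ?thesis unfolding 1 by simp
qed

lemma carre_du_champ_ge:
  assumes x: "x \<in> cube n"
  shows "\<alpha> * Gam g x \<le> cdc g x"
proof -
  have "\<alpha> * Gam g x = (\<Sum>j\<in>V. \<alpha> * (D j g x)\<^sup>2)" by (simp add: Gam_def sum_distrib_left)
  also have "\<dots> \<le> (\<Sum>j\<in>V. Ei j (\<lambda>y. (g y)\<^sup>2) x - (g x)\<^sup>2 - 2 * g x * (Ei j g x - g x))"
    by (intro sum_mono Ei_variance_ge x)
  also have "\<dots> = cdc g x"
    unfolding cdc_def L_def sum_distrib_left by (simp only: sum_subtractf)
  finally show ?thesis .
qed

definition "smooth_const = \<alpha> * exp (- 1 / \<alpha>)"

lemma smooth_const_pos: "0 < smooth_const"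
  using \<alpha>_pos by (simp add: smooth_const_def)

text \<open>The reverse Poincare inequality. \<open>P s ((P (t - s) f)\<^sup>2)\<close> increases in \<open>s\<close> at a rate of at least
  \<open>\<alpha> * P s (Gam (P (t - s) f))\<close>, and by curvature this rate is, up to a constant, at least its value at
  \<open>s = 0\<close>. Evaluation of \<open>P s\<close> at \<open>x\<close> is written as integration against \<open>P s \<kappa>\<close>, where \<open>\<kappa>\<close> is the
  density of the point mass at \<open>x\<close>.\<close>
lemma gradient_smoothing:
  assumes f: "\<And>y. y \<in> cube n \<Longrightarrow> (f y)\<^sup>2 \<le> 1" and t: "0 \<le> t" "t \<le> 1" and x: "x \<in> cube n"
  shows "smooth_const * t * Gam (P t f) x \<le> 1"
proof -
  define W where "W = (\<Sum>y\<in>cube n. w y)"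
  have W: "0 < W" unfolding W_def by (rule total_weight_pos)
  define \<kappa> where "\<kappa> y = (if y = x then W / w x else 0)" for y
  have \<kappa>: "0 \<le> \<kappa> y" if "y \<in> cube n" for y using W w_pos[OF that] by (auto simp: \<kappa>_def)
  have mean\<kappa>: "mean (\<lambda>y. \<kappa> y * g y) = g x" for g
  proof -
    have "(\<Sum>y\<in>cube n. w y * (\<kappa> y * g y)) = (\<Sum>y\<in>cube n. if y = x then W * g x else 0)"
      using w_pos[OF x] by (intro sum.cong) (auto simp: \<kappa>_def)
    then show ?thesis using x W finite_cube by (simp add: mean_def W_def[symmetric])
  qed
  define k where "k s = P s \<kappa>" for s
  have k0: "0 \<le> k s y" if "0 \<le> s" "y \<in> cube n" for s y unfolding k_def by (intro P_nonneg \<kappa> that)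
  define g where "g s = P (t - s) f" for s
  have dg: "((\<lambda>s. g s y) has_real_derivative - L (g s) y) (at s)" if "y \<in> cube n" for s y
  proof -
    have "((\<lambda>s. t - s) has_real_derivative - 1) (at s)" by (auto intro!: derivative_eq_intros)
    from P_deriv_chain[OF that this, of f] show ?thesis by (simp add: g_def)
  qed
  have dDg: "((\<lambda>s. D i (g s) y) has_real_derivative - D i (L (g s)) y) (at s)" if "y \<in> cube n" "i \<in> V" for s y i
  proof -
    have "((\<lambda>s. D i (g s) y) has_real_derivative (- L (g s) (y(i := 1)) - - L (g s) (y(i := -1)))) (at s)"
      unfolding disc_deriv_def by (intro DERIV_diff dg cube_upd that) auto
    then show ?thesis by (simp add: disc_deriv_def)
  qed
  define H where "H s = mean (\<lambda>y. k s y * Gam (g s) y)" for s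
  define h where "h s = mean (\<lambda>y. k s y * (g s y)\<^sup>2)" for s
  have dH: "(H has_real_derivative mean (\<lambda>y. k s y * Gam2 (g s) y)) (at s)" for s
  proof -
    have "((\<lambda>s. k s y * Gam (g s) y) has_real_derivative
       (k s y * (\<Sum>i\<in>V. 2 * (D i (g s) y * - D i (L (g s)) y)) + L (k s) y * Gam (g s) y)) (at s)" if y: "y \<in> cube n" for y
    proof -
      have "((\<lambda>s. (D i (g s) y)\<^sup>2) has_real_derivative 2 * (D i (g s) y * - D i (L (g s)) y)) (at s)" if i: "i \<in> V" for i
        using DERIV_mult'[OF dDg[OF y i, of s] dDg[OF y i, of s]] by (simp add: power2_eq_square algebra_simps)
      then have "((\<lambda>s. Gam (g s) y) has_real_derivative (\<Sum>i\<in>V. 2 * (D i (g s) y * - D i (L (g s)) y))) (at s)"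
        unfolding Gam_def by (rule DERIV_sum)
      from DERIV_mult'[OF P_deriv[OF y, of \<kappa> s] this] show ?thesis by (simp add: k_def)
    qed
    then have "(H has_real_derivative mean (\<lambda>y. k s y * (\<Sum>i\<in>V. 2 * (D i (g s) y * - D i (L (g s)) y)) + L (k s) y * Gam (g s) y)) (at s)"
      unfolding H_def by (rule mean_deriv)
    also have "mean (\<lambda>y. k s y * (\<Sum>i\<in>V. 2 * (D i (g s) y * - D i (L (g s)) y)) + L (k s) y * Gam (g s) y)
       = mean (\<lambda>y. Gam (g s) y * L (k s) y) - mean (\<lambda>y. k s y * (2 * (\<Sum>i\<in>V. D i (g s) y * D i (L (g s)) y)))"
      by (simp add: mean_diff[symmetric] sum_negf sum_distrib_left algebra_simps)
    also have "\<dots> = mean (\<lambda>y. k s y * Gam2 (g s) y)"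
      by (subst mean_L_symmetric) (simp add: Gam2_def mean_diff[symmetric] algebra_simps)
    finally show ?thesis .
  qed
  have dh: "(h has_real_derivative mean (\<lambda>y. k s y * cdc (g s) y)) (at s)" for s
  proof -
    have "((\<lambda>s. k s y * (g s y)\<^sup>2) has_real_derivative
       (k s y * (2 * (g s y * - L (g s) y)) + L (k s) y * (g s y)\<^sup>2)) (at s)" if y: "y \<in> cube n" for y
    proof -
      have "((\<lambda>s. (g s y)\<^sup>2) has_real_derivative 2 * (g s y * - L (g s) y)) (at s)"
        using DERIV_mult'[OF dg[OF y, of s] dg[OF y, of s]] by (simp add: power2_eq_square algebra_simps)
      from DERIV_mult'[OF P_deriv[OF y, of \<kappa> s] this] show ?thesis by (simp add: k_def)
    qed
    then have "(h has_real_derivative mean (\<lambda>y. k s y * (2 * (g s y * - L (g s) y)) + L (k s) y * (g s y)\<^sup>2)) (at s)"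
      unfolding h_def by (rule mean_deriv)
    also have "mean (\<lambda>y. k s y * (2 * (g s y * - L (g s) y)) + L (k s) y * (g s y)\<^sup>2)
       = mean (\<lambda>y. (g s y)\<^sup>2 * L (k s) y) - mean (\<lambda>y. k s y * (2 * g s y * L (g s) y))"
      by (simp add: mean_diff[symmetric] algebra_simps)
    also have "\<dots> = mean (\<lambda>y. k s y * cdc (g s) y)"
      by (subst mean_L_symmetric) (simp add: cdc_def mean_diff[symmetric] algebra_simps)
    finally show ?thesis .
  qed
  have H_mono: "exp (- 1 / \<alpha>) * H 0 \<le> H s" if s: "0 \<le> s" "s \<le> t" for s
  proof -
    have "exp (0 / \<alpha>) * H 0 \<le> exp (s / \<alpha>) * H s"
    proof (rule DERIV_nonneg_imp_nondecreasing[OF s(1)])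
      fix r assume r: "0 \<le> r" "r \<le> s"
      have "mean (\<lambda>y. (- 1 / \<alpha>) * (k r y * Gam (g r) y))
        \<le> mean (\<lambda>y. k r y * Gam2 (g r) y)"
      proof (rule mean_mono)
        fix y assume y: "y \<in> cube n"
        show "(- 1 / \<alpha>) * (k r y * Gam (g r) y) \<le> k r y * Gam2 (g r) y"
          using mult_left_mono[OF bochner[OF y, of "g r"] k0[OF r(1) y]] by (simp add: algebra_simps)
      qed
      then have ge: "(- 1 / \<alpha>) * H r \<le> mean (\<lambda>y. k r y * Gam2 (g r) y)" (is "_ \<le> ?H'")
        unfolding mean_cmult H_def .
      have "((\<lambda>s. exp (s / \<alpha>) * H s) has_real_derivative (exp (r / \<alpha>) * ?H' + exp (r / \<alpha>) * (1 / \<alpha>) * H r)) (at r)"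
        by (intro DERIV_mult' dH) (use \<alpha>_pos in \<open>auto intro!: derivative_eq_intros\<close>)
      moreover have "0 \<le> exp (r / \<alpha>) * ?H' + exp (r / \<alpha>) * (1 / \<alpha>) * H r"
      proof -
        have "0 \<le> exp (r / \<alpha>) * (?H' - (- 1 / \<alpha>) * H r)" using ge by simp
        then show ?thesis by (simp add: algebra_simps)
      qed
      ultimately show "\<exists>d. ((\<lambda>s. exp (s / \<alpha>) * H s) has_real_derivative d) (at r) \<and> 0 \<le> d" by blast
    qed
    moreover have "0 \<le> H s" unfolding H_def Gam_def
      using k0 s by (intro mean_nonneg mult_nonneg_nonneg sum_nonneg) auto
    moreover have "exp (s / \<alpha>) \<le> exp (1 / \<alpha>)" using s t \<alpha>_pos by (simp add: divide_right_mono)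
    ultimately have "H 0 \<le> exp (1 / \<alpha>) * H s" using mult_right_mono by fastforce
    then have "exp (- 1 / \<alpha>) * H 0 \<le> exp (- 1 / \<alpha>) * (exp (1 / \<alpha>) * H s)" by simp
    also have "\<dots> = H s" using \<alpha>_pos by (simp add: mult.assoc[symmetric] exp_add[symmetric])
    finally show ?thesis .
  qed
  have "h 0 - smooth_const * H 0 * 0 \<le> h t - smooth_const * H 0 * t"
  proof (rule DERIV_nonneg_imp_nondecreasing[OF t(1)])
    fix s assume s: "0 \<le> s" "s \<le> t"
    have "smooth_const * H 0 \<le> \<alpha> * H s"
      using H_mono[OF s] \<alpha>_pos by (simp add: smooth_const_def)
    also have "\<dots> = mean (\<lambda>y. \<alpha> * (k s y * Gam (g s) y))" unfolding mean_cmult H_def ..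
    also have "\<dots> \<le> mean (\<lambda>y. k s y * cdc (g s) y)" (is "_ \<le> ?h'")
    proof (rule mean_mono)
      fix y assume y: "y \<in> cube n"
      show "\<alpha> * (k s y * Gam (g s) y) \<le> k s y * cdc (g s) y"
        using mult_left_mono[OF carre_du_champ_ge[OF y, of "g s"] k0[OF s(1) y]] by (simp add: algebra_simps)
    qed
    finally have "0 \<le> ?h' - smooth_const * H 0" by simp
    moreover have "((\<lambda>s. h s - smooth_const * H 0 * s) has_real_derivative (?h' - smooth_const * H 0)) (at s)"
      by (auto intro!: derivative_eq_intros dh)
    ultimately show "\<exists>d. ((\<lambda>s. h s - smooth_const * H 0 * s) has_real_derivative d) (at s) \<and> 0 \<le> d" by blast
  qed
  moreover have "0 \<le> h 0" unfolding h_def using k0 by (intro mean_nonneg mult_nonneg_nonneg) auto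
  moreover have "h t \<le> 1"
  proof -
    have "h t \<le> mean (\<lambda>y. k t y)" unfolding h_def
    proof (rule mean_mono)
      fix y assume y: "y \<in> cube n"
      show "k t y * (g t y)\<^sup>2 \<le> k t y"
        using mult_left_mono[OF f[OF y] k0[OF t(1) y]] by (simp add: g_def)
    qed
    also have "mean (\<lambda>y. k t y) = mean \<kappa>" unfolding k_def by (rule mean_P)
    also have "mean \<kappa> = 1" using mean\<kappa>[of "\<lambda>_. 1"] by simp
    finally show ?thesis .
  qed
  moreover have "H 0 = Gam (P t f) x"
    unfolding H_def using mean\<kappa>[of "Gam (g 0)"] by (simp add: k_def g_def)
  ultimately show ?thesis by (simp add: mult_ac)
qed

lemma Gam_nonneg: "0 \<le> Gam f x"
  unfolding Gam_def by (intro sum_nonneg) auto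

text \<open>Integrate \<open>dirichlet f (P s f)\<close> over time: by smoothing the gradient of \<open>P s f\<close> is of order
  \<open>1 / sqrt s\<close>, uniformly in the configuration, so only the L1-norm of the gradient of \<open>f\<close> is needed.\<close>
lemma correlation_decay_le_gradient:
  assumes f: "\<And>y. y \<in> cube n \<Longrightarrow> (f y)\<^sup>2 \<le> 1" and t: "0 \<le> t" "t \<le> 1"
  shows "mean (\<lambda>x. (f x)\<^sup>2) - mean (\<lambda>x. f x * P t f x)
    \<le> sqrt t * mean (\<lambda>x. sqrt (Gam f x)) / (2 * sqrt smooth_const)"
proof -
  define E where "E = mean (\<lambda>x. sqrt (Gam f x))"
  define c where "c t = mean (\<lambda>x. f x * P t f x)" for t
  define \<phi> where "\<phi> t = c t + sqrt t * (E / (2 * sqrt smooth_const))" for t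
  note q = smooth_const_pos
  have dc: "(c has_real_derivative - dirichlet f (P s f)) (at s)" for s
  proof -
    have "(c has_real_derivative mean (\<lambda>x. f x * L (P s f) x)) (at s)"
      unfolding c_def by (intro mean_deriv DERIV_cmult P_deriv)
    then show ?thesis by (simp add: mean_mult_L)
  qed
  have "\<phi> 0 \<le> \<phi> t"
  proof (rule DERIV_nonneg_imp_increasing_open[OF t(1)])
    fix s assume s: "0 < s" "s < t"
    have "dirichlet f (P s f)
      = mean (\<lambda>x. \<Sum>i\<in>V. p i x * (1 - p i x) * D i f x * D i (P s f) x)" by (simp add: dirichlet_def mean_sum)
    also have "\<dots> \<le> mean (\<lambda>x. 1 / (4 * sqrt (smooth_const * s)) * sqrt (Gam f x))"
    proof (rule mean_mono)
      fix x assume x: "x \<in> cube n"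
      have "(\<Sum>i\<in>V. p i x * (1 - p i x) * D i f x * D i (P s f) x) \<le> (\<Sum>i\<in>V. (1 / 4) * (\<bar>D i f x\<bar> * \<bar>D i (P s f) x\<bar>))"
      proof (rule sum_mono)
        fix i assume i: "i \<in> V"
        have b: "0 \<le> p i x * (1 - p i x)" "p i x * (1 - p i x) \<le> 1 / 4"
          using heat_bath_var_bounds[OF x i] \<alpha>_pos by auto
        have "p i x * (1 - p i x) * D i f x * D i (P s f) x = (p i x * (1 - p i x)) * (D i f x * D i (P s f) x)"
          by simp
        also have "\<dots> \<le> (p i x * (1 - p i x)) * \<bar>D i f x * D i (P s f) x\<bar>"
          using b by (intro mult_left_mono) auto
        also have "\<dots> \<le> (1 / 4) * \<bar>D i f x * D i (P s f) x\<bar>"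
          using b by (intro mult_right_mono) auto
        finally show "p i x * (1 - p i x) * D i f x * D i (P s f) x \<le> (1 / 4) * (\<bar>D i f x\<bar> * \<bar>D i (P s f) x\<bar>)"
          by (simp only: abs_mult)
      qed
      also have "\<dots> = (1 / 4) * (\<Sum>i\<in>V. \<bar>D i f x\<bar> * \<bar>D i (P s f) x\<bar>)" by (simp add: sum_distrib_left)
      also have "\<dots> \<le> (1 / 4) * (sqrt (Gam f x) * sqrt (Gam (P s f) x))"
        using L2_set_mult_ineq[of "\<lambda>i. D i f x" "\<lambda>i. D i (P s f) x" V]
        by (intro mult_left_mono) (auto simp: L2_set_def Gam_def)
      also have "\<dots> \<le> (1 / 4) * (sqrt (Gam f x) * (1 / sqrt (smooth_const * s)))"
      proof -
        have "smooth_const * s * Gam (P s f) x \<le> 1"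
          using s t by (intro gradient_smoothing f x) auto
        then have "sqrt (smooth_const * s * Gam (P s f) x) \<le> sqrt 1" by (rule real_sqrt_le_mono)
        then have "sqrt (Gam (P s f) x) \<le> 1 / sqrt (smooth_const * s)"
          using q s by (simp add: real_sqrt_mult field_simps)
        then show ?thesis by (intro mult_left_mono) (auto simp: Gam_nonneg)
      qed
      finally show "(\<Sum>i\<in>V. p i x * (1 - p i x) * D i f x * D i (P s f) x)
        \<le> 1 / (4 * sqrt (smooth_const * s)) * sqrt (Gam f x)" by (simp add: mult_ac)
    qed
    also have "\<dots> = 1 / (4 * sqrt (smooth_const * s)) * E" unfolding mean_cmult E_def ..
    finally have le: "dirichlet f (P s f) \<le> 1 / (4 * sqrt (smooth_const * s)) * E" .
    have "(\<phi> has_real_derivative (- dirichlet f (P s f)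
       + (inverse (sqrt s) / 2) * (E / (2 * sqrt smooth_const)))) (at s)"
      unfolding \<phi>_def by (rule DERIV_add[OF dc DERIV_cmult_right[OF DERIV_real_sqrt[OF s(1)]]])
    moreover have "(inverse (sqrt s) / 2) * (E / (2 * sqrt smooth_const)) = 1 / (4 * sqrt (smooth_const * s)) * E"
      using q s by (simp add: real_sqrt_mult field_simps)
    ultimately have "DERIV \<phi> s :> (- dirichlet f (P s f) + 1 / (4 * sqrt (smooth_const * s)) * E)"
      by (simp only:)
    moreover have "0 \<le> - dirichlet f (P s f) + 1 / (4 * sqrt (smooth_const * s)) * E"
      using le by simp
    ultimately show "\<exists>y. DERIV \<phi> s :> y \<and> 0 \<le> y" by blast
  next
    have "continuous_on {0..t} c"
      using dc by (intro DERIV_continuous_on[of _ _ "\<lambda>s. - dirichlet f (P s f)"])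
        (auto intro: has_field_derivative_at_within)
    then show "continuous_on {0..t} \<phi>"
      unfolding \<phi>_def by (intro continuous_intros)
  qed
  then show ?thesis
    by (simp add: \<phi>_def c_def E_def power2_eq_square)
qed

section \<open>Variance and gradients along the semigroup\<close>
definition var :: "((nat \<Rightarrow> real) \<Rightarrow> real) \<Rightarrow> real" where
  "var f = mean (\<lambda>x. (f x)\<^sup>2) - (mean f)\<^sup>2"

lemma var_eq: "var f = mean (\<lambda>x. (f x - mean f)\<^sup>2)"
proof -
  have "mean (\<lambda>x. (f x - mean f)\<^sup>2) = mean (\<lambda>x. (f x)\<^sup>2 - 2 * mean f * f x + (mean f)\<^sup>2)"
    by (rule mean_cong) (simp add: power2_eq_square algebra_simps)
  also have "\<dots> = mean (\<lambda>x. (f x)\<^sup>2) - 2 * mean f * mean f + (mean f)\<^sup>2"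
    unfolding mean_add mean_diff mean_cmult mean_const ..
  finally show ?thesis by (simp add: var_def power2_eq_square)
qed

lemma var_nonneg: "0 \<le> var f"
  unfolding var_eq by (intro mean_nonneg) auto

lemma var_le_energy: "var f \<le> loc_const * mean (Gam f)"
  using poincare[of f] by (simp add: var_def Gam_def[abs_def] mean_sum)

lemma mean_square_mult_le: "(mean (\<lambda>x. f x * g x))\<^sup>2 \<le> mean (\<lambda>x. (f x)\<^sup>2) * mean (\<lambda>x. (g x)\<^sup>2)"
proof -
  define W where "W = (\<Sum>y\<in>cube n. w y)"
  have W: "0 < W" unfolding W_def by (rule total_weight_pos)
  have sq: "(\<Sum>x\<in>cube n. (sqrt (w x) * h x)\<^sup>2) = (\<Sum>x\<in>cube n. w x * (h x)\<^sup>2)" for h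
    by (intro sum.cong refl) (simp add: power_mult_distrib w_pos less_imp_le)
  have "(\<Sum>x\<in>cube n. (sqrt (w x) * f x) * (sqrt (w x) * g x))\<^sup>2
    \<le> (\<Sum>x\<in>cube n. (sqrt (w x) * f x)\<^sup>2) * (\<Sum>x\<in>cube n. (sqrt (w x) * g x)\<^sup>2)"
    by (rule Cauchy_Schwarz_ineq_sum)
  also have "(\<Sum>x\<in>cube n. (sqrt (w x) * f x) * (sqrt (w x) * g x)) = (\<Sum>x\<in>cube n. w x * (f x * g x))"
  proof (intro sum.cong refl)
    fix x assume "x \<in> cube n"
    then have "sqrt (w x) * sqrt (w x) = w x" using w_pos by (simp add: less_imp_le)
    then show "(sqrt (w x) * f x) * (sqrt (w x) * g x) = w x * (f x * g x)"
      by (metis mult.assoc mult.left_commute)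
  qed
  finally have "(\<Sum>x\<in>cube n. w x * (f x * g x))\<^sup>2 / W\<^sup>2
    \<le> (\<Sum>x\<in>cube n. w x * (f x)\<^sup>2) * (\<Sum>x\<in>cube n. w x * (g x)\<^sup>2) / W\<^sup>2"
    unfolding sq by (intro divide_right_mono) auto
  then show ?thesis by (simp add: mean_def W_def[symmetric] power_divide power2_eq_square)
qed

lemma var_P_deriv:
  "((\<lambda>t. var (P t f)) has_real_derivative 2 * mean (\<lambda>x. P t f x * L (P t f) x)) (at t)"
proof -
  have "((\<lambda>t. mean (\<lambda>x. (P t f x)\<^sup>2)) has_real_derivative mean (\<lambda>x. 2 * (P t f x * L (P t f) x))) (at t)"
  proof (rule mean_deriv)
    fix x assume x: "x \<in> cube n"
    from DERIV_mult'[OF P_deriv[OF x, of f t] P_deriv[OF x, of f t]]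
    show "((\<lambda>t. (P t f x)\<^sup>2) has_real_derivative 2 * (P t f x * L (P t f) x)) (at t)"
      by (simp add: power2_eq_square algebra_simps)
  qed
  from DERIV_diff[OF this DERIV_const[of "(mean f)\<^sup>2"]] show ?thesis
    unfolding mean_cmult by (simp add: var_def mean_P)
qed

lemma dissipation_bounds:
  "2 * mean (\<lambda>x. f x * L f x) \<le> - \<alpha> * mean (Gam f)"
  "- mean (Gam f) / 2 \<le> 2 * mean (\<lambda>x. f x * L f x)"
proof -
  have G: "mean (Gam f) = (\<Sum>i\<in>V. mean (\<lambda>x. (D i f x)\<^sup>2))" by (simp add: Gam_def[abs_def] mean_sum)
  have "(\<Sum>i\<in>V. (\<alpha> / 2) * mean (\<lambda>x. (D i f x)\<^sup>2)) \<le> dirichlet f f"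
    unfolding dirichlet_def mean_cmult[symmetric]
  proof (intro sum_mono mean_mono)
    fix i x assume "i \<in> V" "x \<in> cube n"
    from mult_right_mono[OF heat_bath_var_bounds(1)[OF this(2,1)], of "(D i f x)\<^sup>2"]
    show "\<alpha> / 2 * (D i f x)\<^sup>2 \<le> p i x * (1 - p i x) * D i f x * D i f x"
      by (simp add: power2_eq_square mult.assoc)
  qed
  then have "(\<alpha> / 2) * mean (Gam f) \<le> dirichlet f f"
    by (simp only: G sum_distrib_left)
  then show "2 * mean (\<lambda>x. f x * L f x) \<le> - \<alpha> * mean (Gam f)"
    by (simp add: mean_mult_L)
  have "dirichlet f f \<le> (\<Sum>i\<in>V. (1 / 4) * mean (\<lambda>x. (D i f x)\<^sup>2))"
    unfolding dirichlet_def mean_cmult[symmetric]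
  proof (intro sum_mono mean_mono)
    fix i x assume "i \<in> V" "x \<in> cube n"
    from mult_right_mono[OF heat_bath_var_bounds(2)[OF this(2,1)], of "(D i f x)\<^sup>2"]
    show "p i x * (1 - p i x) * D i f x * D i f x \<le> 1 / 4 * (D i f x)\<^sup>2"
      by (simp add: power2_eq_square mult.assoc)
  qed
  then have "dirichlet f f \<le> (1 / 4) * mean (Gam f)"
    by (simp only: G sum_distrib_left)
  then show "- mean (Gam f) / 2 \<le> 2 * mean (\<lambda>x. f x * L f x)"
    by (simp add: mean_mult_L)
qed

lemma var_P_decay:
  assumes "0 \<le> t"
  shows "var (P t f) \<le> exp (- (\<alpha> / loc_const) * t) * var f"
proof -
  note lc = loc_const_pos
  have v0: "var (P 0 f) = var f" by (simp add: var_def mean_P)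
  have "var (P t f) \<le> exp (0 * (t - 0)) * (exp (- (\<alpha> / loc_const) * (t - 0)) * var (P 0 f) + 0 * (t - 0))"
  proof (rule gronwall_linear[OF assms _ _ _ var_P_deriv])
    fix u assume "0 \<le> u" "u \<le> t"
    have "2 * mean (\<lambda>x. P u f x * L (P u f) x) \<le> - \<alpha> * mean (Gam (P u f))" by (rule dissipation_bounds)
    also have "\<dots> \<le> - \<alpha> * (var (P u f) / loc_const)"
      using var_le_energy[of "P u f"] lc \<alpha>_pos by (simp add: pos_divide_le_eq mult.commute)
    finally show "2 * mean (\<lambda>x. P u f x * L (P u f) x) \<le> - (\<alpha> / loc_const) * var (P u f) + 0 * var (P u f) + 0" by simp
  qed (use \<alpha>_pos lc in auto)
  then show ?thesis by (simp add: v0)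
qed

text \<open>The second derivative of the variance is \<open>4 * E (L (P t f))\<^sup>2\<close>, so log-convexity is the
  Cauchy-Schwarz inequality. The summand \<open>\<epsilon>\<close> keeps the logarithm finite.\<close>
lemma var_P_log_convex:
  assumes t: "0 \<le> t" "t \<le> 1" and e: "0 < \<epsilon>"
  shows "var (P t f) + \<epsilon> \<le> (var f + \<epsilon>) powr (1 - t) * (var (P 1 f) + \<epsilon>) powr t"
proof -
  define v where "v t = var (P t f) + \<epsilon>" for t
  define v' where "v' t = 2 * mean (\<lambda>x. P t f x * L (P t f) x)" for t
  define v'' where "v'' t = 4 * mean (\<lambda>x. (L (P t f) x)\<^sup>2)" for t
  have v: "0 < v t" for t using var_nonneg[of "P t f"] e by (simp add: v_def)
  have d1: "(v has_real_derivative v' t) (at t)" for t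
    using DERIV_add[OF var_P_deriv[of f t] DERIV_const[of \<epsilon>]] unfolding v_def v'_def by simp
  have d2: "(v' has_real_derivative v'' t) (at t)" for t
  proof -
    have "((\<lambda>t. mean (\<lambda>x. P t f x * L (P t f) x)) has_real_derivative
       mean (\<lambda>x. P t f x * L (L (P t f)) x + L (P t f) x * L (P t f) x)) (at t)"
      by (intro mean_deriv DERIV_mult' P_deriv L_P_deriv)
    moreover have "mean (\<lambda>x. P t f x * L (L (P t f)) x + L (P t f) x * L (P t f) x) = 2 * mean (\<lambda>x. (L (P t f) x)\<^sup>2)"
      unfolding mean_add by (subst mean_L_symmetric) (simp add: power2_eq_square)
    ultimately have "((\<lambda>t. mean (\<lambda>x. P t f x * L (P t f) x)) has_real_derivative 2 * mean (\<lambda>x. (L (P t f) x)\<^sup>2)) (at t)"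
      by simp
    from DERIV_cmult[OF this, of 2] show ?thesis unfolding v'_def v''_def by simp
  qed
  have cs: "(v' t)\<^sup>2 \<le> v t * v'' t" for t
  proof -
    have "mean (\<lambda>x. P t f x * L (P t f) x) = mean (\<lambda>x. (P t f x - mean (P t f)) * L (P t f) x)"
      by (simp add: left_diff_distrib mean_diff mean_cmult mean_L)
    then have "(mean (\<lambda>x. P t f x * L (P t f) x))\<^sup>2 \<le> var (P t f) * mean (\<lambda>x. (L (P t f) x)\<^sup>2)"
      unfolding var_eq using mean_square_mult_le by metis
    also have "\<dots> \<le> v t * mean (\<lambda>x. (L (P t f) x)\<^sup>2)"
      using e by (intro mult_right_mono mean_nonneg) (auto simp: v_def)
    finally show ?thesis by (simp add: v'_def v''_def power_mult_distrib)
  qed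
  have "convex_on {0..1} (\<lambda>t. ln (v t))"
  proof (rule f''_ge0_imp_convex)
    fix s
    show "((\<lambda>t. ln (v t)) has_real_derivative v' s / v s) (at s)"
      using v[of s] by (auto intro!: derivative_eq_intros d1 simp: field_simps)
    show "((\<lambda>t. v' t / v t) has_real_derivative (v'' s * v s - v' s * v' s) / (v s * v s)) (at s)"
      using v[of s] by (intro DERIV_divide d1 d2) auto
    show "0 \<le> (v'' s * v s - v' s * v' s) / (v s * v s)"
      using cs[of s] v[of s] by (simp add: power2_eq_square mult.commute)
  qed auto
  from convex_onD[OF this, of t 0 1] t
  have "ln (v t) \<le> (1 - t) * ln (v 0) + t * ln (v 1)" by simp
  then have "exp (ln (v t)) \<le> exp ((1 - t) * ln (v 0) + t * ln (v 1))" by simp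
  then have "v t \<le> v 0 powr (1 - t) * v 1 powr t"
    using v[of t] v[of 0] v[of 1] by (simp add: powr_def exp_add)
  moreover have "var (P 0 f) = var f" by (simp add: var_def mean_P)
  ultimately show ?thesis by (simp add: v_def)
qed

lemma mean_abs_K_le: "mean (\<lambda>x. \<bar>K f x\<bar>) \<le> mean (\<lambda>x. \<bar>f x\<bar>)"
proof -
  have "mean (\<lambda>x. \<bar>K f x\<bar>) \<le> mean (\<lambda>x. (1 / real n) * (\<Sum>j\<in>V. Ei j (\<lambda>y. \<bar>f y\<bar>) x))"
  proof (rule mean_mono)
    fix x assume x: "x \<in> cube n"
    have "\<bar>\<Sum>j\<in>V. Ei j f x\<bar> \<le> (\<Sum>j\<in>V. Ei j (\<lambda>y. \<bar>f y\<bar>) x)"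
      by (intro order.trans[OF sum_abs] sum_mono Ei_abs x)
    then show "\<bar>K f x\<bar> \<le> (1 / real n) * (\<Sum>j\<in>V. Ei j (\<lambda>y. \<bar>f y\<bar>) x)"
      by (simp add: glauber_def divide_right_mono)
  qed
  also have "\<dots> = mean (\<lambda>x. \<bar>f x\<bar>)"
    unfolding mean_cmult mean_sum using n_pos by (simp add: mean_Ei)
  finally show ?thesis .
qed

lemma K_minus_const: "K f x - c = K (\<lambda>y. f y - c) x"
proof -
  have "Ei j (\<lambda>y. f y - c) x = Ei j f x - c" for j by (simp add: Ei_def algebra_simps)
  then show ?thesis using n_pos by (simp add: glauber_def sum_subtractf diff_divide_distrib)
qed

lemma mean_abs_P_minus_const_le:
  assumes t: "0 \<le> t"
  shows "mean (\<lambda>x. \<bar>P t f x - c\<bar>) \<le> mean (\<lambda>x. \<bar>f x - c\<bar>)"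
proof -
  define s where "s = real n * t"
  have s: "0 \<le> s" using t by (simp add: s_def)
  obtain B where B: "\<And>k y. y \<in> cube n \<Longrightarrow> \<bar>(K ^^ k) f y\<bar> \<le> B" using K_iter_bounded[of f] by blast
  have form: "P t f x - c = exp (- s) * (\<Sum>k. s ^ k / fact k * ((K ^^ k) f x - c))" if x: "x \<in> cube n" for x
  proof -
    have e: "(\<lambda>k. s ^ k / fact k * c) sums (exp s * c)"
      using sums_mult2[OF exp_converges[of s], of c] by (simp add: divide_inverse mult_ac)
    have "(\<Sum>k. s ^ k / fact k * ((K ^^ k) f x - c)) = (\<Sum>k. s ^ k / fact k * (K ^^ k) f x) - exp s * c"
      unfolding right_diff_distrib using suminf_diff[OF K_iter_summable[OF x, of s f] sums_summable[OF e]] sums_unique[OF e] by simp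
    then show ?thesis by (simp add: P_def s_def[symmetric] right_diff_distrib mult.assoc[symmetric] exp_add[symmetric])
  qed
  have "mean (\<lambda>x. \<bar>P t f x - c\<bar>) = mean (\<lambda>x. \<bar>exp (- s) * (\<Sum>k. s ^ k / fact k * ((K ^^ k) f x - c))\<bar>)"
    by (rule mean_cong) (simp add: form)
  also have "\<dots> \<le> mean (\<lambda>x. \<bar>f x - c\<bar>) * exp (s * (1 - 1))"
  proof (rule mean_poisson_average_le[OF _ _ s])
    show "\<bar>(K ^^ k) f x - c\<bar> \<le> B + \<bar>c\<bar>" if "x \<in> cube n" for k x
      using B[OF that, of k] by linarith
    show "mean (\<lambda>x. \<bar>(K ^^ k) f x - c\<bar>) \<le> mean (\<lambda>x. \<bar>f x - c\<bar>) * 1 ^ k" for k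
    proof (induction k)
      case (Suc k)
      have "mean (\<lambda>x. \<bar>(K ^^ Suc k) f x - c\<bar>) = mean (\<lambda>x. \<bar>K (\<lambda>y. (K ^^ k) f y - c) x\<bar>)"
        by (simp add: K_minus_const)
      also have "\<dots> \<le> mean (\<lambda>x. \<bar>(K ^^ k) f x - c\<bar>)" by (rule mean_abs_K_le)
      finally show ?case using Suc by simp
    qed simp
  qed
  finally show ?thesis by simp
qed

lemma mean_abs_D_K_le:
  assumes i: "i \<in> V"
  shows "mean (\<lambda>x. \<bar>D i (K f) x\<bar>) \<le> mean (\<lambda>x. \<bar>D i f x\<bar>) + (\<Sum>j\<in>V. d i j * mean (\<lambda>x. \<bar>D j f x\<bar>)) / (real n * \<alpha>)"
proof -
  define M where "M j = mean (\<lambda>x. \<bar>D j f x\<bar>)" for j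
  have M: "0 \<le> M j" for j unfolding M_def by (intro mean_nonneg) auto
  have one: "mean (\<lambda>x. \<bar>D i (Ei j f) x\<bar>) \<le> M i + d i j * M j / \<alpha>" if j: "j \<in> V" for j
  proof (cases "j = i")
    case True
    then show ?thesis using M[of i] d_nonneg[OF i i] \<alpha>_pos by simp
  next
    case False
    have "mean (\<lambda>x. \<bar>D i (Ei j f) x\<bar>) \<le> mean (\<lambda>x. Ei j (\<lambda>y. \<bar>D i f y\<bar>) x + d i j * \<bar>D j f (flip i x)\<bar>)"
      using False i j by (intro mean_mono D_Ei_bound) auto
    also have "\<dots> = M i + d i j * mean (\<lambda>x. \<bar>D j f (flip i x)\<bar>)"
      unfolding mean_add mean_cmult mean_Ei[OF j] M_def ..
    also have "\<dots> \<le> M i + d i j * (M j / \<alpha>)"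
      unfolding M_def using d_nonneg[OF i j] by (intro add_left_mono mult_left_mono mean_flip_le[OF i]) auto
    finally show ?thesis by simp
  qed
  have "mean (\<lambda>x. \<bar>D i (K f) x\<bar>) \<le> mean (\<lambda>x. (1 / real n) * (\<Sum>j\<in>V. \<bar>D i (Ei j f) x\<bar>))"
  proof (rule mean_mono)
    fix x
    have "D i (K f) x = (1 / real n) * (\<Sum>j\<in>V. D i (Ei j f) x)"
      by (simp add: glauber_def disc_deriv_def sum_subtractf diff_divide_distrib)
    then show "\<bar>D i (K f) x\<bar> \<le> (1 / real n) * (\<Sum>j\<in>V. \<bar>D i (Ei j f) x\<bar>)"
      by (simp add: abs_mult divide_right_mono sum_abs)
  qed
  also have "\<dots> = (1 / real n) * (\<Sum>j\<in>V. mean (\<lambda>x. \<bar>D i (Ei j f) x\<bar>))" unfolding mean_cmult mean_sum ..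
  also have "\<dots> \<le> (1 / real n) * (\<Sum>j\<in>V. M i + d i j * M j / \<alpha>)"
    by (intro mult_left_mono sum_mono one) auto
  also have "\<dots> = M i + (\<Sum>j\<in>V. d i j * M j) / (real n * \<alpha>)"
    using n_pos by (simp add: sum.distrib sum_divide_distrib[symmetric] field_simps)
  finally show ?thesis by (simp add: M_def)
qed

text \<open>The L1-norms of the derivatives form a vector that one step of \<open>K\<close> multiplies by at most
  \<open>1 + d / (n * \<alpha>)\<close>; a majorant that is stable under \<open>d\<close> therefore grows by the factor
  \<open>1 + 1 / (n * \<alpha>)\<close> per step.\<close>
lemma mean_abs_D_P_le:
  assumes t: "0 \<le> t" and i: "i \<in> V"
    and M: "\<And>i. i \<in> V \<Longrightarrow> mean (\<lambda>x. \<bar>D i f x\<bar>) \<le> A i"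
    and A: "\<And>i. i \<in> V \<Longrightarrow> (\<Sum>j\<in>V. d i j * A j) \<le> A i"
  shows "mean (\<lambda>x. \<bar>D i (P t f) x\<bar>) \<le> A i * exp (t / \<alpha>)"
proof -
  define s where "s = real n * t"
  define \<gamma> where "\<gamma> = 1 + 1 / (real n * \<alpha>)"
  have \<gamma>: "0 \<le> \<gamma>" using \<alpha>_pos by (simp add: \<gamma>_def)
  have s: "0 \<le> s" using t by (simp add: s_def)
  obtain B where B: "\<And>k y. y \<in> cube n \<Longrightarrow> \<bar>(K ^^ k) f y\<bar> \<le> B" using K_iter_bounded[of f] by blast
  have iter: "mean (\<lambda>x. \<bar>D i ((K ^^ k) f) x\<bar>) \<le> A i * \<gamma> ^ k" if "i \<in> V" for k i
    using that
  proof (induction k arbitrary: i)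
    case (Suc k)
    have "mean (\<lambda>x. \<bar>D i (K ((K ^^ k) f)) x\<bar>) \<le> A i * \<gamma> ^ k + (\<Sum>j\<in>V. d i j * (A j * \<gamma> ^ k)) / (real n * \<alpha>)"
      using Suc \<alpha>_pos d_nonneg
      by (intro order.trans[OF mean_abs_D_K_le] add_mono divide_right_mono sum_mono mult_left_mono) auto
    also have "(\<Sum>j\<in>V. d i j * (A j * \<gamma> ^ k)) \<le> A i * \<gamma> ^ k"
      using mult_right_mono[OF A[OF Suc.prems], of "\<gamma> ^ k"] \<gamma> by (simp add: sum_distrib_right mult.assoc)
    finally show ?case using \<alpha>_pos by (simp add: \<gamma>_def divide_right_mono algebra_simps)
  qed (simp add: M)
  have form: "D i (P t f) x = exp (- s) * (\<Sum>k. s ^ k / fact k * D i ((K ^^ k) f) x)" if x: "x \<in> cube n" for x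
  proof -
    have "x(i := 1) \<in> cube n" "x(i := -1) \<in> cube n" using cube_upd[OF x i] by auto
    from suminf_diff[OF this[THEN K_iter_summable, of s f]]
    show ?thesis
      unfolding disc_deriv_def P_def s_def[symmetric] right_diff_distrib[symmetric] by simp
  qed
  have "mean (\<lambda>x. \<bar>D i (P t f) x\<bar>) = mean (\<lambda>x. \<bar>exp (- s) * (\<Sum>k. s ^ k / fact k * D i ((K ^^ k) f) x)\<bar>)"
    by (rule mean_cong) (simp add: form)
  also have "\<dots> \<le> A i * exp (s * (\<gamma> - 1))"
  proof (rule mean_poisson_average_le[OF _ iter[OF i] s])
    show "\<bar>D i ((K ^^ k) f) x\<bar> \<le> 2 * B" if x: "x \<in> cube n" for k x
    proof -
      have "\<bar>(K ^^ k) f (x(i := 1))\<bar> \<le> B" "\<bar>(K ^^ k) f (x(i := -1))\<bar> \<le> B"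
        using B cube_upd[OF x i] by auto
      then show ?thesis unfolding disc_deriv_def by linarith
    qed
  qed
  also have "s * (\<gamma> - 1) = t / \<alpha>" using n_pos by (simp add: s_def \<gamma>_def)
  finally show ?thesis .
qed

definition "decay_rate = \<alpha> / lsi_const"

lemma decay_rate_pos: "0 < decay_rate"
  using \<alpha>_pos lsi_const_pos by (simp add: decay_rate_def)

lemma energy_component_deriv:
  assumes i: "i \<in> V"
  shows "((\<lambda>t. mean (\<lambda>x. (D i (P t f) x)\<^sup>2)) has_real_derivative 2 * mean (\<lambda>x. D i (P t f) x * D i (L (P t f)) x)) (at t)"
proof -
  have "((\<lambda>t. mean (\<lambda>x. (D i (P t f) x)\<^sup>2)) has_real_derivative mean (\<lambda>x. 2 * (D i (P t f) x * D i (L (P t f)) x))) (at t)"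
  proof (rule mean_deriv)
    fix x assume x: "x \<in> cube n"
    from DERIV_mult'[OF D_P_deriv[OF x i, of f t] D_P_deriv[OF x i, of f t]]
    show "((\<lambda>t. (D i (P t f) x)\<^sup>2) has_real_derivative 2 * (D i (P t f) x * D i (L (P t f)) x)) (at t)"
      by (simp add: power2_eq_square algebra_simps)
  qed
  then show ?thesis by (simp only: mean_cmult)
qed

text \<open>The logarithmic Sobolev inequality for \<open>D i f\<close> turns the second derivatives produced by the dynamics
  into decay of the energy at \<open>i\<close>, at a rate \<open>k\<close> of free choice. The commutator contributes the
  flow of energy from the other sites.\<close>
lemma energy_component_dissipation:
  assumes i: "i \<in> V" and M: "mean (\<lambda>x. \<bar>D i f x\<bar>) \<le> M"
  shows "2 * mean (\<lambda>x. D i f x * D i (L f) x) \<le> - decay_rate * (k * mean (\<lambda>x. (D i f x)\<^sup>2) - exp k * M\<^sup>2)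
    + (\<Sum>j\<in>V. d i j * mean (\<lambda>x. (D j f x)\<^sup>2)) / \<alpha>"
proof -
  define N where "N j = mean (\<lambda>x. (D j f x)\<^sup>2)" for j
  have N: "0 \<le> N j" for j unfolding N_def by (intro mean_nonneg) auto
  define u where "u = D i f"
  define R where "R j = mean (\<lambda>x. (D j u x)\<^sup>2)" for j
  have one: "2 * mean (\<lambda>x. u x * (D i (Ei j f) x - u x)) \<le> - \<alpha> * R j + d i j * (N i + N j / \<alpha>) - (if j = i then 2 * N i else 0)"
    if j: "j \<in> V" for j
  proof (cases "j = i")
    case True
    have "2 * mean (\<lambda>x. u x * (D i (Ei j f) x - u x)) = - 2 * N i"
      using True mean_minus[of "\<lambda>x. u x * u x"] by (simp add: N_def u_def power2_eq_square)
    moreover have "R j = 0" using True by (simp add: R_def u_def)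
    moreover have "0 \<le> d i j * (N i + N j / \<alpha>)" using N d_nonneg[OF i j] \<alpha>_pos by (intro mult_nonneg_nonneg add_nonneg_nonneg) auto
    ultimately show ?thesis using True by simp
  next
    case False
    have "2 * mean (\<lambda>x. u x * (D i (Ei j f) x - u x))
      \<le> mean (\<lambda>x. 2 * (- (u x * (u x - Ei j u x))) + d i j * ((u x)\<^sup>2 + (D j f (flip i x))\<^sup>2))"
      unfolding mean_cmult[symmetric]
    proof (rule mean_mono)
      fix x assume x: "x \<in> cube n"
      define r where "r = D i (p j) x"
      define v where "v = D j f (flip i x)"
      have r: "\<bar>r\<bar> \<le> d i j" unfolding r_def using False by (intro heat_bath_lipschitz x i j) auto
      have "2 * (u x * (r * v)) \<le> 2 * (\<bar>u x\<bar> * (\<bar>r\<bar> * \<bar>v\<bar>))"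
        by (simp add: abs_mult[symmetric])
      also have "\<dots> \<le> 2 * (\<bar>u x\<bar> * (d i j * \<bar>v\<bar>))"
        using r by (intro mult_left_mono mult_right_mono) auto
      also have "\<dots> = d i j * (2 * \<bar>u x\<bar> * \<bar>v\<bar>)" by simp
      also have "\<dots> \<le> d i j * ((u x)\<^sup>2 + v\<^sup>2)"
        using sum_squares_bound[of "\<bar>u x\<bar>" "\<bar>v\<bar>"] d_nonneg[OF i j] by (intro mult_left_mono) auto
      finally have "2 * (u x * (r * v)) \<le> d i j * ((u x)\<^sup>2 + v\<^sup>2)" .
      moreover have "D i (Ei j f) x = Ei j u x + r * v"
        unfolding u_def r_def v_def using D_Ei[of x i j f] cube_cases[OF x i] False by auto
      ultimately show "2 * (u x * (D i (Ei j f) x - u x))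
        \<le> 2 * (- (u x * (u x - Ei j u x))) + d i j * ((u x)\<^sup>2 + (D j f (flip i x))\<^sup>2)"
        unfolding v_def[symmetric] by (simp add: algebra_simps)
    qed
    also have "\<dots> = - 2 * mean (\<lambda>x. u x * (u x - Ei j u x)) + d i j * (N i + mean (\<lambda>x. (D j f (flip i x))\<^sup>2))"
      unfolding mean_add mean_cmult mean_minus N_def u_def by simp
    also have "\<dots> \<le> - 2 * ((\<alpha> / 2) * R j) + d i j * (N i + N j / \<alpha>)"
    proof (rule add_mono)
      have "(\<alpha> / 2) * R j \<le> mean (\<lambda>x. u x * (u x - Ei j u x))"
        unfolding mean_dirichlet[OF j] R_def mean_cmult[symmetric]
      proof (rule mean_mono)
        fix x assume "x \<in> cube n"
        from mult_right_mono[OF heat_bath_var_bounds(1)[OF this j], of "(D j u x)\<^sup>2"]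
        show "\<alpha> / 2 * (D j u x)\<^sup>2 \<le> p j x * (1 - p j x) * D j u x * D j u x"
          by (simp add: power2_eq_square mult.assoc)
      qed
      then show "- 2 * mean (\<lambda>x. u x * (u x - Ei j u x)) \<le> - 2 * ((\<alpha> / 2) * R j)" by simp
      have "mean (\<lambda>x. (D j f (flip i x))\<^sup>2) \<le> N j / \<alpha>"
        unfolding N_def by (rule mean_flip_le[OF i]) auto
      then show "d i j * (N i + mean (\<lambda>x. (D j f (flip i x))\<^sup>2)) \<le> d i j * (N i + N j / \<alpha>)"
        using d_nonneg[OF i j] by (intro mult_left_mono) auto
    qed
    finally show ?thesis using False by simp
  qed
  have "D i (L f) x = (\<Sum>j\<in>V. D i (Ei j f) x - u x)" for x
    unfolding L_def disc_deriv_def u_def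
    by (subst sum_subtractf[symmetric]) (simp add: algebra_simps)
  then have "2 * mean (\<lambda>x. D i f x * D i (L f) x) = (\<Sum>j\<in>V. 2 * mean (\<lambda>x. u x * (D i (Ei j f) x - u x)))"
    unfolding sum_distrib_left[symmetric] mean_sum[symmetric] by (simp add: u_def sum_distrib_left)
  also have "\<dots> \<le> (\<Sum>j\<in>V. - \<alpha> * R j + d i j * (N i + N j / \<alpha>) - (if j = i then 2 * N i else 0))"
    by (intro sum_mono one)
  also have "\<dots> = - \<alpha> * (\<Sum>j\<in>V. R j) + (\<Sum>j\<in>V. d i j) * N i + (\<Sum>j\<in>V. d i j * N j) / \<alpha> - 2 * N i"
    using i by (simp add: sum_subtractf sum.distrib sum_distrib_left sum_distrib_right sum_divide_distrib distrib_left sum_negf)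
  also have "\<dots> \<le> - \<alpha> * (\<Sum>j\<in>V. R j) + 2 * N i + (\<Sum>j\<in>V. d i j * N j) / \<alpha> - 2 * N i"
    using d_row[OF i] \<rho>_less N[of i] by (intro diff_right_mono add_right_mono add_left_mono mult_right_mono) auto
  also have "\<dots> = - \<alpha> * (\<Sum>j\<in>V. R j) + (\<Sum>j\<in>V. d i j * N j) / \<alpha>" by simp
  also have "- \<alpha> * (\<Sum>j\<in>V. R j) \<le> - decay_rate * (k * N i - exp k * M\<^sup>2)"
  proof -
    have "k * N i \<le> lsi_const * (\<Sum>j\<in>V. R j) + exp k * (mean (\<lambda>x. \<bar>u x\<bar>))\<^sup>2"
      using linearized_log_sobolev[of k u] by (simp add: N_def R_def u_def)
    also have "\<dots> \<le> lsi_const * (\<Sum>j\<in>V. R j) + exp k * M\<^sup>2"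
      using M by (intro add_left_mono mult_left_mono power_mono mean_nonneg) (auto simp: u_def)
    finally have "decay_rate * (k * N i - exp k * M\<^sup>2) \<le> decay_rate * (lsi_const * (\<Sum>j\<in>V. R j))"
      using decay_rate_pos by (intro mult_left_mono) auto
    then show ?thesis using lsi_const_pos by (simp add: decay_rate_def)
  qed
  finally show ?thesis by (simp add: N_def)
qed

section \<open>Sensitivity and variance\<close>
definition boolean :: "((nat \<Rightarrow> real) \<Rightarrow> real) \<Rightarrow> bool" where
  "boolean f \<longleftrightarrow> (\<forall>x\<in>cube n. f x = 1 \<or> f x = -1)"

definition infl :: "((nat \<Rightarrow> real) \<Rightarrow> real) \<Rightarrow> nat \<Rightarrow> real" where
  "infl f i = mean (\<lambda>x. if f (flip i x) = f x then 0 else 1)"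

definition sens :: "((nat \<Rightarrow> real) \<Rightarrow> real) \<Rightarrow> real" where
  "sens f = mean (\<lambda>x. sqrt (real (sensitivity n f x)))"

lemma boolean_cases: "boolean f \<Longrightarrow> x \<in> cube n \<Longrightarrow> f x = 1 \<or> f x = -1"
  by (auto simp: boolean_def)

lemma boolean_square: "boolean f \<Longrightarrow> x \<in> cube n \<Longrightarrow> (f x)\<^sup>2 = 1"
  using boolean_cases[of f x] by auto

lemma infl_bounds: "0 \<le> infl f i" "infl f i \<le> 1"
proof -
  show "0 \<le> infl f i" unfolding infl_def by (intro mean_nonneg) auto
  have "infl f i \<le> mean (\<lambda>_. 1)" unfolding infl_def by (intro mean_mono) auto
  then show "infl f i \<le> 1" by simp
qed

lemma boolean_D:
  assumes f: "boolean f" and x: "x \<in> cube n" and i: "i \<in> V"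
  shows "\<bar>D i f x\<bar> = 2 * (if f (flip i x) = f x then 0 else 1)"
    "(D i f x)\<^sup>2 = 4 * (if f (flip i x) = f x then 0 else 1)"
proof -
  have "\<bar>D i f x\<bar> = \<bar>f x - f (flip i x)\<bar>"
    using abs_disc_deriv_eq[of x i f] cube_cases[OF x i] by blast
  then show 1: "\<bar>D i f x\<bar> = 2 * (if f (flip i x) = f x then 0 else 1)"
    using boolean_cases[OF f x] boolean_cases[OF f cube_flip[OF x i]] by auto
  have "(D i f x)\<^sup>2 = \<bar>D i f x\<bar>\<^sup>2" by simp
  then show "(D i f x)\<^sup>2 = 4 * (if f (flip i x) = f x then 0 else 1)" unfolding 1 by simp
qed

lemma mean_abs_D_boolean: "boolean f \<Longrightarrow> i \<in> V \<Longrightarrow> mean (\<lambda>x. \<bar>D i f x\<bar>) = 2 * infl f i"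
  unfolding infl_def mean_cmult[symmetric] by (intro mean_cong boolean_D)

lemma mean_D_square_boolean: "boolean f \<Longrightarrow> i \<in> V \<Longrightarrow> mean (\<lambda>x. (D i f x)\<^sup>2) = 4 * infl f i"
  unfolding infl_def mean_cmult[symmetric] by (intro mean_cong boolean_D)

lemma mean_sqrt_Gam_boolean:
  assumes f: "boolean f"
  shows "mean (\<lambda>x. sqrt (Gam f x)) = 2 * sens f"
  unfolding sens_def mean_cmult[symmetric]
proof (rule mean_cong)
  fix x assume x: "x \<in> cube n"
  have "Gam f x = (\<Sum>i\<in>V. 4 * (if f (flip i x) = f x then 0 else 1))"
    unfolding Gam_def by (intro sum.cong refl boolean_D f x)
  also have "\<dots> = 4 * (\<Sum>i\<in>V. if f (flip i x) \<noteq> f x then 1 else 0)"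
    unfolding sum_distrib_left[symmetric] by (intro arg_cong[of _ _ "(*) 4"] sum.cong) auto
  also have "(\<Sum>i\<in>V. if f (flip i x) \<noteq> f x then 1 else 0) = real (sensitivity n f x)"
    unfolding sensitivity_def by (simp add: sum.If_cases Int_def)
  finally show "sqrt (Gam f x) = 2 * sqrt (real (sensitivity n f x))"
    by (simp add: real_sqrt_mult)
qed

lemma sens_nonneg: "0 \<le> sens f"
  unfolding sens_def by (intro mean_nonneg) auto

lemma var_boolean: "boolean f \<Longrightarrow> var f = 1 - (mean f)\<^sup>2"
  using mean_cong[of "\<lambda>x. (f x)\<^sup>2" "\<lambda>_. 1"] by (simp add: var_def boolean_square)

lemma var_boolean_le_1: "boolean f \<Longrightarrow> var f \<le> 1"
  by (simp add: var_boolean)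

lemma mean_abs_centered_boolean:
  assumes f: "boolean f"
  shows "mean (\<lambda>x. \<bar>f x - mean f\<bar>) = var f"
proof -
  have "\<bar>mean f\<bar> \<le> mean (\<lambda>x. \<bar>f x\<bar>)" by (rule mean_abs)
  also have "\<dots> = mean (\<lambda>_. 1)" using boolean_cases[OF f] by (intro mean_cong) fastforce
  finally have m: "\<bar>mean f\<bar> \<le> 1" by simp
  have "mean (\<lambda>x. \<bar>f x - mean f\<bar>) = mean (\<lambda>x. 1 - mean f * f x)"
  proof (rule mean_cong)
    fix x assume "x \<in> cube n"
    from boolean_cases[OF f this] m show "\<bar>f x - mean f\<bar> = 1 - mean f * f x" by auto
  qed
  also have "\<dots> = 1 - mean f * mean f" unfolding mean_diff mean_cmult mean_const ..
  finally show ?thesis using var_boolean[OF f] by (simp add: power2_eq_square)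
qed

text \<open>For a Boolean function the L1-norm of \<open>f - E f\<close> is \<open>var f\<close>, much smaller than its L2-norm when the
  variance is small.\<close>
lemma var_P_le_var_power:
  assumes f: "boolean f" and V: "0 < var f"
  shows "var (P 1 f) \<le> (1 + decay_rate) * var f powr (min (decay_rate / 2) (1 / 2)) * var f"
proof -
  define v where "v = var f"
  define c where "c = decay_rate"
  have c: "0 < c" unfolding c_def by (rule decay_rate_pos)
  have v: "0 < v" "v \<le> 1" using V var_boolean_le_1[OF f] by (auto simp: v_def)
  define k where "k = - ln v / 2"
  have k: "0 \<le> k" using v by (simp add: k_def)
  have "var (P 1 f) \<le> exp (0 * (1 - 0)) * (exp (- (c * k) * (1 - 0)) * var (P 0 f) + (c * exp k * v\<^sup>2) * (1 - 0))"
  proof (rule gronwall_linear[OF _ _ _ _ var_P_deriv])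
    fix t :: real assume t: "0 \<le> t" "t \<le> 1"
    define u where "u x = P t f x - mean f" for x
    have eu: "mean (\<lambda>x. (u x)\<^sup>2) = var (P t f)" by (simp add: u_def var_eq mean_P)
    have Du: "D i u x = D i (P t f) x" for i x by (simp add: disc_deriv_def u_def)
    have "k * var (P t f) \<le> lsi_const * mean (Gam (P t f)) + exp k * (mean (\<lambda>x. \<bar>u x\<bar>))\<^sup>2"
      using linearized_log_sobolev[of k u] by (simp add: eu Du Gam_def[abs_def] mean_sum)
    also have "\<dots> \<le> lsi_const * mean (Gam (P t f)) + exp k * v\<^sup>2"
    proof (intro add_left_mono mult_left_mono power_mono mean_nonneg)
      show "mean (\<lambda>x. \<bar>u x\<bar>) \<le> v"
        using mean_abs_P_minus_const_le[OF t(1), of f "mean f"] mean_abs_centered_boolean[OF f]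
        by (simp add: u_def v_def)
    qed auto
    finally have "c * (k * var (P t f) - exp k * v\<^sup>2) \<le> c * (lsi_const * mean (Gam (P t f)))"
      using c by (intro mult_left_mono) auto
    also have "\<dots> = \<alpha> * mean (Gam (P t f))" using lsi_const_pos by (simp add: c_def decay_rate_def)
    finally show "2 * mean (\<lambda>x. P t f x * L (P t f) x) \<le> - (c * k) * var (P t f) + 0 * var (P t f) + c * exp k * v\<^sup>2"
      using dissipation_bounds(1)[of "P t f"] by (simp add: algebra_simps)
  qed (use c k in auto)
  moreover have "var (P 0 f) = v" by (simp add: var_def mean_P v_def)
  ultimately have "var (P 1 f) \<le> exp (- (c * k)) * v + c * exp k * v\<^sup>2" by simp
  also have "exp (- (c * k)) = v powr (c / 2)" using v by (simp add: powr_def k_def)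
  also have "c * exp k * v\<^sup>2 = c * v powr (1 / 2) * v"
  proof -
    have "exp k * v = exp k * exp (ln v)" using v by simp
    also have "\<dots> = v powr (1 / 2)" using v unfolding exp_add[symmetric] by (simp add: powr_def k_def)
    finally have "exp k * v = v powr (1 / 2)" .
    then show ?thesis by (simp add: power2_eq_square)
  qed
  also have "v powr (c / 2) * v + c * v powr (1 / 2) * v \<le> v powr (min (c / 2) (1 / 2)) * v + c * v powr (min (c / 2) (1 / 2)) * v"
    using v c by (intro add_mono mult_right_mono mult_left_mono powr_mono') auto
  finally show ?thesis by (simp add: v_def c_def algebra_simps)
qed

definition "gap = \<alpha> / loc_const"

lemma gap_pos: "0 < gap"
  using \<alpha>_pos loc_const_pos by (simp add: gap_def)

definition "iso_const = min (sqrt (smooth_const / (2 * ln 4)) / 2) ((1 - exp (- gap / 2)) * sqrt smooth_const / sqrt (ln 16))"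

lemma iso_const_pos: "0 < iso_const"
proof -
  have "0 < sqrt (smooth_const / (2 * ln 4)) / 2" using smooth_const_pos by simp
  moreover have "0 < (1 - exp (- gap / 2)) * sqrt smooth_const / sqrt (ln 16)"
    using smooth_const_pos gap_pos by (intro divide_pos_pos mult_pos_pos) auto
  ultimately show ?thesis by (simp add: iso_const_def)
qed

lemma var_decrease_le_sens:
  assumes f: "boolean f" and t: "0 \<le> t" "t \<le> 1 / 2"
  shows "var f - var (P t f) \<le> sqrt (2 * t / smooth_const) * sens f"
proof -
  have "mean (\<lambda>x. (f x)\<^sup>2) - mean (\<lambda>x. f x * P (2 * t) f x)
    \<le> sqrt (2 * t) * mean (\<lambda>x. sqrt (Gam f x)) / (2 * sqrt smooth_const)"
    using t by (intro correlation_decay_le_gradient) (auto simp: boolean_square[OF f])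
  moreover have "mean (\<lambda>x. (f x)\<^sup>2) - mean (\<lambda>x. f x * P (2 * t) f x) = var f - var (P t f)"
    by (simp add: mean_mult_P_double var_def mean_P)
  ultimately show ?thesis unfolding mean_sqrt_Gam_boolean[OF f] by (simp add: real_sqrt_divide)
qed

text \<open>By log-convexity \<open>var (P t f) \<le> var f / 2\<close> at \<open>t = ln 4 / r\<close> if \<open>r\<close> is large. For small \<open>r\<close> the
  spectral gap removes a fixed proportion of the variance by time 1/2.\<close>
lemma sens_ge:
  assumes f: "boolean f" and V: "0 < var f" and r: "var (P 1 f) \<le> exp (- r) * var f"
  shows "iso_const * var f * sqrt (max 1 r) \<le> sens f"
proof (cases "ln 16 \<le> r")
  case True
  define v where "v = var f"
  have v: "0 < v" using V by (simp add: v_def)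
  have l16: "ln (16 :: real) = 2 * ln 4"
    using ln_realpow[of 4 2] by simp
  have l4: "1 < ln (4::real)"
  proof -
    have "exp 1 < (4::real)" using e_less_272 by simp
    then show ?thesis by (subst exp_less_cancel_iff[symmetric]) simp
  qed
  have Lp: "1 < r" using True l16 l4 by linarith
  define t where "t = ln 4 / r"
  have t: "0 \<le> t" "t \<le> 1 / 2" "t \<le> 1" using True l16 l4 Lp by (auto simp: t_def field_simps)
  define \<eta> where "\<eta> = exp (- r)"
  have \<eta>: "0 < \<eta>" "\<eta> \<le> 1" using Lp by (auto simp: \<eta>_def)
  \<comment> \<open>For \<open>\<epsilon> = \<eta> * v\<close> both factors are at most doubled, and \<open>2 * \<eta> powr t = 1 / 2\<close>.\<close>
  have "var (P t f) \<le> var (P t f) + \<eta> * v" using \<eta> v by simp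
  also have "\<dots> \<le> (v + \<eta> * v) powr (1 - t) * (var (P 1 f) + \<eta> * v) powr t"
    unfolding v_def using \<eta> V t by (intro var_P_log_convex) auto
  also have "\<dots> \<le> (2 * v) powr (1 - t) * (2 * v * \<eta>) powr t"
    using \<eta> v t r mult_right_mono[OF \<eta>(2), of v] var_nonneg[of "P 1 f"]
    by (intro mult_mono powr_mono2) (auto simp: \<eta>_def v_def mult_ac)
  also have "\<dots> = ((2 * v) powr (1 - t) * (2 * v) powr t) * \<eta> powr t"
    using \<eta> v by (simp add: powr_mult)
  also have "(2 * v) powr (1 - t) * (2 * v) powr t = 2 * v" using v by (simp add: powr_add[symmetric])
  also have "\<eta> powr t = 1 / 4"
  proof -
    have "t * ln \<eta> = - ln 4" using Lp by (simp add: \<eta>_def t_def)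
    then show ?thesis using \<eta> by (simp add: powr_def exp_minus)
  qed
  finally have "v / 2 \<le> v - var (P t f)" by simp
  also have "\<dots> \<le> sqrt (2 * t / smooth_const) * sens f"
    unfolding v_def by (rule var_decrease_le_sens[OF f t(1,2)])
  finally have 1: "v / 2 \<le> sqrt (2 * t / smooth_const) * sens f" .
  have "iso_const * v * sqrt (max 1 r) \<le> (sqrt (smooth_const / (2 * ln 4)) / 2) * v * sqrt r"
  proof (intro mult_mono)
    show "iso_const \<le> sqrt (smooth_const / (2 * ln 4)) / 2"
      unfolding iso_const_def by (rule min.cobounded1)
  qed (use v Lp l4 smooth_const_pos in auto)
  also have "\<dots> = (sqrt (smooth_const / (2 * ln 4)) * sqrt r) * (v / 2)" by simp
  also have "\<dots> \<le> (sqrt (smooth_const / (2 * ln 4)) * sqrt r) * (sqrt (2 * t / smooth_const) * sens f)"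
    using 1 Lp l4 smooth_const_pos by (intro mult_left_mono) auto
  also have "\<dots> = sqrt (smooth_const / (2 * ln 4) * r * (2 * t / smooth_const)) * sens f"
    by (simp only: real_sqrt_mult mult.assoc)
  also have "smooth_const / (2 * ln 4) * r * (2 * t / smooth_const) = 1"
    using Lp l4 smooth_const_pos by (simp add: t_def)
  finally show ?thesis by (simp add: v_def)
next
  case False
  have l16: "1 < ln (16::real)"
  proof -
    have "exp 1 < (16::real)" using e_less_272 by simp
    then show ?thesis by (subst exp_less_cancel_iff[symmetric]) simp
  qed
  have g: "0 \<le> 1 - exp (- gap / 2)" using gap_pos by simp
  have "var (P (1 / 2) f) \<le> exp (- gap / 2) * var f"
    using var_P_decay[of "1 / 2" f] by (simp add: gap_def)
  then have "(1 - exp (- gap / 2)) * var f \<le> var f - var (P (1 / 2) f)" by (simp add: algebra_simps)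
  also have "\<dots> \<le> sqrt (1 / smooth_const) * sens f"
    using var_decrease_le_sens[OF f, of "1 / 2"] by simp
  finally have 1: "(1 - exp (- gap / 2)) * var f \<le> sqrt (1 / smooth_const) * sens f" .
  have "iso_const * var f * sqrt (max 1 r)
    \<le> ((1 - exp (- gap / 2)) * sqrt smooth_const / sqrt (ln 16)) * var f * sqrt (ln 16)"
  proof (intro mult_mono)
    show "iso_const \<le> (1 - exp (- gap / 2)) * sqrt smooth_const / sqrt (ln 16)"
      unfolding iso_const_def by (rule min.cobounded2)
  qed (use V False l16 smooth_const_pos g in auto)
  also have "\<dots> = sqrt smooth_const * ((1 - exp (- gap / 2)) * var f)" using l16 by simp
  also have "\<dots> \<le> sqrt smooth_const * (sqrt (1 / smooth_const) * sens f)"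
    using 1 smooth_const_pos by (intro mult_left_mono) auto
  also have "\<dots> = sens f" using smooth_const_pos by (simp add: real_sqrt_divide)
  finally show ?thesis .
qed

definition "log_var_rate =
  (let c' = min (decay_rate / 2) (1 / 2) in c' / (c' + ln (1 + decay_rate) + 1))"

lemma log_var_rate_pos: "0 < log_var_rate"
proof -
  have "0 < min (decay_rate / 2) (1 / 2)" "0 < ln (1 + decay_rate)" using decay_rate_pos by auto
  then show ?thesis unfolding log_var_rate_def Let_def by (intro divide_pos_pos add_pos_pos) auto
qed

lemma sens_ge_log_var_sq:
  assumes f: "boolean f" and V: "0 < var f"
  shows "iso_const * var f * sqrt (log_var_rate * (1 + ln (1 / var f))) \<le> sens f"
proof -
  define c' where "c' = min (decay_rate / 2) (1 / 2)"
  define a where "a = ln (1 + decay_rate)"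
  define l where "l = ln (1 / var f)"
  have c': "0 < c'" and a: "0 < a" using decay_rate_pos by (auto simp: c'_def a_def)
  have l: "0 \<le> l" using V var_boolean_le_1[OF f] by (simp add: l_def)
  define r where "r = c' * l - a"
  have "exp (- r) = (1 + decay_rate) * var f powr c'"
  proof -
    have "exp (- r) = exp a * exp (c' * ln (var f))"
      using V by (simp add: r_def l_def ln_div exp_add[symmetric])
    then show ?thesis using decay_rate_pos V by (simp add: a_def powr_def)
  qed
  then have "var (P 1 f) \<le> exp (- r) * var f"
    using var_P_le_var_power[OF f V] by (simp add: c'_def)
  then have "iso_const * var f * sqrt (max 1 r) \<le> sens f" by (rule sens_ge[OF f V])
  moreover have "log_var_rate * (1 + l) \<le> max 1 r"
  proof -
    have r: "log_var_rate = c' / (c' + a + 1)" by (simp add: log_var_rate_def c'_def a_def Let_def)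
    have "c' * (1 + l) = c' + a + r" by (simp add: r_def algebra_simps)
    also have "\<dots> \<le> c' * max 1 r + a * max 1 r + max 1 r"
      using c' a by (intro add_mono) (auto simp: mult_le_cancel_left1)
    also have "\<dots> = max 1 r * (c' + a + 1)" by (simp add: algebra_simps)
    finally show ?thesis using c' a unfolding r by (simp add: pos_divide_le_eq)
  qed
  then have "iso_const * var f * sqrt (log_var_rate * (1 + l)) \<le> iso_const * var f * sqrt (max 1 r)"
    using iso_const_pos V by (intro mult_left_mono) auto
  ultimately show ?thesis by (simp add: l_def)
qed

section \<open>Squared influences\<close>
definition "mass_const = 2 * exp (1 / \<alpha>) / (1 - \<rho>)"

text \<open>The majorant is \<open>A = (1 - \<rho>) * (1 - d)\<^sup>-\<^sup>1 infl\<close>. It is stable under \<open>d\<close>, hence bounds, up to a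
  constant factor, the L1-norms of the derivatives of \<open>P t f\<close> until time 1, and by subconvexity its sums of squares and of Talagrand's function
  do not exceed those of the influences.\<close>
lemma influence_majorant:
  assumes f: "boolean f"
  obtains A where "\<And>i. i \<in> V \<Longrightarrow> 0 \<le> A i" "\<And>i. i \<in> V \<Longrightarrow> A i \<le> 1"
    "\<And>i. i \<in> V \<Longrightarrow> A i = (1 - \<rho>) * infl f i + (\<Sum>j\<in>V. d i j * A j)"
    "\<And>i t. i \<in> V \<Longrightarrow> 0 \<le> t \<Longrightarrow> t \<le> 1 \<Longrightarrow> mean (\<lambda>x. \<bar>D i (P t f) x\<bar>) \<le> mass_const * A i"
    "(\<Sum>i\<in>V. (A i)\<^sup>2) \<le> (\<Sum>i\<in>V. (infl f i)\<^sup>2)"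
    "(\<Sum>i\<in>V. talagrand (A i)) \<le> (\<Sum>i\<in>V. talagrand (infl f i))"
proof -
  obtain A where A: "\<And>i. i \<in> V \<Longrightarrow> 0 \<le> A i"
    "\<And>i. i \<in> V \<Longrightarrow> A i = (1 - \<rho>) * infl f i + (\<Sum>j\<in>V. d i j * A j)"
    using substochastic_fixpoint[of V d \<rho> "infl f"] d_nonneg d_row \<rho>_nonneg \<rho>_less infl_bounds by blast
  have A1: "A i \<le> 1" if "i \<in> V" for i
    by (rule substochastic_fixpoint_le[OF _ d_nonneg d_row \<rho>_less A infl_bounds(2) that]) auto
  have M: "mean (\<lambda>x. \<bar>D i (P t f) x\<bar>) \<le> mass_const * A i" if i: "i \<in> V" and t: "0 \<le> t" "t \<le> 1" for i t
  proof -
    define A' where "A' i = 2 / (1 - \<rho>) * A i" for i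
    have dA: "(\<Sum>j\<in>V. d i j * A j) \<le> A i" if "i \<in> V" for i
      using A(2)[OF that] infl_bounds(1)[of f i] \<rho>_less by simp
    have "mean (\<lambda>x. \<bar>D i (P t f) x\<bar>) \<le> A' i * exp (t / \<alpha>)"
    proof (rule mean_abs_D_P_le[OF t(1) i])
      fix i assume i: "i \<in> V"
      have "0 \<le> (\<Sum>j\<in>V. d i j * A j)" using A d_nonneg[OF i] by (intro sum_nonneg mult_nonneg_nonneg) auto
      then have "(1 - \<rho>) * infl f i \<le> A i" using A(2)[OF i] by simp
      then show "mean (\<lambda>x. \<bar>D i f x\<bar>) \<le> A' i"
        unfolding mean_abs_D_boolean[OF f i] A'_def using \<rho>_less by (simp add: field_simps)
      have "(\<Sum>j\<in>V. d i j * A' j) = 2 / (1 - \<rho>) * (\<Sum>j\<in>V. d i j * A j)"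
        by (simp add: A'_def sum_distrib_left mult_ac)
      also have "\<dots> \<le> A' i" unfolding A'_def using dA[OF i] \<rho>_less by (intro mult_left_mono) auto
      finally show "(\<Sum>j\<in>V. d i j * A' j) \<le> A' i" .
    qed
    also have "\<dots> \<le> A' i * exp (1 / \<alpha>)"
      using A(1)[OF i] \<rho>_less t \<alpha>_pos by (intro mult_left_mono) (auto simp: A'_def divide_right_mono)
    finally show ?thesis by (simp add: A'_def mass_const_def mult_ac)
  qed
  have s1: "(\<Sum>i\<in>V. (A i)\<^sup>2) \<le> (\<Sum>i\<in>V. (infl f i)\<^sup>2)"
  proof (rule substochastic_sum_le[OF d_col \<rho>_less])
    fix i assume i: "i \<in> V"
    show "(A i)\<^sup>2 \<le> (1 - \<rho>) * (infl f i)\<^sup>2 + (\<Sum>j\<in>V. d i j * (A j)\<^sup>2)"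
      unfolding A(2)[OF i] using d_nonneg i d_row \<rho>_less by (intro square_subconvex) auto
  qed auto
  have s2: "(\<Sum>i\<in>V. talagrand (A i)) \<le> (\<Sum>i\<in>V. talagrand (infl f i))"
  proof (rule substochastic_sum_le[OF d_col \<rho>_less])
    fix i assume i: "i \<in> V"
    show "0 \<le> talagrand (A i)" using A(1) A1 i by (intro talagrand_nonneg) auto
    show "talagrand (A i) \<le> (1 - \<rho>) * talagrand (infl f i) + (\<Sum>j\<in>V. d i j * talagrand (A j))"
      unfolding A(2)[OF i] using d_nonneg i d_row \<rho>_less infl_bounds A(1) A1 by (intro talagrand_subconvex) auto
  qed auto
  show ?thesis by (rule that[OF A(1) A1 A(2) M s1 s2])
qed

lemma mean_Gam: "mean (Gam f) = (\<Sum>i\<in>V. mean (\<lambda>x. (D i f x)\<^sup>2))"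
  by (simp add: Gam_def[abs_def] mean_sum)

definition "noise_const = loc_const * (exp (1 / \<alpha>) * (2 / smooth_const + decay_rate * mass_const\<^sup>2))"

text \<open>The total energy \<open>E t\<close> decays at a rate proportional to \<open>k\<close> from time 1/2 on, where smoothing bounds it
  by a constant, down to a level of order \<open>e\<^sup>k * Q\<close> set by the squared L1-norms, \<open>Q\<close> being the sum of the squared influences; take
  \<open>e\<^sup>k = 1 / sqrt Q\<close>.\<close>
lemma var_P_le_sqinf_power:
  assumes f: "boolean f" and Q: "0 < (\<Sum>i\<in>V. (infl f i)\<^sup>2)" "(\<Sum>i\<in>V. (infl f i)\<^sup>2) \<le> 1"
  shows "var (P 1 f) \<le> noise_const * (\<Sum>i\<in>V. (infl f i)\<^sup>2) powr (min (decay_rate / 4) (1 / 2))"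
proof -
  define q where "q = (\<Sum>i\<in>V. (infl f i)\<^sup>2)"
  have q: "0 < q" "q \<le> 1" using Q by (auto simp: q_def)
  define c where "c = decay_rate"
  have c: "0 < c" unfolding c_def by (rule decay_rate_pos)
  define k where "k = - ln q / 2"
  have k: "0 \<le> k" using q by (simp add: k_def)
  obtain A where A_mass: "\<And>i t. i \<in> V \<Longrightarrow> 0 \<le> t \<Longrightarrow> t \<le> 1 \<Longrightarrow> mean (\<lambda>x. \<bar>D i (P t f) x\<bar>) \<le> mass_const * A i"
    and A_sq: "(\<Sum>i\<in>V. (A i)\<^sup>2) \<le> q"
    unfolding q_def by (rule influence_majorant[OF f]) blast
  define N where "N t i = mean (\<lambda>x. (D i (P t f) x)\<^sup>2)" for t i
  have N: "0 \<le> N t i" for t i unfolding N_def by (intro mean_nonneg) auto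
  define E where "E t = (\<Sum>i\<in>V. N t i)" for t
  have E: "E t = mean (Gam (P t f))" for t by (simp add: E_def N_def mean_Gam)
  have E0: "0 \<le> E t" for t unfolding E_def by (intro sum_nonneg N)
  define b where "b = c * exp k * mass_const\<^sup>2 * q"
  have b: "0 \<le> b" using c q by (simp add: b_def)
  have "E 1 \<le> exp (1 / \<alpha> * (1 - 1 / 2)) * (exp (- (c * k) * (1 - 1 / 2)) * E (1 / 2) + b * (1 - 1 / 2))"
  proof (rule gronwall_linear[where y = E])
    fix t :: real assume t: "1 / 2 \<le> t" "t \<le> 1"
    show "(E has_real_derivative (\<Sum>i\<in>V. 2 * mean (\<lambda>x. D i (P t f) x * D i (L (P t f)) x))) (at t)"
      unfolding E_def N_def by (intro DERIV_sum energy_component_deriv)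
    have "(\<Sum>i\<in>V. 2 * mean (\<lambda>x. D i (P t f) x * D i (L (P t f)) x))
      \<le> (\<Sum>i\<in>V. - c * (k * N t i - exp k * (mass_const * A i)\<^sup>2) + (\<Sum>j\<in>V. d i j * N t j) / \<alpha>)"
      unfolding N_def c_def using t by (intro sum_mono energy_component_dissipation A_mass) auto
    also have "\<dots> = - (c * k) * E t + c * exp k * mass_const\<^sup>2 * (\<Sum>i\<in>V. (A i)\<^sup>2) + (\<Sum>j\<in>V. (\<Sum>i\<in>V. d i j) * N t j) / \<alpha>"
    proof -
      have "(\<Sum>i\<in>V. \<Sum>j\<in>V. d i j * N t j) = (\<Sum>j\<in>V. (\<Sum>i\<in>V. d i j) * N t j)"
        unfolding sum_distrib_right by (rule sum.swap)
      then have "(\<Sum>j\<in>V. (\<Sum>i\<in>V. d i j) * N t j) / \<alpha> = (\<Sum>i\<in>V. (\<Sum>j\<in>V. d i j * N t j) / \<alpha>)"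
        by (simp add: sum_divide_distrib[symmetric])
      then show ?thesis
        by (simp add: E_def sum.distrib sum_subtractf sum_negf sum_distrib_left algebra_simps power_mult_distrib)
    qed
    also have "\<dots> \<le> - (c * k) * E t + c * exp k * mass_const\<^sup>2 * q + (\<Sum>j\<in>V. 1 * N t j) / \<alpha>"
    proof -
      have "(\<Sum>i\<in>V. d i j) \<le> 1" if "j \<in> V" for j using d_col[OF that] \<rho>_less by linarith
      then have "(\<Sum>j\<in>V. (\<Sum>i\<in>V. d i j) * N t j) / \<alpha> \<le> (\<Sum>j\<in>V. 1 * N t j) / \<alpha>"
        using N \<alpha>_pos by (intro divide_right_mono sum_mono mult_right_mono) auto
      moreover have "c * exp k * mass_const\<^sup>2 * (\<Sum>i\<in>V. (A i)\<^sup>2) \<le> c * exp k * mass_const\<^sup>2 * q"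
        using A_sq c by (intro mult_left_mono) auto
      ultimately show ?thesis by linarith
    qed
    finally show "(\<Sum>i\<in>V. 2 * mean (\<lambda>x. D i (P t f) x * D i (L (P t f)) x)) \<le> - (c * k) * E t + 1 / \<alpha> * E t + b"
      by (simp add: b_def E_def)
  qed (use c k \<alpha>_pos b in auto)
  also have "\<dots> \<le> exp (1 / \<alpha>) * (exp (- (c * k) / 2) * (2 / smooth_const) + b)"
  proof (intro mult_mono add_mono)
    have "1 / \<alpha> * (1 - 1 / 2) \<le> 1 / \<alpha> * 1" using \<alpha>_pos by (intro mult_left_mono) auto
    then show "exp (1 / \<alpha> * (1 - 1 / 2)) \<le> exp (1 / \<alpha>)" by simp
    have "mean (Gam (P (1 / 2) f)) \<le> mean (\<lambda>_. 2 / smooth_const)"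
    proof (rule mean_mono)
      fix x assume "x \<in> cube n"
      then have "smooth_const * (1 / 2) * Gam (P (1 / 2) f) x \<le> 1"
        using boolean_square[OF f] by (intro gradient_smoothing) auto
      then show "Gam (P (1 / 2) f) x \<le> 2 / smooth_const" using smooth_const_pos by (simp add: field_simps)
    qed
    then show "E (1 / 2) \<le> 2 / smooth_const" by (simp add: E)
  qed (use \<alpha>_pos b E0 in auto)
  also have "exp (- (c * k) / 2) = q powr (c / 4)" using q by (simp add: powr_def k_def)
  also have "b = c * mass_const\<^sup>2 * q powr (1 / 2)"
  proof -
    have "exp k * q = exp k * exp (ln q)" using q by simp
    also have "\<dots> = q powr (1 / 2)" using q unfolding exp_add[symmetric] by (simp add: powr_def k_def)
    finally show ?thesis by (simp add: b_def mult_ac)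
  qed
  also have "q powr (c / 4) * (2 / smooth_const) + c * mass_const\<^sup>2 * q powr (1 / 2)
    \<le> q powr (min (c / 4) (1 / 2)) * (2 / smooth_const) + c * mass_const\<^sup>2 * q powr (min (c / 4) (1 / 2))"
    using q c smooth_const_pos by (intro add_mono mult_left_mono mult_right_mono powr_mono') auto
  finally have "E 1 \<le> exp (1 / \<alpha>) * (q powr (min (c / 4) (1 / 2)) * (2 / smooth_const) + c * mass_const\<^sup>2 * q powr (min (c / 4) (1 / 2)))"
    by simp
  then have "loc_const * E 1 \<le> loc_const * (exp (1 / \<alpha>) * (q powr (min (c / 4) (1 / 2)) * (2 / smooth_const) + c * mass_const\<^sup>2 * q powr (min (c / 4) (1 / 2))))"
    using loc_const_pos by (intro mult_left_mono) auto
  also have "\<dots> = noise_const * q powr (min (c / 4) (1 / 2))"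
    by (simp add: noise_const_def c_def algebra_simps)
  finally show ?thesis using var_le_energy[of "P 1 f"] by (simp add: E q_def c_def)
qed

definition "eldan_gross_const =
  (let c' = min (decay_rate / 4) (1 / 2)
   in iso_const * sqrt (c' / (2 * c' + 1 + ln (max 1 noise_const) + 1 / log_var_rate)))"

lemma eldan_gross_const_pos: "0 < eldan_gross_const"
proof -
  have "0 < min (decay_rate / 4) (1 / 2)" using decay_rate_pos by auto
  then show ?thesis unfolding eldan_gross_const_def Let_def
    using iso_const_pos log_var_rate_pos
    by (intro mult_pos_pos real_sqrt_gt_zero divide_pos_pos add_pos_pos add_pos_nonneg) auto
qed

text \<open>The bound on \<open>var (P 1 f)\<close> gives the logarithm of \<open>var f / Q\<^sup>c\<close> in place of that of \<open>1 / Q\<^sup>c\<close>. The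
  difference is the logarithm of \<open>1 / var f\<close>, which \<open>sens_ge_log_var_sq\<close> controls.\<close>
lemma sens_ge_log_sqinf:
  assumes f: "boolean f" and V: "0 < var f"
  shows "eldan_gross_const * var f * sqrt (ln (1 + exp 1 / (\<Sum>i\<in>V. (infl f i)\<^sup>2))) \<le> sens f"
proof -
  define q where "q = (\<Sum>i\<in>V. (infl f i)\<^sup>2)"
  have q0: "0 \<le> q" unfolding q_def by (intro sum_nonneg) auto
  define c' where "c' = min (decay_rate / 4) (1 / 2)"
  have c': "0 < c'" using decay_rate_pos by (auto simp: c'_def)
  define \<theta> where "\<theta> = log_var_rate"
  have \<theta>: "0 < \<theta>" unfolding \<theta>_def by (rule log_var_rate_pos)
  define B where "B = ln (max 1 noise_const)"
  have B: "0 \<le> B" by (simp add: B_def)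
  define den where "den = 2 * c' + 1 + B + 1 / \<theta>"
  have den: "0 < den" unfolding den_def using c' B \<theta> by (intro add_pos_pos add_pos_nonneg) auto
  have const: "eldan_gross_const = iso_const * sqrt (c' / den)"
    by (simp add: eldan_gross_const_def c'_def den_def B_def \<theta>_def Let_def)
  define X where "X = (sens f / (iso_const * var f))\<^sup>2"
  have iv: "0 < iso_const * var f" using iso_const_pos V by simp
  have toX: "y \<le> X" if "iso_const * var f * sqrt y \<le> sens f" "0 \<le> y" for y
  proof -
    have "sqrt y \<le> sens f / (iso_const * var f)" using that iv by (simp add: pos_le_divide_eq mult.commute)
    then have "(sqrt y)\<^sup>2 \<le> X" unfolding X_def using that by (intro power_mono) auto
    then show ?thesis using that by simp
  qed
  have goal: "eldan_gross_const * var f * sqrt y \<le> sens f" if y: "y * c' \<le> X * den" "0 \<le> y" for y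
  proof -
    have "sqrt (c' / den * y) \<le> sqrt X"
      using y den by (intro real_sqrt_le_mono) (simp add: pos_divide_le_eq mult.commute)
    also have "sqrt X = sens f / (iso_const * var f)" unfolding X_def using iv sens_nonneg[of f] by simp
    finally have "iso_const * var f * sqrt (c' / den * y) \<le> sens f"
      using iv by (simp add: pos_le_divide_eq mult.commute)
    then show ?thesis unfolding const real_sqrt_mult by (simp add: mult_ac)
  qed
  have X1: "\<theta> * (1 + ln (1 / var f)) \<le> X"
    using V var_boolean_le_1[OF f] \<theta> unfolding \<theta>_def
    by (intro toX sens_ge_log_var_sq[OF f V] mult_nonneg_nonneg) auto
  have "var (P 1 f) \<le> exp (- gap) * var f" using var_P_decay[of 1 f] by (simp add: gap_def)
  then have X2: "1 \<le> X" using toX[of "max 1 gap"] sens_ge[OF f V, of gap] by simp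
  have bigden: "2 * c' \<le> den" unfolding den_def using B \<theta> by simp
  have y2: "y * c' \<le> X * den" if "y \<le> 2" for y
  proof -
    have "y * c' \<le> 2 * c'" using that c' by simp
    also have "\<dots> \<le> 1 * den" using bigden by simp
    also have "\<dots> \<le> X * den" using X2 den by (intro mult_right_mono) auto
    finally show ?thesis .
  qed
  have e2: "1 + exp 1 \<le> exp (2::real)"
  proof -
    have "exp (2::real) = exp 1 * exp 1" by (simp add: exp_add[symmetric])
    moreover have "(2::real) \<le> exp 1" using exp_ge_add_one_self[of 1] by simp
    ultimately have "2 * exp 1 \<le> exp (2::real)" by (simp add: mult_right_mono)
    then show ?thesis using \<open>(2::real) \<le> exp 1\<close> by linarith
  qed
  have yn: "0 \<le> ln (1 + exp 1 / q)" using q0 by simp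
  \<comment> \<open>For \<open>q = 0\<close> the logarithm vanishes, as \<open>exp 1 / 0 = 0\<close>.\<close>
  consider "q = 0" | "1 \<le> q" | "0 < q" "q < 1" using q0 by linarith
  then have "ln (1 + exp 1 / q) * c' \<le> X * den"
  proof cases
    case 1
    then show ?thesis using X2 den by simp
  next
    case 2
    then have "1 + exp 1 / q \<le> exp 2" using e2 by (smt (verit) exp_gt_zero frac_le div_by_1)
    then have "ln (1 + exp 1 / q) \<le> ln (exp 2)" using q0 by (subst ln_le_cancel_iff) (auto intro: add_pos_nonneg)
    then show ?thesis by (intro y2) simp
  next
    case 3
    define l where "l = ln (1 / q)"
    have "1 + exp 1 / q \<le> 1 / q + exp 1 / q" using 3 by (intro add_right_mono) simp
    also have "\<dots> \<le> exp 2 / q" unfolding add_divide_distrib[symmetric] using e2 3 by (intro divide_right_mono) auto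
    finally have "1 + exp 1 / q \<le> exp 2 / q" .
    then have "ln (1 + exp 1 / q) \<le> ln (exp 2 / q)" using 3 by (subst ln_le_cancel_iff) (auto intro: add_pos_nonneg)
    also have "\<dots> = 2 + l" using 3 by (simp add: ln_div l_def)
    finally have y: "ln (1 + exp 1 / q) \<le> 2 + l" .
    define r where "r = c' * l - B - ln (1 / var f)"
    have "exp (- r) * var f = exp B * exp (- (c' * l)) * (exp (ln (1 / var f)) * var f)"
    proof -
      have "- r = B + - (c' * l) + ln (1 / var f)" by (simp add: r_def)
      then show ?thesis by (simp only: exp_add mult.assoc)
    qed
    also have "exp (ln (1 / var f)) * var f = 1" using V by simp
    also have "exp (- (c' * l)) = q powr c'" using 3 by (simp add: powr_def l_def ln_div)
    also have "exp B = max 1 noise_const" by (simp add: B_def)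
    finally have eL: "exp (- r) * var f = max 1 noise_const * q powr c'" by simp
    have "var (P 1 f) \<le> noise_const * q powr c'"
      using var_P_le_sqinf_power[OF f] 3 by (simp add: q_def c'_def)
    also have "\<dots> \<le> max 1 noise_const * q powr c'" by (intro mult_right_mono) auto
    finally have "var (P 1 f) \<le> exp (- r) * var f" unfolding eL .
    then have X3: "max 1 r \<le> X" by (intro toX sens_ge[OF f V]) auto
    have "(2 + l) * c' = 2 * c' + r + B + ln (1 / var f)" by (simp add: r_def algebra_simps)
    also have "\<dots> \<le> 2 * c' * X + X + B * X + X / \<theta>"
    proof (intro add_mono)
      show "2 * c' \<le> 2 * c' * X" using X2 c' by simp
      show "B \<le> B * X" using X2 B by (simp add: mult_le_cancel_left1)
      show "r \<le> X" using X3 by simp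
      have "1 + ln (1 / var f) \<le> X / \<theta>" using X1 \<theta> by (simp add: pos_le_divide_eq mult.commute)
      then show "ln (1 / var f) \<le> X / \<theta>" by simp
    qed
    also have "\<dots> = X * den" by (simp add: den_def algebra_simps)
    finally have "(2 + l) * c' \<le> X * den" .
    moreover have "ln (1 + exp 1 / q) * c' \<le> (2 + l) * c'" using y c' by (intro mult_right_mono) auto
    ultimately show ?thesis by linarith
  qed
  then show ?thesis using goal[OF _ yn] by (simp add: q_def)
qed

section \<open>Talagrand's inequality and the maximal influence\<close>
definition "talagrand_const =
  decay_rate * (1 - \<rho>) * exp (- (decay_rate / 2 + 1 / \<alpha>)) * (1 - exp (- gap)) / (4 + 2 * decay_rate * mass_const\<^sup>2)"

lemma talagrand_const_pos: "0 < talagrand_const"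
  unfolding talagrand_const_def using decay_rate_pos \<rho>_less gap_pos
  by (intro divide_pos_pos mult_pos_pos add_pos_nonneg) auto

text \<open>The energy \<open>N t i\<close> at site \<open>i\<close> starts at \<open>4 * infl f i\<close>, decays at a rate proportional to \<open>k i\<close>, half the
  logarithm of \<open>1 / A i\<close>, and receives energy from its neighbours. The weights \<open>\<omega> i \<ge> (1 - \<rho>) / (1 + ln (1 / A i))\<close>
  turn the decay of the weighted energy \<open>F\<close> into a multiple of the total energy, and \<open>\<omega>\<close> being stable
  under \<open>d\<close> turns the flow into a multiple of \<open>F\<close>. As the total energy dominates the rate at which the
  variance decreases, the variance lost up to time 1 is at most a multiple of
  \<open>F 0 = 4 * (\<Sum>i. talagrand (A i))\<close> plus errors of the same order.\<close>
lemma var_le_sum_talagrand: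
  assumes f: "boolean f"
  shows "talagrand_const * var f \<le> (\<Sum>i\<in>V. talagrand (infl f i))"
proof -
  define c where "c = decay_rate"
  have c: "0 < c" unfolding c_def by (rule decay_rate_pos)
  define C where "C = mass_const"
  obtain A where A0: "\<And>i. i \<in> V \<Longrightarrow> 0 \<le> A i" and A1: "\<And>i. i \<in> V \<Longrightarrow> A i \<le> 1"
    and A_eq: "\<And>i. i \<in> V \<Longrightarrow> A i = (1 - \<rho>) * infl f i + (\<Sum>j\<in>V. d i j * A j)"
    and A_mass: "\<And>i t. i \<in> V \<Longrightarrow> 0 \<le> t \<Longrightarrow> t \<le> 1 \<Longrightarrow> mean (\<lambda>x. \<bar>D i (P t f) x\<bar>) \<le> C * A i"
    and A_tal: "(\<Sum>i\<in>V. talagrand (A i)) \<le> (\<Sum>i\<in>V. talagrand (infl f i))"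
    unfolding C_def by (rule influence_majorant[OF f]) blast
  define l where "l i = 1 + ln (1 / A i)" for i
  have l: "1 \<le> l i" if "i \<in> V" for i unfolding l_def using that A0 A1 by (intro one_plus_ln_inverse_ge_1) auto
  have l': "0 \<le> 1 / l i" "1 / l i \<le> 1" if "i \<in> V" for i using l[OF that] by auto
  obtain \<omega> where \<omega>0: "\<And>i. i \<in> V \<Longrightarrow> 0 \<le> \<omega> i"
    and \<omega>_eq: "\<And>i. i \<in> V \<Longrightarrow> \<omega> i = (1 - \<rho>) * (1 / l i) + (\<Sum>j\<in>V. d i j * \<omega> j)"
    by (rule substochastic_fixpoint[of V d \<rho> "\<lambda>i. 1 / l i"])
      (use d_nonneg d_row \<rho>_nonneg \<rho>_less l' in auto)
  have \<omega>1: "\<omega> i \<le> 1" if "i \<in> V" for i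
    by (rule substochastic_fixpoint_le[OF _ d_nonneg d_row \<rho>_less \<omega>0 \<omega>_eq l'(2) that]) auto
  have \<omega>_ge: "(1 - \<rho>) * (1 / l i) \<le> \<omega> i" if i: "i \<in> V" for i
  proof -
    have "0 \<le> (\<Sum>j\<in>V. d i j * \<omega> j)" using \<omega>0 d_nonneg[OF i] by (intro sum_nonneg mult_nonneg_nonneg) auto
    then show ?thesis using \<omega>_eq[OF i] by simp
  qed
  have \<omega>_col: "(\<Sum>i\<in>V. d i j * \<omega> i) \<le> \<omega> j" if j: "j \<in> V" for j
  proof -
    have "(\<Sum>i\<in>V. d i j * \<omega> i) = (\<Sum>i\<in>V. d j i * \<omega> i)" using d_sym[OF j] by (intro sum.cong) auto
    also have "\<dots> \<le> \<omega> j" using \<omega>_eq[OF j] \<rho>_less l'[OF j] by simp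
    finally show ?thesis .
  qed
  define T where "T = (\<Sum>i\<in>V. talagrand (A i))"
  have tal: "talagrand (A i) = A i * (1 / l i)" for i by (simp add: talagrand_def l_def)
  \<comment> \<open>Both vectors come from the resolvent of the symmetric matrix \<open>d\<close>, which can be moved from one to the other.\<close>
  have \<omega>_infl: "(\<Sum>i\<in>V. \<omega> i * infl f i) = T"
  proof -
    have "(1 - \<rho>) * (\<Sum>i\<in>V. \<omega> i * infl f i) = (\<Sum>i\<in>V. \<omega> i * ((1 - \<rho>) * infl f i))"
      by (simp add: sum_distrib_left mult_ac)
    also have "\<dots> = (\<Sum>i\<in>V. \<omega> i * (A i - (\<Sum>j\<in>V. d i j * A j)))"
    proof (intro sum.cong refl)
      fix i assume "i \<in> V"
      from A_eq[OF this] have "(1 - \<rho>) * infl f i = A i - (\<Sum>j\<in>V. d i j * A j)" by linarith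
      then show "\<omega> i * ((1 - \<rho>) * infl f i) = \<omega> i * (A i - (\<Sum>j\<in>V. d i j * A j))" by (simp only:)
    qed
    also have "\<dots> = (\<Sum>i\<in>V. \<omega> i * A i) - (\<Sum>i\<in>V. \<Sum>j\<in>V. \<omega> i * (d i j * A j))"
      by (simp only: right_diff_distrib sum_subtractf sum_distrib_left)
    also have "(\<Sum>i\<in>V. \<Sum>j\<in>V. \<omega> i * (d i j * A j)) = (\<Sum>j\<in>V. \<Sum>i\<in>V. \<omega> i * (d i j * A j))"
      by (rule sum.swap)
    also have "\<dots> = (\<Sum>j\<in>V. (\<Sum>i\<in>V. d j i * \<omega> i) * A j)"
      unfolding sum_distrib_right using d_sym by (intro sum.cong refl) (simp add: mult_ac)
    also have "\<dots> = (\<Sum>j\<in>V. (\<omega> j - (1 - \<rho>) * (1 / l j)) * A j)"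
    proof (intro sum.cong refl)
      fix j assume "j \<in> V"
      from \<omega>_eq[OF this] have "(\<Sum>i\<in>V. d j i * \<omega> i) = \<omega> j - (1 - \<rho>) * (1 / l j)" by linarith
      then show "(\<Sum>i\<in>V. d j i * \<omega> i) * A j = (\<omega> j - (1 - \<rho>) * (1 / l j)) * A j" by (simp only:)
    qed
    also have "(\<Sum>i\<in>V. \<omega> i * A i) - \<dots> = (\<Sum>i\<in>V. (1 - \<rho>) * (A i * (1 / l i)))"
      unfolding sum_subtractf[symmetric] by (intro sum.cong refl) (simp add: algebra_simps)
    also have "\<dots> = (1 - \<rho>) * T" by (simp only: T_def tal sum_distrib_left)
    finally show ?thesis using \<rho>_less by simp
  qed
  define k where "k i = (l i - 1) / 2" for i
  \<comment> \<open>If \<open>A i = 0\<close>, then \<open>k i = 0\<close> because \<open>ln (1 / 0) = 0\<close>, and both sides vanish.\<close>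
  have expk: "exp (k i) * (C * A i)\<^sup>2 \<le> 2 * C\<^sup>2 * talagrand (A i)" if i: "i \<in> V" for i
  proof (cases "A i = 0")
    case False
    then have a: "0 < A i" using A0[OF i] by simp
    have "exp (k i) = 1 / sqrt (A i)"
    proof -
      have "k i = - ln (sqrt (A i))" using a by (simp add: k_def l_def ln_sqrt ln_div)
      then show ?thesis using a by (simp add: exp_minus inverse_eq_divide)
    qed
    then have "exp (k i) * (C * A i)\<^sup>2 = C\<^sup>2 * A i * (A i / sqrt (A i))" by (simp add: power2_eq_square)
    also have "A i / sqrt (A i) = sqrt (A i)" using a by (simp add: real_div_sqrt)
    also have "C\<^sup>2 * A i * sqrt (A i) \<le> C\<^sup>2 * A i * (2 * (1 / l i))"
      using sqrt_le_inverse_log[OF A0[OF i] A1[OF i]] a by (intro mult_left_mono) (auto simp: l_def)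
    finally show ?thesis by (simp add: tal mult_ac)
  qed simp
  define N where "N t i = mean (\<lambda>x. (D i (P t f) x)\<^sup>2)" for t i
  have N: "0 \<le> N t i" for t i unfolding N_def by (intro mean_nonneg) auto
  define E where "E t = (\<Sum>i\<in>V. N t i)" for t
  have E: "E t = mean (Gam (P t f))" for t by (simp add: E_def N_def mean_Gam)
  define F where "F t = (\<Sum>i\<in>V. \<omega> i * N t i)" for t
  have F0: "0 \<le> F t" for t unfolding F_def using \<omega>0 N by (intro sum_nonneg mult_nonneg_nonneg) auto
  define F' where "F' t = (\<Sum>i\<in>V. \<omega> i * (2 * mean (\<lambda>x. D i (P t f) x * D i (L (P t f)) x)))" for t
  have dF: "(F has_real_derivative F' t) (at t)" for t
    unfolding F_def F'_def N_def by (intro DERIV_sum DERIV_cmult energy_component_deriv)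
  define \<mu> where "\<mu> = c / 2 + 1 / \<alpha>"
  have \<mu>: "0 < \<mu>" using c \<alpha>_pos by (simp add: \<mu>_def add_pos_pos)
  define B where "B = 2 * c * C\<^sup>2 * T"
  have B: "0 \<le> B" unfolding B_def T_def using c A0 A1
    by (intro mult_nonneg_nonneg sum_nonneg talagrand_nonneg) auto
  have F': "F' t \<le> - (c * (1 - \<rho>) / 2) * E t + \<mu> * F t + B" if t: "0 \<le> t" "t \<le> 1" for t
  proof -
    have "F' t \<le> (\<Sum>i\<in>V. - (c * (1 - \<rho>) / 2) * N t i + (c / 2) * (\<omega> i * N t i) + 2 * c * C\<^sup>2 * talagrand (A i)
       + (\<Sum>j\<in>V. (d i j * \<omega> i) * N t j) / \<alpha>)"
      unfolding F'_def
    proof (rule sum_mono)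
      fix i assume i: "i \<in> V"
      have "\<omega> i * (2 * mean (\<lambda>x. D i (P t f) x * D i (L (P t f)) x))
        \<le> \<omega> i * (- c * (k i * N t i - exp (k i) * (C * A i)\<^sup>2) + (\<Sum>j\<in>V. d i j * N t j) / \<alpha>)"
        unfolding N_def c_def using t \<omega>0[OF i]
        by (intro mult_left_mono energy_component_dissipation A_mass i) auto
      also have "\<dots> = - (c / 2) * (\<omega> i * l i * N t i) + (c / 2) * (\<omega> i * N t i)
         + c * (\<omega> i * (exp (k i) * (C * A i)\<^sup>2)) + \<omega> i * ((\<Sum>j\<in>V. d i j * N t j) / \<alpha>)"
        unfolding k_def by (simp add: algebra_simps diff_divide_distrib)
      also have "\<dots> \<le> - (c / 2) * ((1 - \<rho>) * N t i) + (c / 2) * (\<omega> i * N t i)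
         + c * (1 * (2 * C\<^sup>2 * talagrand (A i))) + \<omega> i * ((\<Sum>j\<in>V. d i j * N t j) / \<alpha>)"
      proof (intro add_mono order.refl)
        have "(1 - \<rho>) * (1 / l i) * l i \<le> \<omega> i * l i" using \<omega>_ge[OF i] l[OF i] by (intro mult_right_mono) auto
        then have "(1 - \<rho>) * N t i \<le> \<omega> i * l i * N t i" using l[OF i] N by (intro mult_right_mono) auto
        then show "- (c / 2) * (\<omega> i * l i * N t i) \<le> - (c / 2) * ((1 - \<rho>) * N t i)" using c by simp
        show "c * (\<omega> i * (exp (k i) * (C * A i)\<^sup>2)) \<le> c * (1 * (2 * C\<^sup>2 * talagrand (A i)))"
          using c mult_mono[OF \<omega>1[OF i] expk[OF i]] by (intro mult_left_mono) auto
      qed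
      also have "\<omega> i * ((\<Sum>j\<in>V. d i j * N t j) / \<alpha>) = (\<Sum>j\<in>V. (d i j * \<omega> i) * N t j) / \<alpha>"
        by (simp add: sum_distrib_left mult_ac)
      finally show "\<omega> i * (2 * mean (\<lambda>x. D i (P t f) x * D i (L (P t f)) x))
         \<le> - (c * (1 - \<rho>) / 2) * N t i + (c / 2) * (\<omega> i * N t i) + 2 * c * C\<^sup>2 * talagrand (A i)
       + (\<Sum>j\<in>V. (d i j * \<omega> i) * N t j) / \<alpha>" by (simp add: mult_ac)
    qed
    also have "\<dots> = - (c * (1 - \<rho>) / 2) * E t + (c / 2) * F t + B + (\<Sum>i\<in>V. \<Sum>j\<in>V. (d i j * \<omega> i) * N t j) / \<alpha>"
      by (simp only: sum.distrib sum_distrib_left[symmetric] sum_divide_distrib[symmetric] E_def F_def B_def T_def)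
    also have "(\<Sum>i\<in>V. \<Sum>j\<in>V. (d i j * \<omega> i) * N t j) = (\<Sum>j\<in>V. (\<Sum>i\<in>V. d i j * \<omega> i) * N t j)"
      unfolding sum_distrib_right by (rule sum.swap)
    also have "- (c * (1 - \<rho>) / 2) * E t + (c / 2) * F t + B + (\<Sum>j\<in>V. (\<Sum>i\<in>V. d i j * \<omega> i) * N t j) / \<alpha>
      \<le> - (c * (1 - \<rho>) / 2) * E t + (c / 2) * F t + B + F t / \<alpha>"
      unfolding F_def using \<omega>_col N \<alpha>_pos
      by (intro add_left_mono divide_right_mono sum_mono mult_right_mono) auto
    finally show ?thesis by (simp add: \<mu>_def algebra_simps)
  qed
  define \<eta> where "\<eta> = c * (1 - \<rho>) * exp (- \<mu>)"
  have \<eta>: "0 < \<eta>" using c \<rho>_less by (simp add: \<eta>_def)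
  define Y where "Y t = exp (- \<mu> * t) * F t - \<eta> * var (P t f) - B * t" for t
  \<comment> \<open>\<open>exp (- \<mu> * t)\<close> removes the growth of \<open>F\<close>, and \<open>\<eta>\<close> is small enough for the decrease of \<open>F\<close> to dominate that of the variance.\<close>
  have "Y 1 \<le> Y 0"
  proof (rule DERIV_nonpos_imp_nonincreasing[where f = Y])
    fix t :: real assume t: "0 \<le> t" "t \<le> 1"
    define v' where "v' = 2 * mean (\<lambda>x. P t f x * L (P t f) x)"
    have "(Y has_real_derivative (exp (- \<mu> * t) * F' t + exp (- \<mu> * t) * (- \<mu>) * F t - \<eta> * v' - B)) (at t)"
      unfolding Y_def v'_def
      by (intro DERIV_diff DERIV_mult' dF DERIV_cmult var_P_deriv) (auto intro!: derivative_eq_intros)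
    moreover have "exp (- \<mu> * t) * F' t + exp (- \<mu> * t) * (- \<mu>) * F t - \<eta> * v' - B \<le> 0"
    proof -
      have e: "exp (- \<mu>) \<le> exp (- \<mu> * t)" "exp (- \<mu> * t) \<le> 1" using \<mu> t by (auto simp: mult_left_le)
      have E0: "0 \<le> E t" unfolding E_def by (intro sum_nonneg N)
      have "exp (- \<mu> * t) * (F' t - \<mu> * F t) \<le> exp (- \<mu> * t) * (- (c * (1 - \<rho>) / 2) * E t + B)"
        using F'[OF t] by (intro mult_left_mono) auto
      also have "\<dots> = exp (- \<mu> * t) * B - exp (- \<mu> * t) * (c * (1 - \<rho>) / 2 * E t)" by (simp add: algebra_simps)
      also have "\<dots> \<le> 1 * B - exp (- \<mu>) * (c * (1 - \<rho>) / 2 * E t)"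
        using e B E0 c \<rho>_less by (intro diff_mono mult_right_mono) auto
      finally have 1: "exp (- \<mu> * t) * (F' t - \<mu> * F t) \<le> B - \<eta> * (E t / 2)" by (simp add: \<eta>_def mult_ac)
      have "- (E t / 2) \<le> v'" using dissipation_bounds(2)[of "P t f"] by (simp add: v'_def E)
      then have "- \<eta> * v' \<le> \<eta> * (E t / 2)" using mult_left_mono[of "- (E t / 2)" v' \<eta>] \<eta> by simp
      then show ?thesis using 1 by (simp add: algebra_simps)
    qed
    ultimately show "\<exists>y. (Y has_real_derivative y) (at t) \<and> y \<le> 0" by blast
  qed simp
  moreover have "- \<eta> * var (P 1 f) - B \<le> Y 1" using F0[of 1] by (simp add: Y_def)
  moreover have "Y 0 = 4 * T - \<eta> * var f"
  proof -
    have "N 0 i = 4 * infl f i" if "i \<in> V" for i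
      unfolding N_def using mean_D_square_boolean[OF f that] by (simp add: disc_deriv_def)
    then have "F 0 = (\<Sum>i\<in>V. \<omega> i * (4 * infl f i))" unfolding F_def by (intro sum.cong) auto
    also have "\<dots> = 4 * T" unfolding \<omega>_infl[symmetric] by (simp add: sum_distrib_left mult_ac)
    finally show ?thesis by (simp add: Y_def var_def mean_P)
  qed
  ultimately have "\<eta> * (var f - var (P 1 f)) \<le> 4 * T + B" by (simp add: algebra_simps)
  moreover have "\<eta> * ((1 - exp (- gap)) * var f) \<le> \<eta> * (var f - var (P 1 f))"
    using var_P_decay[of 1 f] \<eta> by (intro mult_left_mono) (auto simp: gap_def algebra_simps)
  ultimately have "\<eta> * (1 - exp (- gap)) * var f \<le> (4 + 2 * c * C\<^sup>2) * T"
    by (simp add: B_def algebra_simps)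
  moreover have "0 < 4 + 2 * c * C\<^sup>2" using c by (intro add_pos_nonneg) auto
  ultimately have "talagrand_const * var f \<le> T"
    by (simp add: talagrand_const_def \<eta>_def c_def C_def \<mu>_def pos_divide_le_eq mult_ac)
  then show ?thesis using A_tal by (simp add: T_def)
qed

text \<open>If the maximal influence is at least \<open>1 / sqrt n\<close>, use \<open>ln n \<le> 2 * sqrt n\<close>; otherwise all the
  logarithms in Talagrand's inequality are at least \<open>ln n / 2\<close>.\<close>
lemma var_le_max_infl:
  assumes f: "boolean f" and M: "\<And>i. i \<in> V \<Longrightarrow> infl f i \<le> M" "0 \<le> M" "M \<le> 1"
  shows "min talagrand_const 1 / 2 * (ln (real n) / real n) * var f \<le> M"
proof -
  define N where "N = real n"
  have N: "1 \<le> N" using n_pos by (simp add: N_def)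
  define C where "C = min talagrand_const 1"
  have C: "0 < C" "C \<le> 1" "C \<le> talagrand_const" using talagrand_const_pos by (auto simp: C_def)
  have v: "0 \<le> var f" "var f \<le> 1" using var_nonneg var_boolean_le_1[OF f] by auto
  have lnN: "0 \<le> ln N" using N by simp
  show ?thesis
  proof (cases "1 / sqrt N \<le> M")
    case True
    have "ln N = 2 * ln (sqrt N)" using N by (simp add: ln_sqrt)
    also have "ln (sqrt N) \<le> sqrt N - 1" using N by (intro ln_le_minus_one) auto
    finally have l: "ln N \<le> 2 * sqrt N" by simp
    have "C / 2 * (ln N / N) * var f \<le> 1 / 2 * (2 * sqrt N / N) * 1"
      using C l v N lnN by (intro mult_mono divide_right_mono) auto
    also have "\<dots> = 1 / sqrt N" using N by (simp add: real_div_sqrt divide_simps)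
    finally show ?thesis using True by (simp add: C_def N_def)
  next
    case False
    have "C * var f \<le> talagrand_const * var f" using C v by (intro mult_right_mono) auto
    also have "\<dots> \<le> (\<Sum>i\<in>V. talagrand (infl f i))" by (rule var_le_sum_talagrand[OF f])
    also have "\<dots> \<le> (\<Sum>i\<in>V. talagrand M)" using M infl_bounds by (intro sum_mono talagrand_mono) auto
    also have "\<dots> = N * talagrand M" by (simp add: N_def)
    finally have 1: "C * var f \<le> N * talagrand M" .
    show ?thesis
    proof (cases "M = 0")
      case True
      then have "C * var f \<le> 0" using 1 by simp
      then have "var f = 0" using C v by (simp add: mult_le_0_iff)
      then show ?thesis using M by simp
    next
      case M0: False
      then have Mp: "0 < M" using M by simp
      have "ln N / 2 = ln (sqrt N)" using N by (simp add: ln_sqrt)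
      also have "\<dots> \<le> ln (1 / M)" using False Mp N by (subst ln_le_cancel_iff) (auto simp: field_simps)
      finally have l: "ln N / 2 \<le> 1 + ln (1 / M)" by simp
      have lp: "0 < 1 + ln (1 / M)" using one_plus_ln_inverse_ge_1[of M] M by linarith
      have "C * var f * (ln N / 2) \<le> C * var f * (1 + ln (1 / M))"
        using l C v by (intro mult_left_mono) auto
      also have "\<dots> \<le> N * M"
        using 1 lp by (simp add: talagrand_def pos_le_divide_eq)
      finally show ?thesis using N by (simp add: C_def N_def field_simps)
    qed
  qed
qed

definition "final_const =
  min (min (min talagrand_const 1 / 2) talagrand_const) (min (iso_const * sqrt log_var_rate) eldan_gross_const)"

lemma final_const_pos: "0 < final_const"
  unfolding final_const_def
  using talagrand_const_pos iso_const_pos log_var_rate_pos eldan_gross_const_pos by simp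

lemma final_const_le:
  "final_const \<le> min talagrand_const 1 / 2" "final_const \<le> talagrand_const"
  "final_const \<le> iso_const * sqrt log_var_rate" "final_const \<le> eldan_gross_const"
  unfolding final_const_def by (auto intro: min.coboundedI1 min.coboundedI2)

end

section \<open>The Ising model\<close>
definition local_field :: "nat \<Rightarrow> (nat \<Rightarrow> nat \<Rightarrow> real) \<Rightarrow> nat \<Rightarrow> (nat \<Rightarrow> real) \<Rightarrow> real" where
  "local_field n J i x = (\<Sum>j\<in>{1..n} - {i}. J i j * x j)"

definition logistic :: "real \<Rightarrow> real" where
  "logistic s = 1 / (1 + exp (- s))"

lemma logistic_lipschitz: "\<bar>logistic a - logistic b\<bar> \<le> \<bar>a - b\<bar> / 4"
proof -
  have less: "\<bar>logistic b - logistic a\<bar> \<le> (b - a) / 4" if ab: "a < b" for a b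
  proof -
    have pos: "0 < 1 + exp (- s)" for s :: real by (simp add: add_pos_pos)
    have der: "(logistic has_real_derivative exp (- s) / (1 + exp (- s))\<^sup>2) (at s)" for s
      unfolding logistic_def using pos[of s]
      by (auto intro!: derivative_eq_intros simp: power2_eq_square)
    obtain z where z: "logistic b - logistic a = (b - a) * (exp (- z) / (1 + exp (- z))\<^sup>2)"
      using MVT2[OF ab, of logistic "\<lambda>s. exp (- s) / (1 + exp (- s))\<^sup>2"] der by blast
    have "4 * exp (- z) \<le> (1 + exp (- z))\<^sup>2"
      using zero_le_power2[of "1 - exp (- z)"] by (simp add: power2_eq_square algebra_simps)
    then have "exp (- z) / (1 + exp (- z))\<^sup>2 \<le> 1 / 4" using pos[of z] by (simp add: field_simps)
    moreover have "0 \<le> exp (- z) / (1 + exp (- z))\<^sup>2" by simp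
    ultimately have "\<bar>logistic b - logistic a\<bar> \<le> (b - a) * (1 / 4)"
      using ab unfolding z abs_mult by (intro mult_mono) auto
    then show ?thesis by simp
  qed
  show ?thesis
    using less[of a b] less[of b a] by (cases a b rule: linorder_cases) (auto simp: abs_minus_commute)
qed

lemma logistic_mono: "a \<le> b \<Longrightarrow> logistic a \<le> logistic b"
  unfolding logistic_def by (intro divide_left_mono mult_pos_pos add_pos_pos) auto

lemma logistic_2: "logistic (- 2) = 1 / (1 + exp 2)" "logistic 2 = 1 - 1 / (1 + exp 2)"
proof -
  have "0 < 1 + exp (2::real)" by (simp add: add_pos_pos)
  then show "logistic (- 2) = 1 / (1 + exp 2)" "logistic 2 = 1 - 1 / (1 + exp 2)"
    by (auto simp: logistic_def exp_minus field_simps)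
qed

text \<open>The energy is affine in the spin at \<open>i\<close>: the diagonal entry contributes a constant because the square of
  a spin is 1, and by symmetry row and column \<open>i\<close> contribute the local field twice.\<close>
lemma ising_weight_upd:
  assumes sym: "symmetric_matrix n J" and i: "i \<in> {1..n}"
  obtains R where "\<And>s. s = 1 \<or> s = -1 \<Longrightarrow> ising_weight n J (x(i := s)) = exp (R + s * local_field n J i x)"
proof -
  define V where "V = {1..n}"
  have fin: "finite V" and iV: "i \<in> V" using i by (auto simp: V_def)
  define R where "R = (J i i + (\<Sum>a\<in>V - {i}. \<Sum>b\<in>V - {i}. x a * J a b * x b)) / 2"
  have "ising_weight n J (x(i := s)) = exp (R + s * local_field n J i x)" if s: "s = 1 \<or> s = -1" for s
  proof -
    define y where "y = x(i := s)"
    have yi: "y i = s" and ya: "y a = x a" if "a \<in> V - {i}" for a using that by (auto simp: y_def)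
    have ss: "s * s = 1" using s by auto
    have row: "(\<Sum>b\<in>V. y a * J a b * y b) = s * (J a i * x a) + (\<Sum>b\<in>V - {i}. x a * J a b * x b)" if a: "a \<in> V - {i}" for a
      using a by (simp add: sum.remove[OF fin iV] y_def mult_ac)
    have row_i: "(\<Sum>b\<in>V. y i * J i b * y b) = J i i + s * (\<Sum>b\<in>V - {i}. J i b * x b)"
    proof -
      have "y i * J i i * y i = s * s * J i i" by (simp add: y_def)
      moreover have "(\<Sum>b\<in>V - {i}. y i * J i b * y b) = (\<Sum>b\<in>V - {i}. s * (J i b * x b))"
        by (intro sum.cong refl) (auto simp: y_def)
      ultimately show ?thesis using ss by (simp add: sum.remove[OF fin iV] sum_distrib_left)
    qed
    have "(\<Sum>a\<in>V. \<Sum>b\<in>V. y a * J a b * y b)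
      = (\<Sum>b\<in>V. y i * J i b * y b) + (\<Sum>a\<in>V - {i}. \<Sum>b\<in>V. y a * J a b * y b)"
      by (rule sum.remove[OF fin iV])
    also have "(\<Sum>a\<in>V - {i}. \<Sum>b\<in>V. y a * J a b * y b)
      = (\<Sum>a\<in>V - {i}. s * (J a i * x a) + (\<Sum>b\<in>V - {i}. x a * J a b * x b))"
      by (intro sum.cong refl row)
    also have "\<dots> = s * (\<Sum>a\<in>V - {i}. J a i * x a) + (\<Sum>a\<in>V - {i}. \<Sum>b\<in>V - {i}. x a * J a b * x b)"
      by (simp add: sum.distrib sum_distrib_left)
    also have "(\<Sum>a\<in>V - {i}. J a i * x a) = (\<Sum>a\<in>V - {i}. J i a * x a)"
      using sym iV by (intro sum.cong refl) (auto simp: symmetric_matrix_def V_def)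
    finally have "1 / 2 * (\<Sum>a\<in>V. \<Sum>b\<in>V. y a * J a b * y b) = R + s * local_field n J i x"
      unfolding row_i by (simp add: R_def local_field_def V_def algebra_simps)
    then show ?thesis by (simp only: ising_weight_def y_def V_def)
  qed
  then show ?thesis by (rule that)
qed

lemma heat_bath_ising:
  assumes sym: "symmetric_matrix n J" and i: "i \<in> {1..n}"
  shows "heat_bath (ising_weight n J) i x = logistic (2 * local_field n J i x)"
proof -
  obtain R where R: "\<And>s. s = 1 \<or> s = -1 \<Longrightarrow> ising_weight n J (x(i := s)) = exp (R + s * local_field n J i x)"
    by (rule ising_weight_upd[OF sym i]) blast
  define h where "h = local_field n J i x"
  have "heat_bath (ising_weight n J) i x = exp (R + h) / (exp (R + h) + exp (R - h))"
    unfolding heat_bath_def using R[of 1] R[of "-1"] by (simp add: h_def)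
  also have "exp (R + h) + exp (R - h) = exp (R + h) * (1 + exp (- (2 * h)))"
    by (simp add: distrib_left exp_add[symmetric])
  finally show ?thesis by (simp add: logistic_def h_def)
qed

lemma norm1_bounds:
  assumes "symmetric_matrix n J" "i \<in> {1..n}"
  shows "(\<Sum>j\<in>{1..n}. \<bar>J i j\<bar>) \<le> norm1 n J" "0 \<le> norm1 n J"
proof -
  have "(\<Sum>j\<in>{1..n}. \<bar>J i j\<bar>) = (\<Sum>j\<in>{1..n}. \<bar>J j i\<bar>)"
    using assms by (intro sum.cong refl) (auto simp: symmetric_matrix_def)
  also have "\<dots> \<le> norm1 n J" unfolding norm1_def using assms(2) by (intro Max_ge) auto
  finally show 1: "(\<Sum>j\<in>{1..n}. \<bar>J i j\<bar>) \<le> norm1 n J" .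
  have "0 \<le> (\<Sum>j\<in>{1..n}. \<bar>J i j\<bar>)" by (intro sum_nonneg) auto
  then show "0 \<le> norm1 n J" using 1 by linarith
qed

lemma local_field_bound:
  assumes sym: "symmetric_matrix n J" and J: "norm1 n J < 1" and i: "i \<in> {1..n}" and x: "x \<in> cube n"
  shows "\<bar>local_field n J i x\<bar> \<le> 1"
proof -
  have "\<bar>local_field n J i x\<bar> \<le> (\<Sum>j\<in>{1..n} - {i}. \<bar>J i j * x j\<bar>)"
    unfolding local_field_def by (rule sum_abs)
  also have "\<dots> = (\<Sum>j\<in>{1..n} - {i}. \<bar>J i j\<bar>)"
    using cube_cases[OF x] by (intro sum.cong refl) (fastforce simp: abs_mult)
  also have "\<dots> \<le> (\<Sum>j\<in>{1..n}. \<bar>J i j\<bar>)" by (intro sum_mono2) auto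
  also have "\<dots> \<le> 1" using norm1_bounds(1)[OF sym i] J by linarith
  finally show ?thesis .
qed

lemma local_field_upd:
  assumes "i \<in> {1..n}" "i \<noteq> j"
  shows "local_field n J j (x(i := 1)) - local_field n J j (x(i := -1)) = 2 * J j i"
proof -
  have "local_field n J j (x(i := 1)) - local_field n J j (x(i := -1))
    = (\<Sum>k\<in>{1..n} - {j}. if k = i then 2 * J j i else 0)"
    unfolding local_field_def sum_subtractf[symmetric] by (intro sum.cong) auto
  then show ?thesis using assms by simp
qed

lemma spin_system_ising:
  assumes n: "1 \<le> n" and sym: "symmetric_matrix n J" and J: "norm1 n J < 1"
  shows "spin_system n (ising_weight n J) (\<lambda>i j. \<bar>J i j\<bar>) (1 / (1 + exp 2)) (norm1 n J)"
proof
  show "0 < ising_weight n J x" for x by (simp add: ising_weight_def)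
  show "1 \<le> n" by (rule n)
  show "0 < 1 / (1 + exp (2::real))" by (simp add: add_pos_pos)
  show "0 \<le> norm1 n J" using norm1_bounds(2)[OF sym, of 1] n by simp
  show "norm1 n J < 1" by (rule J)
  fix x i assume x: "x \<in> cube n" and i: "i \<in> {1..n}"
  have "\<bar>local_field n J i x\<bar> \<le> 1" by (rule local_field_bound[OF sym J i x])
  then have "- 2 \<le> 2 * local_field n J i x" "2 * local_field n J i x \<le> 2" by auto
  from this[THEN logistic_mono]
  show "1 / (1 + exp 2) \<le> heat_bath (ising_weight n J) i x"
    "heat_bath (ising_weight n J) i x \<le> 1 - 1 / (1 + exp 2)"
    by (auto simp: heat_bath_ising[OF sym i] logistic_2)
next
  fix i j assume "i \<in> {1..n}" "j \<in> {1..n}"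
  then show "\<bar>J i j\<bar> = \<bar>J j i\<bar>" using sym by (simp add: symmetric_matrix_def)
next
  fix i assume "i \<in> {1..n}"
  then show "(\<Sum>j\<in>{1..n}. \<bar>J i j\<bar>) \<le> norm1 n J" by (rule norm1_bounds(1)[OF sym])
next
  fix x i j assume ij: "i \<in> {1..n}" "j \<in> {1..n}" "i \<noteq> j"
  have "\<bar>disc_deriv i (heat_bath (ising_weight n J) j) x\<bar>
    \<le> \<bar>2 * local_field n J j (x(i := 1)) - 2 * local_field n J j (x(i := -1))\<bar> / 4"
    unfolding disc_deriv_def heat_bath_ising[OF sym ij(2)] by (rule logistic_lipschitz)
  also have "2 * local_field n J j (x(i := 1)) - 2 * local_field n J j (x(i := -1)) = 4 * J j i"
    using local_field_upd[OF ij(1,3), of J x] by simp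
  also have "\<bar>4 * J j i\<bar> / 4 = \<bar>J i j\<bar>" using sym ij by (simp add: symmetric_matrix_def abs_mult)
  finally show "\<bar>disc_deriv i (heat_bath (ising_weight n J) j) x\<bar> \<le> \<bar>J i j\<bar>" .
qed auto

lemma expectation_ising:
  assumes "spin_system n (ising_weight n J) d a r"
  shows "measure_pmf.expectation (ising n J) f = spin_system.mean n (ising_weight n J) f"
proof -
  interpret spin_system n "ising_weight n J" d a r by fact
  have "measure_pmf.expectation (ising n J) f = (\<Sum>x\<in>cube n. f x * pmf (ising n J) x)"
    by (rule integral_measure_pmf_real[OF finite_cube]) (auto simp: set_pmf_eq pmf_ising split: if_splits)
  also have "\<dots> = (\<Sum>x\<in>cube n. ising_weight n J x * f x / ising_Z n J)"
    by (intro sum.cong) (auto simp: pmf_ising)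
  finally show ?thesis by (simp add: mean_def ising_Z_def sum_divide_distrib)
qed

lemma influence_ising:
  assumes "spin_system n (ising_weight n J) d a r"
  shows "influence (ising n J) f i = spin_system.infl n (ising_weight n J) f i"
proof -
  interpret spin_system n "ising_weight n J" d a r by fact
  have "influence (ising n J) f i = measure_pmf.expectation (ising n J) (indicator {x. f (flip i x) \<noteq> f x})"
    by (simp add: influence_def)
  also have "\<dots> = mean (indicator {x. f (flip i x) \<noteq> f x})" by (rule expectation_ising[OF assms])
  also have "\<dots> = infl f i" unfolding infl_def by (intro mean_cong) (auto simp: indicator_def)
  finally show ?thesis .
qed

theorem corollary1p2:
  shows "\<exists>C :: real \<Rightarrow> real. \<forall>(n :: nat) (J :: nat \<Rightarrow> nat \<Rightarrow> real).
    n \<ge> 1 \<and> symmetric_matrix n J \<and> norm1 n J < 1 \<longrightarrow>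
    C (norm1 n J) > 0 \<and>
    (\<forall>f \<in> cube n \<rightarrow> {-1, 1}.
      (MAX i\<in>{1..n}. influence (ising n J) f i)
        \<ge> C (norm1 n J) * (ln (real n) / real n) * Var (ising n J) f \<and>
      C (norm1 n J) * Var (ising n J) f
        \<le> (\<Sum>i\<in>{1..n}. if influence (ising n J) f i = 0 then 0
              else influence (ising n J) f i / (1 + ln (1 / influence (ising n J) f i))) \<and>
      SA n (ising n J) f
        \<ge> (if Var (ising n J) f = 0 then 0
            else C (norm1 n J) * Var (ising n J) f * sqrt (ln (exp 1 / Var (ising n J) f))) \<and>
      SA n (ising n J) f
        \<ge> (if Var (ising n J) f = 0 then 0
            else C (norm1 n J) * Var (ising n J) f *
              sqrt (ln (1 + exp 1 / SqInf n (ising n J) f))))"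
proof (rule exI[of _ "spin_system.final_const (1 / (1 + exp 2))"], intro allI impI, elim conjE, intro conjI ballI)
  fix n :: nat and J :: "nat \<Rightarrow> nat \<Rightarrow> real"
  assume n: "1 \<le> n" and sym: "symmetric_matrix n J" and J: "norm1 n J < 1"
  note sys = spin_system_ising[OF n sym J]
  interpret spin_system n "ising_weight n J" "\<lambda>i j. \<bar>J i j\<bar>" "1 / (1 + exp 2)" "norm1 n J"
    by (rule sys)
  let ?C = "spin_system.final_const (1 / (1 + exp 2)) (norm1 n J)"
  show "0 < ?C" by (rule final_const_pos)
  fix f assume "f \<in> cube n \<rightarrow> {- 1, 1 :: real}"
  then have f: "boolean f" unfolding boolean_def by fastforce
  have Var: "Var (ising n J) f = var f" by (simp add: Var_def var_def expectation_ising[OF sys])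
  have inf: "influence (ising n J) f i = infl f i" for i by (rule influence_ising[OF sys])
  have SA: "SA n (ising n J) f = sens f" by (simp add: SA_def sens_def expectation_ising[OF sys])
  have Sq: "SqInf n (ising n J) f = (\<Sum>i\<in>{1..n}. (infl f i)\<^sup>2)" by (simp add: SqInf_def inf)
  note v = var_nonneg[of f] var_boolean_le_1[OF f]
  show "?C * (ln (real n) / real n) * Var (ising n J) f \<le> (MAX i\<in>{1..n}. influence (ising n J) f i)"
    unfolding Var inf
  proof -
    let ?M = "MAX i\<in>{1..n}. infl f i"
    have fin: "finite (infl f ` {1..n})" and ne: "infl f ` {1..n} \<noteq> {}" using n by auto
    have le: "infl f i \<le> ?M" if "i \<in> {1..n}" for i using that fin by (intro Max_ge) auto
    have "?M \<in> infl f ` {1..n}" by (rule Max_in[OF fin ne])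
    then have "0 \<le> ?M" "?M \<le> 1" using infl_bounds[of f] by auto
    then have "min talagrand_const 1 / 2 * (ln (real n) / real n) * var f \<le> ?M"
      using le by (intro var_le_max_infl[OF f]) auto
    moreover have "?C * (ln (real n) / real n) * var f \<le> min talagrand_const 1 / 2 * (ln (real n) / real n) * var f"
      using final_const_le(1) v n by (intro mult_right_mono) auto
    ultimately show "?C * (ln (real n) / real n) * var f \<le> ?M" by linarith
  qed
  show "?C * Var (ising n J) f \<le> (\<Sum>i\<in>{1..n}. if influence (ising n J) f i = 0 then 0
    else influence (ising n J) f i / (1 + ln (1 / influence (ising n J) f i)))"
    unfolding Var inf
  proof -
    have "?C * var f \<le> talagrand_const * var f" using final_const_le(2) v by (intro mult_right_mono) auto
    also have "\<dots> \<le> (\<Sum>i\<in>{1..n}. talagrand (infl f i))" by (rule var_le_sum_talagrand[OF f])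
    also have "\<dots> = (\<Sum>i\<in>{1..n}. if infl f i = 0 then 0 else infl f i / (1 + ln (1 / infl f i)))"
      by (intro sum.cong refl) (simp add: talagrand_def)
    finally show "?C * var f \<le> \<dots>" .
  qed
  show "(if Var (ising n J) f = 0 then 0
    else ?C * Var (ising n J) f * sqrt (ln (exp 1 / Var (ising n J) f))) \<le> SA n (ising n J) f"
  proof (cases "var f = 0")
    case False
    then have vp: "0 < var f" using v by simp
    have e: "ln (exp 1 / var f) = 1 + ln (1 / var f)" using vp by (simp add: ln_div)
    have "?C * var f * sqrt (1 + ln (1 / var f)) \<le> (iso_const * sqrt log_var_rate) * var f * sqrt (1 + ln (1 / var f))"
      using final_const_le(3) vp v by (intro mult_right_mono) auto
    also have "\<dots> = iso_const * var f * sqrt (log_var_rate * (1 + ln (1 / var f)))"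
      by (simp add: real_sqrt_mult)
    also have "\<dots> \<le> sens f" by (rule sens_ge_log_var_sq[OF f vp])
    finally show ?thesis using False by (simp add: Var SA e)
  qed (simp add: Var SA sens_nonneg)
  show "(if Var (ising n J) f = 0 then 0
    else ?C * Var (ising n J) f * sqrt (ln (1 + exp 1 / SqInf n (ising n J) f))) \<le> SA n (ising n J) f"
  proof (cases "var f = 0")
    case False
    then have vp: "0 < var f" using v by simp
    have "0 \<le> (\<Sum>i\<in>{1..n}. (infl f i)\<^sup>2)" by (intro sum_nonneg) auto
    then have "?C * var f * sqrt (ln (1 + exp 1 / (\<Sum>i\<in>{1..n}. (infl f i)\<^sup>2)))
      \<le> eldan_gross_const * var f * sqrt (ln (1 + exp 1 / (\<Sum>i\<in>{1..n}. (infl f i)\<^sup>2)))"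
      using final_const_le(4) v by (intro mult_right_mono) auto
    also have "\<dots> \<le> sens f" by (rule sens_ge_log_sqinf[OF f vp])
    finally show ?thesis using False by (simp add: Var SA Sq)
  qed (simp add: Var SA sens_nonneg)
qed

end
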